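(* Let $G=SL(n,\mathbb{C})$, let $P\subset G$ be the block upper triangular parabolic subgroup associated to a non-symmetric dimension sequence $f$ of total $n$, let $Z=G/P$, and let $D\subset Z$ be an open (non-measurable) $SL(n,\mathbb{R})$-orbit with base cycle $C_0$. Let $\hat D\subset\hat Z=G/\hat P$ be the measurable model of $D$, with base cycle $\hat C_0$ and projection $\pi:\hat Z\to Z$. Let $(d_1,\dots,d_s)$ be the (symmetric) dimension sequence of $\hat P$, and write $f=(f_{\delta_1},\dots,f_{\delta_p})$ with $f_{\delta_j}=\sum_{i=\delta_{j-1}+1}^{\delta_j}d_i$, where $\delta_0=0$, $\delta_j=t_1+\dots+t_j$, for the unique sequence $t=(t_1,\dots,t_p)$ of positive integers with $t_1+\dots+t_p=s$. Let $S_{\hat w}\in\mathcal{S}_{\hat C_0}$ with minimal representative $\hat w=B_1\dots B_s$ in block form, and let $w=C_1\dots C_p$, where $C_j=\bigcup_{i=\delta_{j-1}+1}^{\delta_j}B_i$ arranged in increasing order. Then $S_{\hat w}$ is mapped under the projection $\pi$ to a Schubert variety $S_w\in\mathcal{S}_{C_0}$ if and only if all the blocks $C_j$ with $t_j>1$ of $w$ come from groups of blocks $B_{\delta_{j-1}+1},\dots,B_{\delta_j}$ arranged in strictly decreasing order in $\hat w$.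
   Context: For a dimension sequence $(f_1,\dots,f_u)$ with $\sum f_i=n$, $P$ is the group of block upper triangular matrices in $G$ with blocks of these sizes, and $G/P$ is the manifold of partial flags $0\subset V_1\subset\dots\subset V_u=\mathbb{C}^n$ with $\dim V_i=f_1+\dots+f_i=:r_i$. The sequence is symmetric if it reads the same backwards; open $SL(n,\mathbb{R})$-orbits in $G/P$ are called measurable if the sequence is symmetric and non-measurable otherwise. Let $G_0=SL(n,\mathbb{R})$, $K_0=SO(n,\mathbb{R})$. Each open $G_0$-orbit contains a unique $K_0$-orbit which is a complex submanifold, called its base cycle; it is the set of isotropic flags in the open orbit, i.e. flags with $\dim(V_i\cap V_j^\perp)=\min\{r_i,n-r_j\}$ for all $i,j$, where $\perp$ is with respect to $b(v,w)=v^tw$. Measurable model: $\hat P\subset P$ is the block upper triangular parabolic subgroup whose dimension sequence is the symmetric sequence with set of partial sums $\{r_i\}\cup\{n-r_i\}\setminus\{0\}$, i.e. the coarsest common refinement of the dimension sequence of $P$ and its reverse (for example $(2,4,3)$ gives $(2,1,3,1,2)$, with $t=(1,2,2)$). $\pi:\hat Z=G/\hat P\to Z=G/P$ is the projection forgetting subspaces, and $\hat D$ is the open $G_0$-orbit in $\hat Z$ with $\pi(\hat D)=D$. Schubert varieties are closures of orbits of the group $B$ of upper triangular matrices in $G$. In $G/P$ they are parametrized by minimal coset representatives $w$, i.e. permutations of $\{1,\dots,n\}$ whose one-line notation is increasing inside each block of positions determined by the dimension sequence; $S_w$ is the closure of the $B$-orbit of the flag with $i$-th subspace $\langle e_{w(1)},\dots,e_{w(r_i)}\rangle$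 (similarly for $S_{\hat w}$ in $\hat Z$). The block form $\hat w=B_1\dots B_s$ is the division of the one-line notation into consecutive blocks of sizes $d_1,\dots,d_s$. $\mathcal{S}_{C_0}$ is the set of Schubert varieties $S\subset Z$ with $S\cap C_0\neq\emptyset$ and $\dim S+\dim C_0=\dim Z$; $\mathcal{S}_{\hat C_0}$ is the analogous set in $\hat Z$ for $\hat C_0$. The group of blocks $B_{\delta_{j-1}+1},\dots,B_{\delta_j}$ forming $C_j$ is in strictly decreasing order if the last element of $B_{i+1}$ is smaller than the first element of $B_i$ for all $\delta_{j-1}+1\le i\le\delta_j-1$. *)

theory Defs
  imports "HOL-Analysis.Analysis"
begin

text \<open>
  The index set \<open>{1..n}\<close> is modelled by an arbitrary finite linearly ordered type \<open>'n\<close> with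
  \<open>CARD('n) = n\<close>. A permutation of \<open>{1..n}\<close> in one-line notation is a list over \<open>'n\<close> in which
  every element occurs exactly once, and its block form is the corresponding list of lists.
\<close>

definition partial_sum :: "nat list \<Rightarrow> nat \<Rightarrow> nat" where
  "partial_sum f k = sum_list (take k f)"

definition partial_sums :: "nat list \<Rightarrow> nat set" where
  "partial_sums f = partial_sum f ` {1..length f}"

definition dimension_sequence :: "nat \<Rightarrow> nat list \<Rightarrow> bool" where
  "dimension_sequence n f \<longleftrightarrow> (\<forall>x\<in>set f. 0 < x) \<and> sum_list f = n"

definition symmetric_sequence :: "nat list \<Rightarrow> bool" where
  "symmetric_sequence f \<longleftrightarrow> rev f = f"

text \<open>The dimension sequence of the parabolic subgroup of the measurable model.\<close>

definition symmetric_refinement :: "nat \<Rightarrow> nat list \<Rightarrow> nat list \<Rightarrow> bool" where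
  "symmetric_refinement n f d \<longleftrightarrow>
     dimension_sequence n d \<and> symmetric_sequence d \<and>
     partial_sums d = (partial_sums f \<union> (\<lambda>r. n - r) ` partial_sums f) - {0}"

type_synonym 'n flag = "(complex^'n) set list"

text \<open>
  A point of \<open>G/P\<close> is the list \<open>[V\<^sub>1, \<dots>, V\<^sub>u]\<close> of the nonzero members of a partial flag, the last
  one being the whole space. Subspaces, dimensions and spans are taken over the complex numbers.
\<close>

definition flags :: "nat list \<Rightarrow> ('n::finite) flag set" where
  "flags f = {V. length V = length f \<and>
     (\<forall>i<length f. vec.subspace (V ! i) \<and> vec.dim (V ! i) = partial_sum f (Suc i)) \<and>
     (\<forall>i j. i < j \<longrightarrow> j < length f \<longrightarrow> V ! i \<subseteq> V ! j)}"

definition SL_complex :: "(complex^('n::finite)^('n::finite)) set" where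
  "SL_complex = {A. det A = 1}"

definition SL_real :: "(complex^('n::finite)^('n::finite)) set" where
  "SL_real = {A \<in> SL_complex. \<forall>i j. A $ i $ j \<in> \<real>}"

definition borel_subgroup :: "(complex^('n::{finite,linorder})^('n::{finite,linorder})) set" where
  "borel_subgroup = {A \<in> SL_complex. \<forall>i j. j < i \<longrightarrow> A $ i $ j = 0}"

text \<open>The index \<open>i\<close> is the element of \<open>'n\<close> at position \<open>card {..<i}\<close>, counted from 0.\<close>

definition parabolic :: "nat list \<Rightarrow> (complex^('n::{finite,linorder})^('n::{finite,linorder})) set" where
  "parabolic f = {A \<in> SL_complex.
     \<forall>r\<in>partial_sums f. \<forall>i j. card {..<j} < r \<and> r \<le> card {..<i} \<longrightarrow> A $ i $ j = 0}"

definition act :: "complex^('n::finite)^('n::finite) \<Rightarrow> 'n flag \<Rightarrow> 'n flag" where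
  "act A V = map (\<lambda>W. (*v) A ` W) V"

definition orbit :: "(complex^('n::finite)^('n::finite)) set \<Rightarrow> 'n flag \<Rightarrow> 'n flag set" where
  "orbit H V = (\<lambda>A. act A V) ` H"

definition coordinate_flag :: "nat list \<Rightarrow> 'n list \<Rightarrow> ('n::finite) flag" where
  "coordinate_flag f w =
     map (\<lambda>k. vec.span {axis i 1 |i. i \<in> set (take (partial_sum f (Suc k)) w)}) [0..<length f]"

definition standard_flag :: "nat list \<Rightarrow> ('n::{finite,linorder}) flag" where
  "standard_flag f = coordinate_flag f (sorted_list_of_set UNIV)"

lemma standard_flag_nth:
  assumes "k < length f"
  shows "standard_flag f ! k =
    {v :: complex^('n::{finite,linorder}). \<forall>i. partial_sum f (Suc k) \<le> card {..<i} \<longrightarrow> v $ i = 0}"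
proof -
  let ?r = "partial_sum f (Suc k)"
  let ?I = "set (take ?r (sorted_list_of_set (UNIV :: 'n set)))"
  have I: "i \<in> ?I \<longleftrightarrow> card {..<i} < ?r" for i :: 'n
  proof -
    let ?xs = "sorted_list_of_set (UNIV :: 'n set)"
    obtain m where m: "m < length ?xs" "?xs ! m = i"
      by (metis UNIV_I finite in_set_conv_nth set_sorted_list_of_set)
    have "{..<i} = (!) ?xs ` {..<m}"
    proof (intro set_eqI iffI)
      fix j assume "j \<in> {..<i}"
      moreover obtain l where l: "l < length ?xs" "?xs ! l = j"
        by (metis UNIV_I finite in_set_conv_nth set_sorted_list_of_set)
      ultimately have "l < m"
        using m by (metis lessThan_iff not_le sorted_nth_mono sorted_sorted_list_of_set)
      then show "j \<in> (!) ?xs ` {..<m}" using l by blast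
    next
      fix j assume "j \<in> (!) ?xs ` {..<m}"
      then obtain l where l: "l < m" "?xs ! l = j" by blast
      then show "j \<in> {..<i}"
        using m sorted_wrt_nth_less[OF strict_sorted_list_of_set, of l m "UNIV::'n set"] by simp
    qed
    moreover have "inj_on ((!) ?xs) {..<m}"
      using m by (intro inj_on_nth) auto
    ultimately have c: "card {..<i} = m" by (simp add: card_image)
    have "i \<in> ?I \<longleftrightarrow> m < ?r"
    proof
      assume "i \<in> ?I"
      then obtain l where "l < ?r" "l < length ?xs" "?xs ! l = i"
        by (auto simp: in_set_conv_nth)
      then show "m < ?r" using m nth_eq_iff_index_eq[of ?xs l m] by simp
    next
      assume "m < ?r"
      then show "i \<in> ?I" using m by (force simp: in_set_conv_nth)
    qed
    then show ?thesis using c by simp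
  qed
  have span: "vec.span {axis i 1 |i. i \<in> ?I} = {v :: (complex, 'n) vec. \<forall>i. i \<notin> ?I \<longrightarrow> v $ i = 0}" (is "?L = ?R")
  proof
    have "vec.subspace ?R" by (auto simp: vec.subspace_def)
    moreover have "{axis i 1 |i. i \<in> ?I} \<subseteq> ?R" by (auto simp: axis_def)
    ultimately show "?L \<subseteq> ?R" by (simp add: vec.span_minimal)
    show "?R \<subseteq> ?L"
    proof
      fix v :: "(complex, 'n) vec" assume v: "v \<in> ?R"
      have "v = (\<Sum>i\<in>UNIV. v $ i *s axis i 1)" by (simp add: basis_expansion)
      also have "\<dots> = (\<Sum>i\<in>?I. v $ i *s axis i 1)"
        using v by (intro sum.mono_neutral_right) auto
      also have "\<dots> \<in> ?L"
        by (intro vec.span_sum vec.span_scale vec.span_base) blast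
      finally show "v \<in> ?L" .
    qed
  qed
  have "standard_flag f ! k = vec.span {axis i 1 |i :: 'n. i \<in> ?I}"
    using assms by (simp add: standard_flag_def coordinate_flag_def)
  then show ?thesis
    unfolding span by (simp only: I not_less)
qed

text \<open>The stabilizer of the standard flag is \<open>P\<close>, so the flag manifold is \<open>G/P\<close>.\<close>

lemma stabilizer_standard_flag:
  "{A \<in> SL_complex. act A (standard_flag f) = standard_flag f} = parabolic f"
proof -
  have main: "act A (standard_flag f) = standard_flag f \<longleftrightarrow>
     (\<forall>r\<in>partial_sums f. \<forall>i j. card {..<j} < r \<and> r \<le> card {..<i} \<longrightarrow> A $ i $ j = 0)"
    if A: "A \<in> SL_complex" for A :: "complex^('n::{finite,linorder})^('n::{finite,linorder})"
  proof -
    let ?F = "standard_flag f :: 'n flag"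
    have len: "length ?F = length f" by (simp add: standard_flag_def coordinate_flag_def)
    have inv: "inj ((*v) A)"
      using A by (simp add: SL_complex_def inj_matrix_vector_mult invertible_det_nz)
    have sub: "vec.subspace (?F ! k)" if "k < length f" for k
      using that by (auto simp: standard_flag_nth vec.subspace_def)
    have eq: "(*v) A ` (?F ! k) = ?F ! k \<longleftrightarrow> (*v) A ` (?F ! k) \<subseteq> ?F ! k" if k: "k < length f" for k
    proof
      assume "(*v) A ` (?F ! k) \<subseteq> ?F ! k"
      moreover have "vec.subspace ((*v) A ` (?F ! k))"
        using sub[OF k] by (simp add: vec.subspace_image)
      moreover have "vec.dim ((*v) A ` (?F ! k)) = vec.dim (?F ! k)"
        using inv by (intro vec.dim_image_eq) (auto simp: inj_on_def)
      ultimately show "(*v) A ` (?F ! k) = ?F ! k"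
        using sub[OF k] by (metis vec.subspace_dim_equal order_refl)
    qed auto
    have st: "(*v) A ` (?F ! k) \<subseteq> ?F ! k \<longleftrightarrow> (\<forall>i j. card {..<j} < partial_sum f (Suc k) \<and>
        partial_sum f (Suc k) \<le> card {..<i} \<longrightarrow> A $ i $ j = 0)" if k: "k < length f" for k
    proof (intro iffI allI impI)
      fix i j :: 'n assume s: "(*v) A ` (?F ! k) \<subseteq> ?F ! k" and
        ij: "card {..<j} < partial_sum f (Suc k) \<and> partial_sum f (Suc k) \<le> card {..<i}"
      have "axis j 1 \<in> ?F ! k" using ij k by (auto simp: standard_flag_nth axis_def)
      then have "A *v axis j 1 \<in> ?F ! k" using s by blast
      then have "(A *v axis j 1) $ i = 0" using ij k by (simp add: standard_flag_nth)
      then show "A $ i $ j = 0" 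
        by (simp add: matrix_vector_mult_def axis_def if_distrib cong: if_cong)
    next
      assume z: "\<forall>i j. card {..<j} < partial_sum f (Suc k) \<and>
        partial_sum f (Suc k) \<le> card {..<i} \<longrightarrow> A $ i $ j = 0"
      show "(*v) A ` (?F ! k) \<subseteq> ?F ! k"
      proof (clarsimp simp: standard_flag_nth[OF k])
        fix v :: "(complex, 'n) vec" and i :: 'n
        assume v: "\<forall>j. partial_sum f (Suc k) \<le> card {..<j} \<longrightarrow> v $ j = 0"
          and i: "partial_sum f (Suc k) \<le> card {..<i}"
        have "A $ i $ j * v $ j = 0" for j
          using z v i by (cases "card {..<j} < partial_sum f (Suc k)") auto
        then show "(A *v v) $ i = 0" 
          by (simp add: matrix_vector_mult_def sum.neutral del: mult_eq_0_iff)
      qed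
    qed
    have "act A ?F = ?F \<longleftrightarrow> (\<forall>k<length f. (*v) A ` (?F ! k) = ?F ! k)"
      by (simp add: act_def list_eq_iff_nth_eq len)
    also have "\<dots> \<longleftrightarrow> (\<forall>k<length f. \<forall>i j. card {..<j} < partial_sum f (Suc k) \<and>
        partial_sum f (Suc k) \<le> card {..<i} \<longrightarrow> A $ i $ j = 0)"
      using eq st by simp
    also have "\<dots> \<longleftrightarrow> (\<forall>r\<in>partial_sums f. \<forall>i j. card {..<j} < r \<and> r \<le> card {..<i} \<longrightarrow> A $ i $ j = 0)"
    proof -
      have "partial_sums f = (\<lambda>k. partial_sum f (Suc k)) ` {..<length f}"
        unfolding partial_sums_def using image_Suc_lessThan[of "length f"]
        by (metis image_image)
      then show ?thesis by auto
    qed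
    finally show ?thesis .
  qed
  then show ?thesis unfolding parabolic_def by blast
qed

text \<open>
  The topology of \<open>G/P\<close>: the quotient topology for the orbit map \<open>g \<mapsto> g \<cdot> standard_flag f\<close> of \<open>G\<close>.
\<close>

definition flag_topology :: "nat list \<Rightarrow> ('n::{finite,linorder}) flag topology" where
  "flag_topology f = topology (\<lambda>U. U \<subseteq> flags f \<and>
     openin (top_of_set SL_complex) {A \<in> SL_complex. act A (standard_flag f) \<in> U})"

lemma openin_flag_topology:
  "openin (flag_topology f) U \<longleftrightarrow> U \<subseteq> flags f \<and>
     openin (top_of_set SL_complex) {A \<in> SL_complex. act A (standard_flag f) \<in> U}"
proof -
  have int: "{A \<in> SL_complex. act A (standard_flag f) \<in> S \<inter> T} =
      {A \<in> SL_complex. act A (standard_flag f) \<in> S} \<inter> {A \<in> SL_complex. act A (standard_flag f) \<in> T}"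
    for S T :: "'a flag set" by auto
  have un: "{A \<in> SL_complex. act A (standard_flag f) \<in> \<Union>K} =
      (\<Union>S\<in>K. {A \<in> SL_complex. act A (standard_flag f) \<in> S})" for K :: "'a flag set set" by auto
  have "istopology (\<lambda>U. U \<subseteq> flags f \<and>
     openin (top_of_set SL_complex) {A \<in> SL_complex. act A (standard_flag f :: 'a flag) \<in> U})"
    unfolding istopology_def int un by (blast intro: openin_Int openin_Union)
  then show ?thesis
    unfolding flag_topology_def by (simp add: topology_inverse')
qed

text \<open>
  The complex dimension of a complex analytic subset: it is a locally finite union of complex
  manifolds, so its dimension is the largest \<open>d\<close> such that a nonempty open subset of
  \<open>\<complex>^d = \<real>^(2d)\<close> embeds in it.
\<close>

definition complex_dim :: "'a topology \<Rightarrow> 'a set \<Rightarrow> nat" where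
  "complex_dim X S = (GREATEST d. \<exists>U \<phi>. openin (Euclidean_space (2 * d)) U \<and> U \<noteq> {} \<and>
     embedding_map (subtopology (Euclidean_space (2 * d)) U) (subtopology X S) \<phi>)"

text \<open>\<open>forget f V\<close> keeps the members of \<open>V\<close> whose dimension is a partial sum of \<open>f\<close>.\<close>

definition forget :: "nat list \<Rightarrow> ('n::finite) flag \<Rightarrow> 'n flag" where
  "forget f V = filter (\<lambda>W. vec.dim W \<in> partial_sums f) V"

definition open_orbit :: "nat list \<Rightarrow> ('n::{finite,linorder}) flag set \<Rightarrow> bool" where
  "open_orbit f D \<longleftrightarrow> openin (flag_topology f) D \<and> (\<exists>V\<in>flags f. D = orbit SL_real V)"

definition perp :: "(complex^('n::finite)) set \<Rightarrow> (complex^('n::finite)) set" where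
  "perp W = {v. \<forall>w\<in>W. (\<Sum>i\<in>UNIV. v $ i * w $ i) = 0}"

definition isotropic :: "('n::finite) flag \<Rightarrow> bool" where
  "isotropic V \<longleftrightarrow> (\<forall>i<length V. \<forall>j<length V.
     vec.dim (V ! i \<inter> perp (V ! j)) = min (vec.dim (V ! i)) (CARD('n) - vec.dim (V ! j)))"

text \<open>
  The base cycle of an open orbit \<open>D\<close> of \<open>SL(n, \<real>)\<close>: the orbit of \<open>SO(n, \<real>)\<close> in \<open>D\<close> that is a
  complex submanifold consists exactly of the isotropic flags in \<open>D\<close>.
\<close>

definition base_cycle :: "('n::finite) flag set \<Rightarrow> 'n flag set" where
  "base_cycle D = {V \<in> D. isotropic V}"

definition block_form :: "nat list \<Rightarrow> ('n::{finite,linorder}) list list \<Rightarrow> bool" where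
  "block_form d Bs \<longleftrightarrow> map length Bs = d \<and> (\<forall>B\<in>set Bs. sorted B) \<and>
     distinct (concat Bs) \<and> set (concat Bs) = UNIV"

definition schubert_variety :: "nat list \<Rightarrow> 'n list \<Rightarrow> ('n::{finite,linorder}) flag set" where
  "schubert_variety f w = flag_topology f closure_of orbit borel_subgroup (coordinate_flag f w)"

definition schubert_varieties :: "nat list \<Rightarrow> ('n::{finite,linorder}) flag set set" where
  "schubert_varieties f = {flag_topology f closure_of orbit borel_subgroup V |V. V \<in> flags f}"

text \<open>The set \<open>\<S>\<^bsub>C\<^esub>\<close> for a cycle \<open>C\<close> in \<open>G/P\<close>.\<close>

definition complementary_schubert ::
    "nat list \<Rightarrow> ('n::{finite,linorder}) flag set \<Rightarrow> 'n flag set set" where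
  "complementary_schubert f C = {S \<in> schubert_varieties f. S \<inter> C \<noteq> {} \<and>
     complex_dim (flag_topology f) S + complex_dim (flag_topology f) C =
     complex_dim (flag_topology f) (flags f :: 'n flag set)}"

text \<open>
  \<open>block_group t xs j\<close> is the \<open>j\<close>-th of the consecutive groups, of sizes given by \<open>t\<close>, into which
  \<open>xs\<close> is divided; \<open>j\<close> is counted from 0.
\<close>

definition block_group :: "nat list \<Rightarrow> 'a list \<Rightarrow> nat \<Rightarrow> 'a list" where
  "block_group t xs j = take (t ! j) (drop (partial_sum t j) xs)"

definition merge_groups :: "nat list \<Rightarrow> ('n::linorder) list list \<Rightarrow> 'n list list" where
  "merge_groups t Bs = map (\<lambda>j. sort (concat (block_group t Bs j))) [0..<length t]"

definition strictly_decreasing_blocks :: "('n::linorder) list list \<Rightarrow> bool" where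
  "strictly_decreasing_blocks Bs \<longleftrightarrow>
     (\<forall>i. Suc i < length Bs \<longrightarrow> last (Bs ! Suc i) < hd (Bs ! i))"

end

theory Submission
  imports Defs "HOL-Homology.Invariance_of_Domain"
begin

text \<open>
  A permutation in block form is used below only through the labelling \<open>\<beta>\<close> that sends a value to
  the number of the block containing it. The coordinate flag of \<open>\<beta>\<close> has an open neighbourhood, its
  chart, with one complex coordinate for every pair \<open>(i, j)\<close> such that \<open>\<beta> j < \<beta> i\<close> (a drop), and its
  orbit under the Borel group is the coordinate subspace of the chart given by those drops with
  \<open>i < j\<close> (the inversions). So the flag manifold has as dimension the number of drops, and a Schubert
  variety the number of inversions of its labelling (\<open>complex_dim_flags\<close>,
  \<open>complex_dim_schubert_variety\<close>).

  The lower bounds for these dimensions come from the cell and the chart themselves. For the upper bounds, an open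
  set embedded in a finite union of cells has an open part inside one cell, and a cell in the closure of another one has at
  most as many inversions: the unipotent group that parametrizes it acts freely on its chart and
  preserves the other cell (\<open>card_inversions_le_in_closure\<close>).

  Let \<open>\<beta>'\<close> be the labelling of the permutation in the measurable model and \<open>\<beta>\<close> the one obtained by
  merging blocks. Forgetting subspaces is equivariant, continuous and closed, hence always maps the
  Schubert variety of \<open>\<beta>'\<close> onto that of \<open>\<beta>\<close> (\<open>forget_image_closure_cell\<close>). It also maps isotropic flags
  to isotropic flags, so the image meets the base cycle. Only the condition on dimensions is left.

  The two base cycles have the same dimension. An isotropic flag of the measurable model is recovered
  from its image by adding the orthogonal complements of the subspaces, so forgetting is a
  homeomorphism between the two spaces of all isotropic flags (\<open>complex_dim_isotropic_flags\<close>). By Witt's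
  theorem the complex orthogonal group acts transitively on each of these spaces, so a base cycle, being
  open in it, has the dimension of the whole space (\<open>complex_dim_base_cycle\<close>).

  Consequently the image has complementary dimension exactly if merging loses as many drops as
  inversions. The drops lost are the pairs \<open>(i, j)\<close> with \<open>\<beta>' j < \<beta>' i\<close> whose values lie in the
  same merged group, and the inversions lost are those among them with \<open>i < j\<close>. The numbers agree iff
  in every group each later block lies entirely below each earlier one, which is the strictly decreasing
  order (\<open>card_inversions_drops_refine\<close>, \<open>all_groups_decreasing_iff\<close>).
\<close>

type_synonym 'n cvec = "complex^'n"
type_synonym 'n cmat = "complex^'n^'n"

section \<open>Coordinate flags\<close>

definition coord_space :: "'n set \<Rightarrow> (complex^('n::finite)) set" where
  "coord_space S = {x. \<forall>i. i \<notin> S \<longrightarrow> x $ i = 0}"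

lemma subspace_coord_space: "vec.subspace (coord_space S)"
  by (auto simp: vec.subspace_def coord_space_def)

lemma dim_coord_space: "vec.dim (coord_space S) = card S"
  unfolding coord_space_def by (rule dim_substandard_cart)

lemma coord_space_mono: "S \<subseteq> T \<Longrightarrow> coord_space S \<subseteq> coord_space T"
  by (auto simp: coord_space_def)

lemma axis_in_coord_space: "i \<in> S \<Longrightarrow> axis i 1 \<in> coord_space S"
  by (auto simp: coord_space_def axis_def)

lemma span_axis_eq_coord_space: "vec.span {axis i 1 |i. i \<in> S} = coord_space S"
proof
  show "vec.span {axis i 1 |i. i \<in> S} \<subseteq> coord_space S"
    by (rule vec.span_minimal) (auto simp: subspace_coord_space axis_in_coord_space)
  show "coord_space S \<subseteq> vec.span {axis i 1 |i. i \<in> S}"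
  proof
    fix v :: "complex^'a" assume v: "v \<in> coord_space S"
    have "v = (\<Sum>i\<in>UNIV. v $ i *s axis i 1)" by (simp add: basis_expansion)
    also have "\<dots> = (\<Sum>i\<in>S. v $ i *s axis i 1)"
      using v by (intro sum.mono_neutral_right) (auto simp: coord_space_def)
    also have "\<dots> \<in> vec.span {axis i 1 |i. i \<in> S}"
      by (intro vec.span_sum vec.span_scale vec.span_base) blast
    finally show "v \<in> vec.span {axis i 1 |i. i \<in> S}" .
  qed
qed

text \<open>
  The flag depends on a permutation only through the number \<open>\<beta> i\<close> of the block in which \<open>i\<close> stands.
\<close>

definition coord_flag :: "nat \<Rightarrow> ('n \<Rightarrow> nat) \<Rightarrow> ('n::finite) flag" where
  "coord_flag m \<beta> = map (\<lambda>k. coord_space {i. \<beta> i \<le> k}) [0..<m]"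

lemma length_coord_flag [simp]: "length (coord_flag m \<beta>) = m"
  by (simp add: coord_flag_def)

lemma nth_coord_flag [simp]: "k < m \<Longrightarrow> coord_flag m \<beta> ! k = coord_space {i. \<beta> i \<le> k}"
  by (simp add: coord_flag_def)

text \<open>
  The cardinalities say that block \<open>k\<close> has size \<open>f ! k\<close>; the cumulative form matches the dimensions of
  the subspaces of a coordinate flag.
\<close>

definition labelling :: "nat list \<Rightarrow> ('n::finite \<Rightarrow> nat) \<Rightarrow> bool" where
  "labelling f \<beta> \<longleftrightarrow> (\<forall>i. \<beta> i < length f) \<and>
     (\<forall>k<length f. card {i. \<beta> i \<le> k} = partial_sum f (Suc k))"

lemma partial_sum_mono: "i \<le> j \<Longrightarrow> partial_sum f i \<le> partial_sum f j"
  unfolding partial_sum_def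
  using sum_list_append[of "take i f" "take (j - i) (drop i f)"] by (simp flip: take_add)

lemma partial_sum_full: "length f \<le> k \<Longrightarrow> partial_sum f k = sum_list f"
  by (simp add: partial_sum_def)

lemma partial_sum_le: "partial_sum f k \<le> sum_list f"
  using sum_list_append[of "take k f" "drop k f"] by (simp add: partial_sum_def)

lemma coord_flag_in_flags: "labelling f \<beta> \<Longrightarrow> coord_flag (length f) \<beta> \<in> flags f"
  by (auto simp: flags_def labelling_def subspace_coord_space dim_coord_space intro!: coord_space_mono)

lemma coordinate_flag_eq_coord_flag:
  assumes "\<And>k. k < length f \<Longrightarrow> set (take (partial_sum f (Suc k)) w) = {i. \<beta> i \<le> k}"
  shows "coordinate_flag f w = coord_flag (length f) \<beta>"
  unfolding coordinate_flag_def coord_flag_def span_axis_eq_coord_space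
  using assms by (intro map_cong) auto

section \<open>The action of invertible matrices on flags\<close>

abbreviation GL :: "(complex^('n::finite)^('n::finite)) set" where
  "GL \<equiv> {A. invertible A}"

lemma SL_subset_GL: "A \<in> SL_complex \<Longrightarrow> invertible A"
  by (simp add: SL_complex_def invertible_det_nz)

lemma act_mult: "act (A ** B) V = act A (act B V)"
  by (simp add: act_def image_image matrix_vector_mul_assoc)

lemma act_one [simp]: "act (mat 1) V = V"
  by (simp add: act_def)

lemma length_act [simp]: "length (act A V) = length V"
  by (simp add: act_def)

lemma nth_act: "k < length V \<Longrightarrow> act A V ! k = (*v) A ` (V ! k)"
  by (simp add: act_def)

lemma matrix_inverse_exists:
  fixes A :: "complex^'n^'n"
  assumes "invertible A"
  obtains A' where "A ** A' = mat 1" "A' ** A = mat 1" "invertible A'"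
  using assms unfolding invertible_def by blast

lemma dim_image_invertible:
  assumes "invertible (A::complex^'n^'n)"
  shows "vec.dim ((*v) A ` U) = vec.dim U"
  using inj_matrix_vector_mult[OF assms] by (intro vec.dim_image_eq) (auto simp: inj_on_def)

text \<open>
  An invertible matrix preserves dimensions, so for subspaces of equal dimension an inclusion is enough.
\<close>

lemma image_eq_of_subset:
  fixes A :: "complex^'n^'n"
  assumes "invertible A" "vec.subspace U" "vec.subspace W" "(*v) A ` U \<subseteq> W" "vec.dim W \<le> vec.dim U"
  shows "(*v) A ` U = W"
  using assms by (intro vec.subspace_dim_equal) (auto simp: vec.subspace_image dim_image_invertible)

lemma act_in_flags:
  assumes "invertible (A::complex^'n^'n)" "V \<in> flags f"
  shows "act A V \<in> flags f"
  using assms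
  unfolding flags_def mem_Collect_eq
  by (intro conjI allI impI) (simp_all add: nth_act vec.subspace_image dim_image_invertible image_mono)

lemma act_cancel:
  assumes "invertible (A::complex^'n^'n)" "act A V = act A W"
  shows "V = W"
proof -
  obtain A' where "A' ** A = mat 1" using matrix_inverse_exists[OF assms(1)] by blast
  then show ?thesis using assms(2) act_mult[of A' A] by (metis act_one)
qed

definition block_upper :: "('n \<Rightarrow> nat) \<Rightarrow> (complex^('n::finite)^('n::finite)) set" where
  "block_upper \<beta> = {A. invertible A \<and> (\<forall>i j. \<beta> j < \<beta> i \<longrightarrow> A $ i $ j = 0)}"

lemma mult_axis: "(A :: complex^'n^'m) *v axis j 1 = column j A"
  by (simp add: matrix_vector_mult_def axis_def column_def vec_eq_iff if_distrib cong: if_cong)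

lemma image_coord_space_subset_iff:
  fixes A :: "complex^'n^'n"
  shows "(*v) A ` coord_space S \<subseteq> coord_space T \<longleftrightarrow> (\<forall>i j. i \<notin> T \<longrightarrow> j \<in> S \<longrightarrow> A $ i $ j = 0)"
proof
  assume s: "(*v) A ` coord_space S \<subseteq> coord_space T"
  show "\<forall>i j. i \<notin> T \<longrightarrow> j \<in> S \<longrightarrow> A $ i $ j = 0"
  proof (intro allI impI)
    fix i j assume "i \<notin> T" "j \<in> S"
    then have "A *v axis j 1 \<in> coord_space T" using s axis_in_coord_space by blast
    then show "A $ i $ j = 0" using \<open>i \<notin> T\<close>
      by (simp add: mult_axis column_def coord_space_def)
  qed
next
  assume z: "\<forall>i j. i \<notin> T \<longrightarrow> j \<in> S \<longrightarrow> A $ i $ j = 0"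
  show "(*v) A ` coord_space S \<subseteq> coord_space T"
  proof (clarsimp simp: coord_space_def)
    fix v :: "complex^'n" and i assume v: "\<forall>j. j \<notin> S \<longrightarrow> v $ j = 0" and i: "i \<notin> T"
    have "A $ i $ j * v $ j = 0" for j using z v i by (cases "j \<in> S") auto
    then show "(A *v v) $ i = 0"
      by (simp add: matrix_vector_mult_def sum.neutral del: mult_eq_0_iff)
  qed
qed

text \<open>
  The stabilizer of an arbitrary coordinate flag: a parabolic subgroup in the ordering of the indices
  by their labels.
\<close>

lemma act_coord_flag_fixed_iff:
  assumes "invertible A" "\<And>i. \<beta> i < m"
  shows "act A (coord_flag m \<beta>) = coord_flag m \<beta> \<longleftrightarrow> A \<in> block_upper \<beta>"
proof -
  have "act A (coord_flag m \<beta>) = coord_flag m \<beta> \<longleftrightarrow>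
      (\<forall>k<m. (*v) A ` coord_space {i. \<beta> i \<le> k} = coord_space {i. \<beta> i \<le> k})"
    by (simp add: list_eq_iff_nth_eq nth_act)
  also have "\<dots> \<longleftrightarrow> (\<forall>k<m. (*v) A ` coord_space {i. \<beta> i \<le> k} \<subseteq> coord_space {i. \<beta> i \<le> k})"
    using image_eq_of_subset[OF assms(1) subspace_coord_space subspace_coord_space] by blast
  also have "\<dots> \<longleftrightarrow> A \<in> block_upper \<beta>"
    unfolding image_coord_space_subset_iff block_upper_def using assms
    by (auto simp: not_le)
  finally show ?thesis .
qed

text \<open>
  Triangularity with respect to any ordering \<open>\<tau>\<close> of the indices: a permutation \<open>p\<close> contributing to the
  determinant satisfies \<open>\<tau> (p i) \<le> \<tau> i\<close> everywhere, and since the sums of both sides agree it is the identity.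
\<close>

lemma det_of_order:
  fixes A :: "complex^'n^'n" and \<tau> :: "'n \<Rightarrow> nat"
  assumes "inj \<tau>" and A: "\<And>i j. \<tau> i < \<tau> j \<Longrightarrow> A $ i $ j = 0"
  shows "det A = (\<Prod>i\<in>UNIV. A $ i $ i)"
proof -
  have "(\<Prod>i\<in>UNIV. A $ i $ p i) = 0" if p: "p permutes UNIV" "p \<noteq> id" for p
  proof -
    have "\<exists>i. \<tau> i < \<tau> (p i)"
    proof (rule ccontr)
      assume "\<nexists>i. \<tau> i < \<tau> (p i)"
      moreover have "(\<Sum>i\<in>UNIV. \<tau> (p i)) = (\<Sum>i\<in>UNIV. \<tau> i)"
        using sum.permute[OF p(1), of \<tau>] by (simp add: o_def)
      ultimately have "\<tau> (p i) = \<tau> i" for i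
        using sum_mono_inv[of "\<lambda>i. \<tau> (p i)" UNIV \<tau> i] by (simp add: not_less)
      then show False using p(2) assms(1) by (auto simp: fun_eq_iff dest: injD)
    qed
    then show ?thesis using A by (auto intro!: prod_zero)
  qed
  then have "det A = (\<Sum>p\<in>{id}. of_int (sign p) * (\<Prod>i\<in>UNIV. A $ i $ p i))"
    unfolding det_def by (intro sum.mono_neutral_right) (auto simp: permutes_id finite_permutations)
  then show ?thesis by (simp add: sign_id)
qed

lemma invertible_of_order:
  fixes A :: "complex^'n^'n" and \<tau> :: "'n \<Rightarrow> nat"
  assumes "inj \<tau>" "\<And>i. A $ i $ i \<noteq> 0" "\<And>i j. \<tau> i < \<tau> j \<Longrightarrow> A $ i $ j = 0"
  shows "invertible A"
  using det_of_order[OF assms(1,3)] assms(2) by (simp add: invertible_det_nz)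

lemma card_greaterThan_less_iff:
  "card {i<..} < card {j<..} \<longleftrightarrow> j < (i::'n::{finite,linorder})"
proof
  have *: "card {i<..} < card {j<..}" if "j < i" for i j :: 'n
    using that by (intro psubset_card_mono) auto
  then show "j < i \<Longrightarrow> card {i<..} < card {j<..}" .
  assume "card {i<..} < card {j<..}"
  then show "j < i" using *[of i j] by (metis less_asym linorder_neqE less_irrefl)
qed

text \<open>
  Counting larger elements reverses the order, which turns \<open>det_of_order\<close> into a statement about
  upper triangular matrices.
\<close>

lemma inj_card_greaterThan: "inj (\<lambda>i::'n::{finite,linorder}. card {i<..})"
proof (rule injI)
  fix i j :: 'n assume "card {i<..} = card {j<..}"
  then have "\<not> i < j" "\<not> j < i"
    using card_greaterThan_less_iff[of i j] card_greaterThan_less_iff[of j i] by auto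
  then show "i = j" by auto
qed

lemma invertible_upper:
  fixes A :: "complex^('n::{finite,linorder})^('n::{finite,linorder})"
  assumes "\<And>i. A $ i $ i \<noteq> 0" "\<And>i j. j < i \<Longrightarrow> A $ i $ j = 0"
  shows "invertible A"
proof (rule invertible_of_order[OF inj_card_greaterThan])
  show "A $ i $ j = 0" if "card {i<..} < card {j<..}" for i j
    using that assms(2) by (simp add: card_greaterThan_less_iff)
qed (rule assms)

section \<open>Pivoted bases of a flag\<close>

text \<open>
  Projection to the coordinates in \<open>S\<close> cannot be injective on a space of dimension larger than \<open>card S\<close>.
\<close>

lemma nonzero_vector_avoiding:
  fixes U :: "(complex^'n) set"
  assumes "vec.subspace U" "card S < vec.dim U"
  shows "\<exists>x\<in>U. x \<noteq> 0 \<and> (\<forall>i\<in>S. x $ i = 0)"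
proof (rule ccontr)
  assume "\<not> ?thesis"
  then have U: "x = 0" if "x \<in> U" "\<And>i. i \<in> S \<Longrightarrow> x $ i = 0" for x
    using that by auto
  define R :: "complex^'n^'n" where "R = (\<chi> i j. if i = j \<and> i \<in> S then 1 else 0)"
  have R: "(R *v x) $ i = (if i \<in> S then x $ i else 0)" for x i
    by (simp add: R_def matrix_vector_mult_def if_distrib[of "\<lambda>c. c * _"] cong: if_cong)
  have "inj_on ((*v) R) U"
  proof (rule inj_onI)
    fix x y assume xy: "x \<in> U" "y \<in> U" "R *v x = R *v y"
    have "x - y = 0"
    proof (rule U)
      show "x - y \<in> U" using xy assms(1) vec.subspace_diff by blast
      show "(x - y) $ i = 0" if "i \<in> S" for i
        using R[of x i] R[of y i] xy(3) that by simp
    qed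
    then show "x = y" by simp
  qed
  moreover have "vec.span U = U" using assms(1) by (rule vec.span_eq_iff[THEN iffD2])
  ultimately have "vec.dim U = vec.dim ((*v) R ` U)"
    by (intro vec.dim_image_eq[symmetric] matrix_vector_mul_linear_gen) (simp only:)
  also have "\<dots> \<le> vec.dim (coord_space S :: (complex^'n) set)"
    by (intro vec.dim_subset) (auto simp: coord_space_def R)
  finally show False using assms(2) by (simp add: dim_coord_space)
qed

text \<open>
  Gaussian elimination on a flag. The predicate \<open>Q\<close> records how a pivot \<open>i\<close> of a nonzero vector is
  chosen, in terms of the multiple that has \<open>i\<close>-th coordinate \<open>1\<close>. The next vector is taken in the smallest
  member of the flag that still has room for it and vanishes at all earlier pivots, so its own pivot is new.
\<close>

lemma pivot_sequence:
  fixes V :: "('n::finite) flag"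
  assumes V: "V \<in> flags f" and f: "sum_list f = CARD('n)"
    and Q: "\<And>x. x \<noteq> 0 \<Longrightarrow> \<exists>i. x $ i \<noteq> 0 \<and> Q i (inverse (x $ i) *s x)"
  shows "m \<le> CARD('n) \<Longrightarrow> \<exists>js X. distinct js \<and> length js = m \<and> (\<forall>a<m. X (js ! a) $ (js ! a) = 1 \<and>
     (\<forall>b<a. X (js ! a) $ (js ! b) = 0) \<and> Q (js ! a) (X (js ! a)) \<and>
     (\<forall>k<length f. a < partial_sum f (Suc k) \<longrightarrow> X (js ! a) \<in> V ! k))"
proof (induction m)
  case 0
  show ?case by simp
next
  case (Suc m)
  then have "\<exists>js X. distinct js \<and> length js = m \<and> (\<forall>a<m. X (js ! a) $ (js ! a) = 1 \<and>
     (\<forall>b<a. X (js ! a) $ (js ! b) = 0) \<and> Q (js ! a) (X (js ! a)) \<and>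
     (\<forall>k<length f. a < partial_sum f (Suc k) \<longrightarrow> X (js ! a) \<in> V ! k))" by simp
  then obtain js X where js: "distinct js" "length js = m" and *: "\<forall>a<m. X (js ! a) $ (js ! a) = 1 \<and>
     (\<forall>b<a. X (js ! a) $ (js ! b) = 0) \<and> Q (js ! a) (X (js ! a)) \<and>
     (\<forall>k<length f. a < partial_sum f (Suc k) \<longrightarrow> X (js ! a) \<in> V ! k)"
    by (elim exE conjE) (rule that)
  have X: "\<And>a. a < m \<Longrightarrow> X (js ! a) $ (js ! a) = 1"
      "\<And>a b. a < m \<Longrightarrow> b < a \<Longrightarrow> X (js ! a) $ (js ! b) = 0" "\<And>a. a < m \<Longrightarrow> Q (js ! a) (X (js ! a))"
      "\<And>a k. a < m \<Longrightarrow> k < length f \<Longrightarrow> a < partial_sum f (Suc k) \<Longrightarrow> X (js ! a) \<in> V ! k"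
    using * by simp_all
  have "m < partial_sum f (Suc (length f))" using Suc.prems f by (simp add: partial_sum_full)
  then obtain k where k: "m < partial_sum f (Suc k)" and least: "\<And>l. l < k \<Longrightarrow> \<not> m < partial_sum f (Suc l)"
    using exists_least_iff[of "\<lambda>k. m < partial_sum f (Suc k)"] by blast
  have kf: "k < length f"
  proof (rule ccontr)
    assume "\<not> k < length f"
    then have "m < partial_sum f (Suc (length f - 1))" using Suc.prems f by (simp add: partial_sum_full)
    then have "k \<le> length f - 1" using least by (meson leI)
    with \<open>\<not> k < length f\<close> have "length f = 0" by linarith
    with Suc.prems f show False by simp
  qed
  have Vk: "vec.subspace (V ! k)" "vec.dim (V ! k) = partial_sum f (Suc k)"
    using V kf by (auto simp: flags_def)
  have "card (set js) < vec.dim (V ! k)" using Vk(2) k js by (simp add: distinct_card)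
  from nonzero_vector_avoiding[OF Vk(1) this]
  obtain x where x: "x \<in> V ! k" "x \<noteq> 0" and x0: "\<And>i. i \<in> set js \<Longrightarrow> x $ i = 0"
    by blast
  obtain j where j: "x $ j \<noteq> 0" "Q j (inverse (x $ j) *s x)" using Q x(2) by blast
  define y where "y = inverse (x $ j) *s x"
  have jn: "j \<notin> set js" using x0 j by blast
  have y: "y $ j = 1" "y \<in> V ! k" "\<And>i. i \<in> set js \<Longrightarrow> y $ i = 0"
    using j x x0 Vk by (auto simp: y_def vec.subspace_scale)
  have yV: "y \<in> V ! l" if "l < length f" "m < partial_sum f (Suc l)" for l
  proof -
    have "k \<le> l" using least that by (meson leI)
    then have "V ! k \<subseteq> V ! l" using V that kf by (cases "k = l") (auto simp: flags_def)
    then show ?thesis using y by blast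
  qed
  have n: "(js @ [j]) ! a = js ! a" "js ! a \<noteq> j" if "a < m" for a
    using that js jn by (auto simp: nth_append)
  have n': "(js @ [j]) ! m = j" using js by (simp add: nth_append)
  show ?case
  proof (intro exI conjI allI impI)
    show "distinct (js @ [j])" "length (js @ [j]) = Suc m" using js jn by auto
    fix a assume a: "a < Suc m"
    let ?X = "X(j := y)"
    show "?X ((js @ [j]) ! a) $ ((js @ [j]) ! a) = 1" "Q ((js @ [j]) ! a) (?X ((js @ [j]) ! a))"
      using a n n' X y j by (cases "a = m"; force simp: y_def)+
    show "?X ((js @ [j]) ! a) $ ((js @ [j]) ! b) = 0" if "b < a" for b
      using a that n n' X y js by (cases "a = m") auto
    show "?X ((js @ [j]) ! a) \<in> V ! l" if "l < length f" "a < partial_sum f (Suc l)" for l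
      using a that n n' X(4) yV by (cases "a = m") auto
  qed
qed

text \<open>
  The pivots enumerate all indices, so the vectors form a matrix that is unipotent with respect to
  the ordering \<open>\<tau>\<close> of the pivots. Two choices of \<open>Q\<close> are used: the last nonzero coordinate gives the Bruhat
  decomposition, and a coordinate of maximal modulus gives bounded representatives, hence compactness.
\<close>

lemma pivot_basis:
  fixes V :: "('n::finite) flag"
  assumes V: "V \<in> flags f" and f: "sum_list f = CARD('n)"
    and Q: "\<And>x. x \<noteq> 0 \<Longrightarrow> \<exists>i. x $ i \<noteq> 0 \<and> Q i (inverse (x $ i) *s x)"
  obtains A :: "complex^'n^'n" and \<tau> where "bij_betw \<tau> UNIV {..<CARD('n)}"
    "\<And>i. A $ i $ i = 1" "\<And>i j. \<tau> i < \<tau> j \<Longrightarrow> A $ i $ j = 0" "\<And>j. Q j (column j A)" "invertible A"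
    "\<And>k. k < length f \<Longrightarrow> V ! k = (*v) A ` coord_space {i. \<tau> i < partial_sum f (Suc k)}"
proof -
  let ?n = "CARD('n)"
  have seq: "\<exists>js X. distinct js \<and> length js = ?n \<and> (\<forall>a<?n. X (js ! a) $ (js ! a) = 1 \<and>
     (\<forall>b<a. X (js ! a) $ (js ! b) = 0) \<and> Q (js ! a) (X (js ! a)) \<and>
     (\<forall>k<length f. a < partial_sum f (Suc k) \<longrightarrow> X (js ! a) \<in> V ! k))"
    by (rule pivot_sequence[OF V f Q order_refl])
  obtain js X where js: "distinct js" "length js = ?n" and *: "\<forall>a<?n. X (js ! a) $ (js ! a) = 1 \<and>
     (\<forall>b<a. X (js ! a) $ (js ! b) = 0) \<and> Q (js ! a) (X (js ! a)) \<and>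
     (\<forall>k<length f. a < partial_sum f (Suc k) \<longrightarrow> X (js ! a) \<in> V ! k)"
    using seq by (elim exE conjE) (rule that)
  have X: "\<And>a. a < ?n \<Longrightarrow> X (js ! a) $ (js ! a) = 1"
      "\<And>a b. a < ?n \<Longrightarrow> b < a \<Longrightarrow> X (js ! a) $ (js ! b) = 0" "\<And>a. a < ?n \<Longrightarrow> Q (js ! a) (X (js ! a))"
      "\<And>a k. a < ?n \<Longrightarrow> k < length f \<Longrightarrow> a < partial_sum f (Suc k) \<Longrightarrow> X (js ! a) \<in> V ! k"
    using * by simp_all
  have "card (set js) = ?n" using js distinct_card by metis
  then have set: "set js = UNIV" by (simp add: card_eq_UNIV_imp_eq_UNIV)
  have bj: "bij_betw ((!) js) {..<?n} UNIV" using js set by (intro bij_betw_nth) auto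
  define \<tau> where "\<tau> = the_inv_into {..<?n} ((!) js)"
  have bt: "bij_betw \<tau> UNIV {..<?n}" unfolding \<tau>_def by (rule bij_betw_the_inv_into[OF bj])
  have \<tau>: "js ! \<tau> i = i" "\<tau> i < ?n" for i
    using f_the_inv_into_f_bij_betw[OF bj, of i] bij_betwE[OF bt] by (auto simp: \<tau>_def)
  define A where "A = (\<chi> i j. X j $ i)"
  have col: "column j A = X j" for j by (simp add: A_def column_def vec_eq_iff)
  have A: "A $ i $ i = 1" "\<tau> i < \<tau> j \<Longrightarrow> A $ i $ j = 0" "Q j (column j A)" for i j
    using X(1)[of "\<tau> i"] X(2)[of "\<tau> j" "\<tau> i"] X(3)[of "\<tau> j"] \<tau> unfolding col by (simp_all add: A_def)
  have inv: "invertible A"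
    by (rule invertible_of_order[of \<tau>]) (use A bt in \<open>auto simp: bij_betw_def\<close>)
  have "V ! k = (*v) A ` coord_space {i. \<tau> i < partial_sum f (Suc k)}" if k: "k < length f" for k
  proof -
    let ?S = "{i. \<tau> i < partial_sum f (Suc k)}"
    have Vk: "vec.subspace (V ! k)" "vec.dim (V ! k) = partial_sum f (Suc k)"
      using V k by (auto simp: flags_def)
    have "\<tau> ` ?S = {..<partial_sum f (Suc k)}"
    proof -
      have "{..<partial_sum f (Suc k)} \<subseteq> range \<tau>"
        using bt partial_sum_le[of f "Suc k"] f by (auto simp: bij_betw_def)
      then show ?thesis by auto
    qed
    then have "card ?S = partial_sum f (Suc k)"
      using bt by (metis bij_betw_def card_image card_lessThan inj_on_subset subset_UNIV)
    moreover have "(*v) A ` coord_space ?S \<subseteq> V ! k"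
    proof (clarify)
      fix x assume x: "x \<in> coord_space ?S"
      have "A *v x = (\<Sum>j\<in>UNIV. x $ j *s column j A)" by (rule matrix_mult_sum)
      also have "\<dots> = (\<Sum>j\<in>?S. x $ j *s column j A)"
        using x by (intro sum.mono_neutral_right) (auto simp: coord_space_def)
      also have "\<dots> \<in> V ! k"
      proof (intro vec.subspace_sum[OF Vk(1)] vec.subspace_scale[OF Vk(1)])
        fix j assume "j \<in> ?S"
        then show "column j A \<in> V ! k" using X(4)[of "\<tau> j" k] \<tau> k by (simp add: col)
      qed
      finally show "A *v x \<in> V ! k" .
    qed
    ultimately show ?thesis
      using image_eq_of_subset[OF inv subspace_coord_space Vk(1)] Vk(2) by (metis dim_coord_space order_refl)
  qed
  with that bt A inv show ?thesis by blast
qed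

text \<open>
  Cutting an enumeration of the indices into consecutive blocks of sizes \<open>f\<close>.
\<close>

lemma labelling_of_order:
  fixes \<tau> :: "'n::finite \<Rightarrow> nat"
  assumes bt: "bij_betw \<tau> UNIV {..<CARD('n)}" and f: "sum_list f = CARD('n)"
  obtains \<beta> where "labelling f \<beta>" "\<And>i j. \<tau> i \<le> \<tau> j \<Longrightarrow> \<beta> i \<le> \<beta> j"
    "\<And>k. k < length f \<Longrightarrow> {i. \<beta> i \<le> k} = {i. \<tau> i < partial_sum f (Suc k)}"
proof -
  define \<beta> where "\<beta> i = (LEAST k. \<tau> i < partial_sum f (Suc k))" for i
  have ex: "\<tau> i < partial_sum f (Suc (length f - 1))" for i
  proof -
    have "\<tau> i < CARD('n)" using bt by (auto simp: bij_betw_def)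
    then show ?thesis using f by (simp add: partial_sum_full)
  qed
  have iff: "\<beta> i \<le> k \<longleftrightarrow> \<tau> i < partial_sum f (Suc k)" for i k
  proof
    assume "\<beta> i \<le> k"
    moreover have "\<tau> i < partial_sum f (Suc (\<beta> i))"
      unfolding \<beta>_def by (rule LeastI[of "\<lambda>k. \<tau> i < partial_sum f (Suc k)", OF ex])
    ultimately show "\<tau> i < partial_sum f (Suc k)"
      using partial_sum_mono[of "Suc (\<beta> i)" "Suc k" f] by simp
  qed (simp add: \<beta>_def Least_le)
  have ne: "0 < length f" using f zero_less_card_finite[where 'a = 'n] by (cases f) auto
  have card: "card {i. \<tau> i < partial_sum f (Suc k)} = partial_sum f (Suc k)" for k
  proof -
    have "{..<partial_sum f (Suc k)} \<subseteq> range \<tau>"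
      using bt partial_sum_le[of f "Suc k"] f by (auto simp: bij_betw_def)
    then have "\<tau> ` {i. \<tau> i < partial_sum f (Suc k)} = {..<partial_sum f (Suc k)}" by auto
    then show ?thesis using bt by (metis bij_betw_def card_image card_lessThan inj_on_subset subset_UNIV)
  qed
  have "labelling f \<beta>"
    unfolding labelling_def iff
  proof (intro conjI allI impI card)
    fix i
    have "\<beta> i \<le> length f - 1" using ex iff by blast
    then show "\<beta> i < length f" using ne by linarith
  qed
  moreover have "\<beta> i \<le> \<beta> j" if "\<tau> i \<le> \<tau> j" for i j
    using iff[of j "\<beta> j"] iff[of i "\<beta> j"] that by simp
  ultimately show ?thesis using that iff by blast
qed

section \<open>The topology of the flag manifold\<close>


lemma continuous_on_matrix_mult [continuous_intros]:
  fixes f :: "'t::topological_space \<Rightarrow> complex^'n^'m" and g :: "'t \<Rightarrow> complex^'k^'n"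
  assumes "continuous_on S f" "continuous_on S g"
  shows "continuous_on S (\<lambda>x. f x ** g x)"
  unfolding matrix_matrix_mult_def by (intro continuous_intros assms)

lemma continuous_on_det [continuous_intros]:
  fixes f :: "'t::topological_space \<Rightarrow> complex^'n^'n"
  assumes "continuous_on S f"
  shows "continuous_on S (\<lambda>x. det (f x))"
  unfolding det_def by (intro continuous_intros assms)

lemma open_GL: "open (GL :: (complex^'n^'n) set)"
  unfolding invertible_det_nz by (intro open_Collect_neq continuous_intros)

text \<open>
  Multiplying one arbitrarily chosen column by a nonzero \<open>c\<close> changes the determinant without changing the spans of any
  set of columns. The index \<open>undefined\<close> serves as the arbitrary column.
\<close>

definition det_fix :: "complex \<Rightarrow> complex^('n::finite)^('n::finite)" where
  "det_fix c = (\<chi> i j. if i = j then (if i = undefined then c else 1) else 0)"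

lemma det_det_fix: "det (det_fix c) = c"
proof -
  have "det (det_fix c :: complex^'n^'n) = (\<Prod>i\<in>UNIV. if i = (undefined :: 'n) then c else 1)"
    by (subst det_diagonal) (auto simp: det_fix_def)
  then show ?thesis by simp
qed

lemma det_fix_block_upper: "c \<noteq> 0 \<Longrightarrow> det_fix c \<in> block_upper \<beta>"
  by (auto simp: block_upper_def invertible_det_nz det_det_fix) (auto simp: det_fix_def)

text \<open>
  A continuous retraction of invertible matrices onto determinant \<open>1\<close> that leaves all images of
  coordinate flags unchanged. Dividing all entries by an \<open>n\<close>-th root of the determinant
  would not be continuous.
\<close>

definition normalize_det :: "complex^('n::finite)^('n::finite) \<Rightarrow> complex^('n::finite)^('n::finite)" where
  "normalize_det A = A ** det_fix (inverse (det A))"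

lemma normalize_det_in_SL: "invertible A \<Longrightarrow> normalize_det A \<in> SL_complex"
  by (simp add: normalize_det_def SL_complex_def det_mul det_det_fix invertible_det_nz)

lemma act_normalize_det:
  assumes "invertible A" "\<And>i. \<beta> i < m"
  shows "act (normalize_det A) (coord_flag m \<beta>) = act A (coord_flag m \<beta>)"
proof -
  have *: "det_fix (inverse (det A)) \<in> block_upper \<beta>"
    using assms(1) by (intro det_fix_block_upper) (simp add: invertible_det_nz)
  then show ?thesis
    using act_coord_flag_fixed_iff[of "det_fix (inverse (det A))" \<beta> m] assms(2)
    by (simp add: normalize_det_def act_mult block_upper_def)
qed

lemma continuous_on_normalize_det: "continuous_on GL (normalize_det :: complex^'n^'n \<Rightarrow> _)"
  unfolding normalize_det_def det_fix_def
proof (intro continuous_intros continuous_on_id)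
  fix i j :: 'n
  show "continuous_on GL (\<lambda>A::complex^'n^'n. if i = j then if i = undefined then inverse (det A) else 1 else 0)"
    by (cases "i = j"; cases "i = undefined") (auto intro!: continuous_intros simp: invertible_det_nz)
qed

lemma card_lessThan_less_iff:
  "card {..<i} < card {..<j} \<longleftrightarrow> i < (j::'n::{finite,linorder})"
proof
  have *: "card {..<i} < card {..<j}" if "i < j" for i j :: 'n
    using that by (intro psubset_card_mono) auto
  then show "i < j \<Longrightarrow> card {..<i} < card {..<j}" .
  assume "card {..<i} < card {..<j}"
  then show "i < j" using *[of j i] by (metis less_asym linorder_neqE less_irrefl)
qed

text \<open>
  The position of an index in the increasing enumeration.
\<close>

lemma bij_betw_position: "bij_betw (\<lambda>i::'n::{finite,linorder}. card {..<i}) UNIV {..<CARD('n)}"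
proof -
  have inj: "inj (\<lambda>i::'n. card {..<i})"
  proof (rule injI)
    fix i j :: 'n assume "card {..<i} = card {..<j}"
    then have "\<not> i < j" "\<not> j < i"
      using card_lessThan_less_iff[of i j] card_lessThan_less_iff[of j i] by auto
    then show "i = j" by auto
  qed
  have "range (\<lambda>i::'n. card {..<i}) \<subseteq> {..<CARD('n)}"
    by (auto intro!: psubset_card_mono)
  moreover have "card (range (\<lambda>i::'n. card {..<i})) = card {..<CARD('n)}"
    using inj by (simp add: card_image)
  ultimately show ?thesis
    using inj card_subset_eq[of "{..<CARD('n)}"] unfolding bij_betw_def by blast
qed

lemma nth_standard_flag:
  "k < length f \<Longrightarrow> standard_flag f ! k = coord_space {i. card {..<i} < partial_sum f (Suc k)}"
  by (simp add: standard_flag_nth coord_space_def not_less)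

lemma standard_flag_eq_coord_flag:
  assumes "sum_list f = CARD('n)"
  obtains \<beta> where "labelling f \<beta>" "(standard_flag f :: ('n::{finite,linorder}) flag) = coord_flag (length f) \<beta>"
proof -
  obtain \<beta> :: "'n \<Rightarrow> nat" where \<beta>: "labelling f \<beta>"
    "\<And>i j. card {..<i} \<le> card {..<j} \<Longrightarrow> \<beta> i \<le> \<beta> j"
    "\<And>k. k < length f \<Longrightarrow> {i. \<beta> i \<le> k} = {i. card {..<i} < partial_sum f (Suc k)}"
    by (rule labelling_of_order[OF bij_betw_position assms]) (rule that)
  have "(standard_flag f :: 'n flag) = coord_flag (length f) \<beta>"
  proof (rule nth_equalityI)
    show "length (standard_flag f :: 'n flag) = length (coord_flag (length f) \<beta>)"
      by (simp add: standard_flag_def coordinate_flag_def)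
    fix k assume "k < length (standard_flag f :: 'n flag)"
    then have "k < length f" by (simp add: standard_flag_def coordinate_flag_def)
    then show "(standard_flag f :: 'n flag) ! k = coord_flag (length f) \<beta> ! k"
      by (simp only: nth_standard_flag nth_coord_flag \<beta>(3))
  qed
  with \<beta>(1) that show ?thesis by blast
qed

lemma standard_flag_in_flags:
  "sum_list f = CARD('n) \<Longrightarrow> (standard_flag f :: ('n::{finite,linorder}) flag) \<in> flags f"
  by (rule standard_flag_eq_coord_flag) (auto simp: coord_flag_in_flags)

text \<open>
  Pivoting at a coordinate of maximal modulus produces a unipotent matrix with entries of modulus at
  most \<open>1\<close>; permuting its columns makes it carry the standard flag to the given one.
\<close>

lemma flags_bounded_transitive:
  fixes V :: "('n::{finite,linorder}) flag"
  assumes V: "V \<in> flags f" and f: "sum_list f = CARD('n)"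
  obtains h where "norm (det h) = 1" "\<And>i j. norm (h $ i $ j) \<le> 1" "V = act h (standard_flag f)"
proof -
  define Q where "Q i y \<longleftrightarrow> (\<forall>j. norm (y $ j) \<le> 1)" for i :: 'n and y :: "'n cvec"
  have Q: "\<exists>i. x $ i \<noteq> 0 \<and> Q i (inverse (x $ i) *s x)" if "x \<noteq> 0" for x :: "'n cvec"
  proof -
    have "Max (range (\<lambda>i. norm (x $ i))) \<in> range (\<lambda>i. norm (x $ i))"
      by (rule Max_in) auto
    then obtain i where "Max (range (\<lambda>i. norm (x $ i))) = norm (x $ i)"
      by (rule imageE)
    then have i: "norm (x $ j) \<le> norm (x $ i)" for j
      using Max_ge[of "range (\<lambda>i. norm (x $ i))" "norm (x $ j)"] by simp
    obtain j where "x $ j \<noteq> 0" using \<open>x \<noteq> 0\<close> by (auto simp: vec_eq_iff)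
    then have pos: "0 < norm (x $ i)" using i[of j] by (meson less_le_trans zero_less_norm_iff)
    have "norm ((inverse (x $ i) *s x) $ j) \<le> 1" for j
      using i[of j] pos by (simp add: norm_divide divide_inverse[symmetric] mult.commute)
    then show ?thesis using pos by (auto intro!: exI[of _ i] simp: Q_def)
  qed
  obtain A :: "'n cmat" and \<tau> where \<tau>: "bij_betw \<tau> UNIV {..<CARD('n)}"
    and A: "\<And>i. A $ i $ i = 1" "\<And>i j. \<tau> i < \<tau> j \<Longrightarrow> A $ i $ j = 0" "\<And>j. Q j (column j A)" "invertible A"
    and VA: "\<And>k. k < length f \<Longrightarrow> V ! k = (*v) A ` coord_space {i. \<tau> i < partial_sum f (Suc k)}"
    by (rule pivot_basis[OF V f Q]) (assumption, rule that)
  \<comment> \<open>The columns are reordered so that positions in the increasing order become positions in \<open>\<tau>\<close>.\<close>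
  define \<sigma> where "\<sigma> = inv_into UNIV \<tau> \<circ> (\<lambda>i::'n. card {..<i})"
  have \<sigma>: "bij \<sigma>"
    unfolding \<sigma>_def using bij_betw_trans[OF bij_betw_position bij_betw_inv_into[OF \<tau>]] by simp
  have \<tau>\<sigma>: "\<tau> (\<sigma> j) = card {..<j}" for j
  proof -
    have "card {..<j} \<in> range \<tau>"
      using bij_betwE[OF bij_betw_position] \<tau> by (auto simp: bij_betw_def)
    then show ?thesis by (simp add: \<sigma>_def f_inv_into_f)
  qed
  define R :: "'n cmat" where "R = (\<chi> i j. if i = \<sigma> j then 1 else 0)"
  define h where "h = A ** R"
  have h: "h = (\<chi> i j. A $ i $ \<sigma> j)"
    by (simp add: h_def R_def matrix_matrix_mult_def if_distrib cong: if_cong)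
  have "det A = 1" using det_of_order[of \<tau> A] A \<tau> by (simp add: bij_betw_def)
  then have deth: "norm (det h) = 1"
    unfolding h using bij_imp_permutes[OF \<sigma>]
    by (subst det_permute_columns) (simp_all add: norm_mult sign_def)
  then have inv: "invertible h" by (auto simp: invertible_det_nz)
  have "(*v) h ` coord_space {i. card {..<i} < partial_sum f (Suc k)} = V ! k" if k: "k < length f" for k
  proof (rule image_eq_of_subset[OF inv subspace_coord_space])
    let ?r = "partial_sum f (Suc k)"
    show "vec.subspace (V ! k)" using V k by (simp add: flags_def)
    have "(*v) R ` coord_space {i. card {..<i} < ?r} \<subseteq> coord_space {i. \<tau> i < ?r}"
      unfolding image_coord_space_subset_iff by (auto simp: R_def \<tau>\<sigma>)
    then have "(*v) A ` (*v) R ` coord_space {i. card {..<i} < ?r} \<subseteq> V ! k"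
      unfolding VA[OF k] by (rule image_mono)
    then show "(*v) h ` coord_space {i. card {..<i} < ?r} \<subseteq> V ! k"
      by (simp add: h_def image_image matrix_vector_mul_assoc)
    have *: "coord_space {i::'n. card {..<i} < ?r} = standard_flag f ! k" using k by (simp add: nth_standard_flag)
    show "vec.dim (V ! k) \<le> vec.dim (coord_space {i::'n. card {..<i} < ?r})" unfolding *
      using V k standard_flag_in_flags[OF f] unfolding flags_def by simp
  qed
  moreover have "length V = length f" "length (standard_flag f :: 'n flag) = length f"
    using V standard_flag_in_flags[OF f] by (auto simp: flags_def)
  ultimately have "V = act h (standard_flag f)"
    by (intro nth_equalityI) (auto simp: nth_act nth_standard_flag)
  moreover have "norm (h $ i $ j) \<le> 1" for i j
    using A(3)[of "\<sigma> j"] by (simp add: Q_def h column_def)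
  ultimately show ?thesis using that deth by blast
qed

lemma flags_transitive:
  fixes V W :: "('n::{finite,linorder}) flag"
  assumes "V \<in> flags f" "W \<in> flags f" "sum_list f = CARD('n)"
  obtains h where "invertible h" "W = act h V"
proof -
  obtain a where a: "norm (det a) = 1" "V = act a (standard_flag f)"
    using flags_bounded_transitive[OF assms(1,3)] by metis
  obtain b where b: "norm (det b) = 1" "W = act b (standard_flag f)"
    using flags_bounded_transitive[OF assms(2,3)] by metis
  have "invertible a" "invertible b" using a b by (auto simp: invertible_det_nz)
  moreover obtain a' where a': "a' ** a = mat 1" "invertible a'"
    using matrix_inverse_exists[OF \<open>invertible a\<close>] by blast
  have "W = act (b ** a') V"
    using a(2) b(2) a' by (metis act_mult act_one)
  ultimately show ?thesis using that a' invertible_mult by blast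
qed

lemma topspace_flag_topology:
  assumes "sum_list f = CARD('n)"
  shows "topspace (flag_topology f) = (flags f :: ('n::{finite,linorder}) flag set)"
proof
  show "topspace (flag_topology f) \<subseteq> (flags f :: 'n flag set)"
    using openin_topspace[of "flag_topology f"] unfolding openin_flag_topology by blast
  have "{A \<in> SL_complex. act A (standard_flag f :: 'n flag) \<in> flags f} = SL_complex"
    using act_in_flags[OF SL_subset_GL standard_flag_in_flags[OF assms]] by blast
  then have "openin (flag_topology f) (flags f :: 'n flag set)"
    unfolding openin_flag_topology by simp
  then show "(flags f :: 'n flag set) \<subseteq> topspace (flag_topology f)" by (rule openin_subset)
qed

text \<open>
  The topology is defined through matrices of determinant \<open>1\<close> and the standard flag; \<open>normalize_det\<close>
  extends continuity to all invertible matrices and all base points.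
\<close>

lemma continuous_map_orbit_map:
  fixes V :: "('n::{finite,linorder}) flag"
  assumes f: "sum_list f = CARD('n)" and V: "V \<in> flags f"
  shows "continuous_map (top_of_set GL) (flag_topology f) (\<lambda>A. act A V)"
  unfolding continuous_map_def
proof (intro conjI allI impI)
  show "(\<lambda>A. act A V) \<in> topspace (top_of_set GL) \<rightarrow> topspace (flag_topology f)"
    using act_in_flags[OF _ V] by (auto simp: topspace_flag_topology[OF f])
  fix U :: "'n flag set" assume U: "openin (flag_topology f) U"
  obtain h where h: "invertible h" "V = act h (standard_flag f)"
    using flags_transitive[OF standard_flag_in_flags[OF f] V f] by blast
  obtain \<beta> where \<beta>: "labelling f \<beta>" "(standard_flag f :: 'n flag) = coord_flag (length f) \<beta>"
    using standard_flag_eq_coord_flag[OF f] by blast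
  let ?T = "{A \<in> SL_complex. act A (standard_flag f) \<in> U}"
  let ?\<nu> = "\<lambda>A. normalize_det (A ** h)"
  have inv: "invertible (A ** h)" if "invertible A" for A :: "'n cmat"
    using that h invertible_mult by blast
  have "continuous_on GL ?\<nu>"
    using inv by (intro continuous_on_compose2[OF continuous_on_normalize_det] continuous_intros continuous_on_id) auto
  then have "openin (top_of_set GL) (GL \<inter> ?\<nu> -` ?T)"
    using U inv normalize_det_in_SL unfolding openin_flag_topology
    by (intro continuous_openin_preimage[of _ _ SL_complex]) auto
  also have "GL \<inter> ?\<nu> -` ?T = {A \<in> topspace (top_of_set GL). act A V \<in> U}"
    using inv act_normalize_det[OF inv, of _ \<beta> "length f"] \<beta>
    by (auto simp: normalize_det_in_SL h(2) act_mult labelling_def)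
  finally show "openin (top_of_set GL) {A \<in> topspace (top_of_set GL). act A V \<in> U}" .
qed

lemma open_right_translate:
  fixes h :: "complex^'n^'n"
  assumes "open U" "invertible h"
  shows "open ((\<lambda>A. A ** h) ` U)"
proof -
  obtain h' where h': "h ** h' = mat 1" "h' ** h = mat 1" using matrix_inverse_exists[OF assms(2)] by blast
  have "(\<lambda>A. A ** h) ` U = (\<lambda>A. A ** h') -` U" 
  proof (intro equalityI subsetI)
    fix A assume "A \<in> (\<lambda>A. A ** h') -` U"
    then show "A \<in> (\<lambda>A. A ** h) ` U"
      by (intro image_eqI[of _ _ "A ** h'"]) (auto simp: h' simp flip: matrix_mul_assoc)
  qed (auto simp: h' simp flip: matrix_mul_assoc)
  then show ?thesis using assms(1) by (auto intro!: open_vimage continuous_intros)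
qed

text \<open>
  The preimage of the image of an open set is a union of its right translates.
\<close>

lemma open_map_orbit_map:
  fixes V :: "('n::{finite,linorder}) flag"
  assumes f: "sum_list f = CARD('n)" and V: "V \<in> flags f"
  shows "open_map (top_of_set GL) (flag_topology f) (\<lambda>A. act A V)"
  unfolding open_map_def
proof (intro allI impI)
  fix U :: "('n cmat) set" assume "openin (top_of_set GL) U"
  then have U: "open U" "U \<subseteq> GL" by (auto simp: openin_open_eq open_GL)
  let ?H = "{h. invertible h \<and> act h (standard_flag f) = V}"
  have "{A \<in> SL_complex. act A (standard_flag f) \<in> (\<lambda>A. act A V) ` U} =
      SL_complex \<inter> (\<Union>h\<in>?H. (\<lambda>A. A ** h) ` U)" (is "?L = ?R")
  proof (intro equalityI subsetI)
    fix A assume A: "A \<in> ?L"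
    then obtain B where B: "B \<in> U" "act A (standard_flag f) = act B V" by auto
    obtain B' where B': "B ** B' = mat 1" "B' ** B = mat 1" "invertible B'"
      using matrix_inverse_exists[of B] B U by blast
    have "B' ** A \<in> ?H" using A B B' SL_subset_GL[of A] invertible_mult[of B' A]
      by (auto simp: act_mult) (simp flip: act_mult)
    moreover have "A = B ** (B' ** A)" by (simp add: B' matrix_mul_assoc)
    ultimately show "A \<in> ?R" using A B(1) by blast
  next
    fix A assume "A \<in> ?R"
    then show "A \<in> ?L" by (auto simp: act_mult)
  qed
  moreover have "open (\<Union>h\<in>?H. (\<lambda>A. A ** h) ` U)"
    using open_right_translate[OF U(1)] by blast
  ultimately show "openin (flag_topology f) ((\<lambda>A. act A V) ` U)"
    unfolding openin_flag_topology using act_in_flags[OF _ V] U(2) by auto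
qed

lemma quotient_map_orbit_map:
  fixes V :: "('n::{finite,linorder}) flag"
  assumes f: "sum_list f = CARD('n)" and V: "V \<in> flags f"
  shows "quotient_map (top_of_set GL) (flag_topology f) (\<lambda>A. act A V)"
proof (rule continuous_open_imp_quotient_map)
  show "(\<lambda>A. act A V) ` topspace (top_of_set GL) = topspace (flag_topology f)"
    unfolding topspace_flag_topology[OF f]
  proof
    show "flags f \<subseteq> (\<lambda>A. act A V) ` topspace (top_of_set GL)"
    proof
      fix W :: "'n flag" assume "W \<in> flags f"
      then obtain h where "invertible h" "W = act h V" using flags_transitive V f by metis
      then show "W \<in> (\<lambda>A. act A V) ` topspace (top_of_set GL)" by auto
    qed
  qed (use act_in_flags[OF _ V] in auto)
qed (use continuous_map_orbit_map open_map_orbit_map assms in auto)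

lemma homeomorphic_map_act:
  assumes f: "sum_list f = CARD('n)" and B: "invertible (B :: complex^('n::{finite,linorder})^('n::{finite,linorder}))"
  shows "homeomorphic_map (flag_topology f) (flag_topology f) (act B)"
proof -
  let ?V = "standard_flag f :: 'n flag"
  have V: "?V \<in> flags f" by (rule standard_flag_in_flags[OF f])
  have cont: "continuous_map (flag_topology f) (flag_topology f) (act B)"
    if B: "invertible B" for B :: "complex^('n::{finite,linorder})^('n::{finite,linorder})"
  proof (rule continuous_compose_quotient_map[OF quotient_map_orbit_map[OF f V]])
    have "continuous_map (top_of_set GL) (top_of_set GL) (\<lambda>A. B ** A)"
      using B invertible_mult by (auto intro!: continuous_intros)
    from continuous_map_compose[OF this continuous_map_orbit_map[OF f V]]
    show "continuous_map (top_of_set GL) (flag_topology f) (act B \<circ> (\<lambda>A. act A ?V))"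
      by (simp add: o_def act_mult)
  qed
  obtain B' where B': "B ** B' = mat 1" "B' ** B = mat 1" "invertible B'"
    using matrix_inverse_exists[OF B] by blast
  have "homeomorphic_maps (flag_topology f) (flag_topology f) (act B) (act B')"
    unfolding homeomorphic_maps_def using cont B B' by (auto simp flip: act_mult)
  then show ?thesis using homeomorphic_maps_map by blast
qed

text \<open>
  Cramer's rule for the quotient of two matrices: up to the factor \<open>det A\<close>, the entries of \<open>p\<close>
  are polynomials in \<open>A\<close> and \<open>A ** p\<close>.
\<close>

lemma det_replace_column:
  fixes A :: "complex^'n^'n"
  assumes "invertible A" "B = A ** p"
  shows "det (\<chi> r c. if c = i then B $ r $ j else A $ r $ c) = det A * p $ i $ j"
proof -
  have "A *v column j p = column j B"
    by (simp add: assms(2) vec_eq_iff matrix_vector_mult_def column_def matrix_matrix_mult_def)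
  then have "column j p = (\<chi> k. det (\<chi> r c. if c = k then column j B $ r else A $ r $ c) / det A)"
    using assms(1) by (subst cramer[symmetric]) (simp_all add: invertible_det_nz)
  from arg_cong[OF this, of "\<lambda>v. v $ i"]
  have "p $ i $ j = det (\<chi> r c. if c = i then B $ r $ j else A $ r $ c) / det A"
    unfolding column_def vec_lambda_beta .
  then show ?thesis using assms(1) by (simp add: invertible_det_nz)
qed

text \<open>
  By \<open>det_replace_column\<close> the relation of giving the same flag is closed, and the orbit map is open.
\<close>

lemma Hausdorff_space_flag_topology:
  assumes f: "sum_list f = CARD('n)"
  shows "Hausdorff_space (flag_topology f :: ('n::{finite,linorder}) flag topology)"
  unfolding Hausdorff_space_def topspace_flag_topology[OF f]
proof (intro allI impI)
  fix x y :: "'n flag" assume xy: "x \<in> flags f \<and> y \<in> flags f \<and> x \<noteq> y"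
  let ?V = "standard_flag f :: 'n flag"
  have V: "?V \<in> flags f" by (rule standard_flag_in_flags[OF f])
  obtain \<beta> where \<beta>: "labelling f \<beta>" "?V = coord_flag (length f) \<beta>"
    using standard_flag_eq_coord_flag[OF f] by blast
  have \<beta>len: "\<beta> i < length f" for i using \<beta>(1) by (simp add: labelling_def)
  obtain g where g: "invertible g" "x = act g ?V" using flags_transitive[OF V _ f] xy by metis
  obtain h where h: "invertible h" "y = act h ?V" using flags_transitive[OF V _ f] xy by metis
  define E where "E i j A B = det (\<chi> r c. if c = i then B $ r $ j else A $ r $ c)"
    for i j and A B :: "'n cmat"
  have same: "act A ?V = act B ?V \<longleftrightarrow> (\<forall>i j. \<beta> j < \<beta> i \<longrightarrow> E i j A B = 0)"
    if A: "invertible A" and B: "invertible B" for A B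
  proof -
    obtain A' where A': "A ** A' = mat 1" "A' ** A = mat 1" "invertible A'"
      using matrix_inverse_exists[OF A] by blast
    define p where "p = A' ** B"
    have p: "B = A ** p" "invertible p"
      using A' B invertible_mult by (auto simp: p_def matrix_mul_assoc)
    have "act A ?V = act B ?V \<longleftrightarrow> act p ?V = ?V"
      unfolding p(1) act_mult using act_cancel[OF A] by metis
    also have "\<dots> \<longleftrightarrow> p \<in> block_upper \<beta>"
      unfolding \<beta>(2) by (rule act_coord_flag_fixed_iff[OF p(2) \<beta>len])
    finally show ?thesis
      unfolding E_def det_replace_column[OF A p(1)]
      using A p(2) by (simp add: block_upper_def invertible_det_nz)
  qed
  then obtain i j where ij: "\<beta> j < \<beta> i" "E i j g h \<noteq> 0" using xy g h by blast
  have "open {AB. E i j (fst AB) (snd AB) \<noteq> 0}"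
    unfolding E_def
  proof (intro open_Collect_neq continuous_on_det continuous_on_vec_lambda)
    fix r c
    show "continuous_on UNIV (\<lambda>AB. if c = i then snd AB $ r $ j else fst AB $ r $ c)"
      by (cases "c = i") (auto intro!: continuous_intros)
  qed auto
  then obtain S T where ST: "open S" "open T" "(g, h) \<in> S \<times> T" "S \<times> T \<subseteq> {AB. E i j (fst AB) (snd AB) \<noteq> 0}"
    using ij(2) by (auto elim!: open_prod_elim)
  have op: "openin (flag_topology f) ((\<lambda>A. act A ?V) ` (GL \<inter> W))" if "open W" for W
    using open_map_orbit_map[OF f V] that unfolding open_map_def by (simp add: openin_open_Int)
  have "disjnt ((\<lambda>A. act A ?V) ` (GL \<inter> S)) ((\<lambda>A. act A ?V) ` (GL \<inter> T))"
    unfolding disjnt_iff using ST(4) same ij(1) by fastforce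
  then show "\<exists>U W. openin (flag_topology f) U \<and> openin (flag_topology f) W \<and> x \<in> U \<and> y \<in> W \<and> disjnt U W"
    using op[OF ST(1)] op[OF ST(2)] g h ST(3) by blast
qed

text \<open>
  The matrices provided by \<open>flags_bounded_transitive\<close> form a compact set.
\<close>

lemma compact_space_flag_topology:
  assumes f: "sum_list f = CARD('n)"
  shows "compact_space (flag_topology f :: ('n::{finite,linorder}) flag topology)"
proof -
  let ?V = "standard_flag f :: 'n flag"
  have V: "?V \<in> flags f" by (rule standard_flag_in_flags[OF f])
  define K where "K = {h :: 'n cmat. norm (det h) = 1 \<and> (\<forall>i j. norm (h $ i $ j) \<le> 1)}"
  have "norm h \<le> (\<Sum>i\<in>(UNIV::'n set). \<Sum>j\<in>(UNIV::'n set). 1)" if "h \<in> K" for h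
  proof -
    have "norm (h $ i) \<le> (\<Sum>j\<in>UNIV. norm (h $ i $ j))" for i
      unfolding norm_vec_def by (rule L2_set_le_sum) simp
    moreover have "norm h \<le> (\<Sum>i\<in>UNIV. norm (h $ i))"
      by (subst norm_vec_def) (rule L2_set_le_sum, simp)
    ultimately have "norm h \<le> (\<Sum>i\<in>UNIV. \<Sum>j\<in>UNIV. norm (h $ i $ j))"
      by (meson order_trans sum_mono)
    also have "\<dots> \<le> (\<Sum>i\<in>(UNIV::'n set). \<Sum>j\<in>(UNIV::'n set). 1)"
      using that by (intro sum_mono) (simp add: K_def)
    finally show ?thesis .
  qed
  then have "bounded K" by (rule boundedI)
  moreover have "closed K"
    unfolding K_def by (intro closed_Collect_conj closed_Collect_all closed_Collect_eq closed_Collect_le continuous_intros)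
  ultimately have "compact K" by (simp add: compact_eq_bounded_closed)
  moreover have KGL: "K \<subseteq> GL" by (auto simp: K_def invertible_det_nz)
  ultimately have "compactin (top_of_set GL) K"
    by (simp add: compactin_subtopology)
  then have "compactin (flag_topology f) ((\<lambda>A. act A ?V) ` K)"
    using continuous_map_orbit_map[OF f V] by (rule image_compactin)
  moreover have "(\<lambda>A. act A ?V) ` K = flags f"
  proof
    show "(\<lambda>A. act A ?V) ` K \<subseteq> flags f" using KGL act_in_flags[OF _ V] by auto
    show "flags f \<subseteq> (\<lambda>A. act A ?V) ` K"
    proof
      fix W :: "'n flag" assume "W \<in> flags f"
      then obtain h where "norm (det h) = 1" "\<And>i j. norm (h $ i $ j) \<le> 1" "W = act h ?V"
        using flags_bounded_transitive f by metis
      then show "W \<in> (\<lambda>A. act A ?V) ` K" by (auto simp: K_def)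
    qed
  qed
  ultimately show ?thesis by (simp add: compact_space_def topspace_flag_topology[OF f])
qed

section \<open>The topological notion of complex dimension\<close>

text \<open>
  If \<open>b < a\<close>, then by invariance of domain the image would be open in the \<open>a\<close>-dimensional space, although
  its coordinate number \<open>b\<close> vanishes identically.
\<close>

lemma injective_map_Euclidean_space_le:
  assumes W: "openin (Euclidean_space a) W" "W \<noteq> {}"
    and g: "continuous_map (subtopology (Euclidean_space a) W) (Euclidean_space b) g" "inj_on g W"
  shows "a \<le> b"
proof (rule ccontr)
  assume "\<not> a \<le> b"
  then have ab: "b < a" by simp
  have "Euclidean_space b = subtopology (Euclidean_space a) (topspace (Euclidean_space b))"
    using ab by (metis Euclidean_space_def inf.absorb_iff2 less_imp_le subset_Euclidean_space
        subtopology_subtopology topspace_Euclidean_space)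
  then have "continuous_map (subtopology (Euclidean_space a) W) (Euclidean_space a) g"
    using g(1) by (metis continuous_map_into_fulltopology)
  then have op: "openin (Euclidean_space a) (g ` W)"
    using invariance_of_domain_Euclidean_space[OF W(1) _ g(2)] by blast
  have gW: "z b = 0" if z: "z \<in> g ` W" for z
  proof -
    have "W \<subseteq> topspace (subtopology (Euclidean_space a) W)"
      using openin_subset[OF W(1)] by simp
    then have "g ` W \<subseteq> topspace (Euclidean_space b)"
      using continuous_map_image_subset_topspace[OF g(1)] by blast
    then show ?thesis using z by (auto simp: topspace_Euclidean_space)
  qed
  obtain x where x: "x \<in> W" using W(2) by blast
  define y where "y = g x"
  have y: "y \<in> g ` W" using x by (simp add: y_def)
  \<comment> \<open>The point \<open>y\<close> of the image is moved along the coordinate \<open>b\<close>, which leaves the image at once.\<close>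
  define h where "h t i = (if i < a then if i = b then t else y i else 0)" for t :: real and i
  have "continuous_map euclideanreal (Euclidean_space a) h"
  proof -
    have "continuous_map euclideanreal euclideanreal (\<lambda>t. if i = b then t else y i)" for i
      by (cases "i = b") auto
    then show ?thesis
      using continuous_map_componentwise_Euclidean_space[of euclideanreal a "\<lambda>t i. if i = b then t else y i"]
      unfolding h_def by simp
  qed
  then have "openin euclideanreal {t \<in> topspace euclideanreal. h t \<in> g ` W}"
    using op by (rule openin_continuous_map_preimage)
  moreover have "{t \<in> topspace euclideanreal. h t \<in> g ` W} = {0}"
  proof (intro equalityI subsetI)
    fix t assume "t \<in> {t \<in> topspace euclideanreal. h t \<in> g ` W}"
    then have "h t b = 0" using gW by blast
    then show "t \<in> {0}" using ab by (simp add: h_def)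
  next
    fix t :: real assume "t \<in> {0}"
    moreover have "y i = 0" if "\<not> i < a" for i
      using y openin_subset[OF op] that by (auto simp: topspace_Euclidean_space)
    then have "h 0 = y"
      using gW[OF y] by (intro ext) (simp add: h_def)
    ultimately show "t \<in> {t \<in> topspace euclideanreal. h t \<in> g ` W}" using y by simp
  qed
  ultimately show False by (metis open_openin not_open_singleton)
qed

text \<open>
  The condition on \<open>d\<close> whose greatest solution is \<open>complex_dim X S\<close>.
\<close>

definition embeds_dim :: "nat \<Rightarrow> 'a topology \<Rightarrow> 'a set \<Rightarrow> bool" where
  "embeds_dim d X S \<longleftrightarrow> (\<exists>U \<phi>. openin (Euclidean_space (2 * d)) U \<and> U \<noteq> {} \<and>
     embedding_map (subtopology (Euclidean_space (2 * d)) U) (subtopology X S) \<phi>)"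

lemma complex_dim_embeds_dim: "complex_dim X S = (GREATEST d. embeds_dim d X S)"
  by (simp add: complex_dim_def embeds_dim_def)

lemma complex_dim_eqI:
  assumes "embeds_dim m X S" "\<And>d. embeds_dim d X S \<Longrightarrow> d \<le> m"
  shows "complex_dim X S = m"
  unfolding complex_dim_embeds_dim using assms by (rule Greatest_equality)

lemma homeomorphic_imp_embedding_map: "homeomorphic_map X Y f \<Longrightarrow> embedding_map X Y f"
  using homeomorphic_imp_surjective_map[of X Y f] by (simp add: embedding_map_def)

lemma embedding_imp_continuous_map: "embedding_map X Y f \<Longrightarrow> continuous_map X Y f"
  unfolding embedding_map_def
  by (drule homeomorphic_imp_continuous_map) (simp add: continuous_map_in_subtopology)

lemma embeds_dim_mono:
  assumes "A \<subseteq> S" "embeds_dim d X A"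
  shows "embeds_dim d X S"
proof -
  have *: "subtopology X A = subtopology (subtopology X S) A"
    using assms(1) by (simp add: subtopology_subtopology inf.absorb2)
  have "embedding_map Y (subtopology X S) \<phi>" if "embedding_map Y (subtopology X A) \<phi>"
    for Y :: "(nat \<Rightarrow> real) topology" and \<phi>
    using that by (simp add: * embedding_map_in_subtopology[of Y "subtopology X S"])
  then show ?thesis using assms(2) unfolding embeds_dim_def by meson
qed

lemma embeds_dim_if_homeomorphic:
  assumes "Euclidean_space (2 * d) homeomorphic_space subtopology X S"
  shows "embeds_dim d X S"
proof -
  obtain f where "homeomorphic_map (Euclidean_space (2 * d)) (subtopology X S) f"
    using assms homeomorphic_space by blast
  then have "embedding_map (subtopology (Euclidean_space (2 * d)) (topspace (Euclidean_space (2 * d)))) (subtopology X S) f"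
    by (simp add: homeomorphic_imp_embedding_map)
  moreover have "topspace (Euclidean_space (2 * d)) \<noteq> {}"
    by (auto simp: topspace_Euclidean_space)
  ultimately show ?thesis unfolding embeds_dim_def by blast
qed

lemma embeds_dim_homeomorphic_space:
  assumes "subtopology X S homeomorphic_space subtopology Y T" "embeds_dim d X S"
  shows "embeds_dim d Y T"
proof -
  obtain h where "homeomorphic_map (subtopology X S) (subtopology Y T) h"
    using assms(1) homeomorphic_space by blast
  then have "embedding_map (subtopology X S) (subtopology Y T) h"
    by (rule homeomorphic_imp_embedding_map)
  then show ?thesis
    using assms(2) embedding_map_compose unfolding embeds_dim_def by blast
qed

lemma complex_dim_homeomorphic_space:
  assumes "subtopology X S homeomorphic_space subtopology Y T"
  shows "complex_dim X S = complex_dim Y T"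
proof -
  have "embeds_dim d X S = embeds_dim d Y T" for d
    using embeds_dim_homeomorphic_space[OF assms, of d]
      embeds_dim_homeomorphic_space[OF homeomorphic_space_sym[THEN iffD1, OF assms], of d] by blast
  then show ?thesis by (simp add: complex_dim_embeds_dim)
qed

lemma embedding_map_restrict:
  assumes "embedding_map X Y f"
  shows "embedding_map (subtopology X S) Y f"
proof -
  have "homeomorphic_map (subtopology X S)
      (subtopology (subtopology Y (f ` topspace X)) (f ` (topspace X \<inter> S))) f"
  proof (rule homeomorphic_map_subtopologies)
    show *: "homeomorphic_map X (subtopology Y (f ` topspace X)) f"
      using assms by (simp add: embedding_map_def)
    have "f ` (topspace X \<inter> S) \<subseteq> topspace (subtopology Y (f ` topspace X))"
      using homeomorphic_imp_surjective_map[OF *] by blast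
    then show "f ` (topspace X \<inter> S) = topspace (subtopology Y (f ` topspace X)) \<inter> f ` (topspace X \<inter> S)"
      by blast
  qed
  moreover have "f ` topspace X \<inter> f ` (topspace X \<inter> S) = f ` (topspace X \<inter> S)" by blast
  ultimately show ?thesis
    by (simp add: embedding_map_def subtopology_subtopology topspace_subtopology)
qed

text \<open>
  An embedded Euclidean open set can be moved by a homeomorphism so that it meets the open subset, and
  then shrunk into it.
\<close>

lemma complex_dim_open_in_homogeneous:
  assumes hom: "\<And>x y. x \<in> I \<Longrightarrow> y \<in> I \<Longrightarrow> \<exists>h. homeomorphic_map (subtopology X I) (subtopology X I) h \<and> h x = y"
    and C: "openin (subtopology X I) C" "C \<noteq> {}" and I: "I \<subseteq> topspace X"
  shows "complex_dim X C = complex_dim X I"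
proof -
  have CI: "C \<subseteq> I" using openin_subset[OF C(1)] by simp
  then have XC: "subtopology X C = subtopology (subtopology X I) C"
    by (simp add: subtopology_subtopology inf.absorb2)
  have "embeds_dim d X C" if emb: "embeds_dim d X I" for d
  proof -
    let ?E = "Euclidean_space (2 * d)"
    obtain U \<phi> where U: "openin ?E U" "U \<noteq> {}"
      and \<phi>: "embedding_map (subtopology ?E U) (subtopology X I) \<phi>"
      using emb unfolding embeds_dim_def by blast
    have tU: "topspace (subtopology ?E U) = U" using openin_subset[OF U(1)] by auto
    obtain u y where u: "u \<in> U" and y: "y \<in> C" using U(2) C(2) by blast
    have "\<phi> ` topspace (subtopology ?E U) \<subseteq> I"
      using \<phi> unfolding embedding_map_in_subtopology by (rule conjunct2)
    then have "\<phi> u \<in> I" using u tU by auto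
    then obtain h where h: "homeomorphic_map (subtopology X I) (subtopology X I) h" "h (\<phi> u) = y"
      using hom y CI by blast
    let ?\<psi> = "h \<circ> \<phi>"
    have \<psi>: "embedding_map (subtopology ?E U) (subtopology X I) ?\<psi>"
      using embedding_map_compose[OF \<phi> homeomorphic_imp_embedding_map[OF h(1)]] .
    define W where "W = {x \<in> topspace (subtopology ?E U). ?\<psi> x \<in> C}"
    have cont: "continuous_map (subtopology ?E U) (subtopology X I) ?\<psi>"
      using \<psi> by (rule embedding_imp_continuous_map)
    have "openin (subtopology ?E U) W"
      unfolding W_def using cont C(1) by (rule openin_continuous_map_preimage)
    then have W: "openin ?E W" using U(1) openin_trans_full by blast
    have WU: "W \<subseteq> U" using tU by (auto simp: W_def)
    have "embedding_map (subtopology (subtopology ?E U) W) (subtopology X I) ?\<psi>"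
      using \<psi> by (rule embedding_map_restrict)
    then have "embedding_map (subtopology ?E W) (subtopology X I) ?\<psi>"
      using WU by (simp add: subtopology_subtopology inf.absorb2)
    then have "embedding_map (subtopology ?E W) (subtopology X C) ?\<psi>"
      unfolding XC by (subst embedding_map_in_subtopology) (auto simp: W_def)
    moreover have "u \<in> W" using u tU h(2) y by (simp add: W_def)
    ultimately show ?thesis using W unfolding embeds_dim_def by blast
  qed
  then have "embeds_dim d X C = embeds_dim d X I" for d
    using embeds_dim_mono[OF CI] by blast
  then show ?thesis by (simp add: complex_dim_embeds_dim)
qed

text \<open>
  A finite union of locally closed sets can only cover an open set if one of them has interior. If
  the first set has none inside \<open>U\<close>, some nonempty open part of \<open>U\<close> avoids it and is covered by the others.
\<close>

lemma locally_closed_cover_interior: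
  assumes "finite I" "openin T U" "U \<noteq> {}" "U \<subseteq> (\<Union>i\<in>I. O' i \<inter> C i)"
    and "\<And>i. i \<in> I \<Longrightarrow> openin T (O' i)" "\<And>i. i \<in> I \<Longrightarrow> closedin T (C i)"
  shows "\<exists>i\<in>I. \<exists>W. openin T W \<and> W \<noteq> {} \<and> W \<subseteq> U \<inter> O' i \<inter> C i"
  using assms
proof (induction I arbitrary: U rule: finite_induct)
  case empty
  then show ?case by simp
next
  case (insert i I)
  define U1 where "U1 = U \<inter> O' i"
  have U1: "openin T U1" using insert.prems by (simp add: U1_def openin_Int)
  define U2 where "U2 = U1 - C i"
  have U2: "openin T U2" using U1 insert.prems by (simp add: U2_def openin_diff)
  consider "U1 = {}" | "U1 \<noteq> {}" "U2 = {}" | "U2 \<noteq> {}" by blast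
  then show ?case
  proof cases
    case 1
    then have "U \<subseteq> (\<Union>i\<in>I. O' i \<inter> C i)" using insert.prems(3) unfolding U1_def by blast
    then show ?thesis using insert.IH[of U] insert.prems by auto
  next
    case 2
    then have "U1 \<subseteq> U \<inter> O' i \<inter> C i" unfolding U2_def U1_def by blast
    then show ?thesis using U1 2 by blast
  next
    case 3
    have "U2 \<subseteq> (\<Union>i\<in>I. O' i \<inter> C i)" using insert.prems(3) unfolding U1_def U2_def by blast
    then obtain j W where j: "j \<in> I" and W: "openin T W" "W \<noteq> {}" "W \<subseteq> U2 \<inter> O' j \<inter> C j"
      using insert.IH[OF U2 3] insert.prems by auto
    have "W \<subseteq> U \<inter> O' j \<inter> C j" using W(3) by (auto simp: U1_def U2_def)
    then show ?thesis using j W by blast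
  qed
qed

text \<open>
  The upper bound for dimensions: an open part of any embedded Euclidean set lies in a single cell.
\<close>

lemma embeds_dim_le_of_cells:
  assumes d: "embeds_dim d X S" and I: "finite I" "S \<subseteq> (\<Union>i\<in>I. O' i \<inter> C i)"
    and OC: "\<And>i. i \<in> I \<Longrightarrow> openin X (O' i)" "\<And>i. i \<in> I \<Longrightarrow> closedin X (C i)"
    and E: "\<And>i. i \<in> I \<Longrightarrow> subtopology X (O' i \<inter> C i) homeomorphic_space Euclidean_space (2 * l i)"
    and l: "\<And>i. i \<in> I \<Longrightarrow> l i \<le> m"
  shows "d \<le> m"
proof -
  let ?E = "Euclidean_space (2 * d)"
  obtain U \<phi> where U: "openin ?E U" "U \<noteq> {}"
    and \<phi>: "embedding_map (subtopology ?E U) (subtopology X S) \<phi>"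
    using d unfolding embeds_dim_def by blast
  let ?T = "subtopology ?E U"
  have tU: "topspace ?T = U" using openin_subset[OF U(1)] by auto
  have cont: "continuous_map ?T X \<phi>"
    using \<phi> embedding_imp_continuous_map continuous_map_into_fulltopology by blast
  have "\<phi> ` topspace ?T \<subseteq> S"
    using \<phi> unfolding embedding_map_in_subtopology by (rule conjunct2)
  then have \<phi>S: "\<phi> x \<in> S" if "x \<in> U" for x using that tU by auto
  have inj: "inj_on \<phi> U"
    using \<phi> tU homeomorphic_imp_injective_map unfolding embedding_map_def by fastforce
  define P Q where "P i = {x \<in> topspace ?T. \<phi> x \<in> O' i}" and "Q i = {x \<in> topspace ?T. \<phi> x \<in> C i}" for i
  have "\<exists>i\<in>I. \<exists>W. openin ?T W \<and> W \<noteq> {} \<and> W \<subseteq> U \<inter> P i \<inter> Q i"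
  proof (rule locally_closed_cover_interior[OF I(1) _ U(2)])
    show "openin ?T U" using tU by (metis openin_topspace)
    show "U \<subseteq> (\<Union>i\<in>I. P i \<inter> Q i)"
    proof
      fix x assume x: "x \<in> U"
      then obtain i where "i \<in> I" "\<phi> x \<in> O' i \<inter> C i" using \<phi>S I(2) by blast
      then show "x \<in> (\<Union>i\<in>I. P i \<inter> Q i)" using x tU by (auto simp: P_def Q_def)
    qed
    show "openin ?T (P i)" if "i \<in> I" for i
      unfolding P_def using cont OC(1)[OF that] by (rule openin_continuous_map_preimage)
    show "closedin ?T (Q i)" if "i \<in> I" for i
      unfolding Q_def using cont OC(2)[OF that] by (rule closedin_continuous_map_preimage)
  qed
  then obtain i W where i: "i \<in> I" and W: "openin ?T W" "W \<noteq> {}" "W \<subseteq> U \<inter> P i \<inter> Q i" by blast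
  have WE: "openin ?E W" using W(1) U(1) openin_trans_full by blast
  obtain g where g: "homeomorphic_map (subtopology X (O' i \<inter> C i)) (Euclidean_space (2 * l i)) g"
    using E[OF i] homeomorphic_space by blast
  have \<phi>W: "\<phi> x \<in> O' i \<inter> C i" if "x \<in> W" for x using that W(3) by (auto simp: P_def Q_def)
  have "continuous_map (subtopology ?T W) X \<phi>" using cont by (rule continuous_map_from_subtopology)
  then have "continuous_map (subtopology ?E W) X \<phi>"
    using W(3) by (simp add: subtopology_subtopology inf.absorb2)
  then have "continuous_map (subtopology ?E W) (subtopology X (O' i \<inter> C i)) \<phi>"
    using \<phi>W by (auto simp: continuous_map_in_subtopology)
  then have cg: "continuous_map (subtopology ?E W) (Euclidean_space (2 * l i)) (g \<circ> \<phi>)"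
    using homeomorphic_imp_continuous_map[OF g] by (rule continuous_map_compose)
  have "inj_on (g \<circ> \<phi>) W"
  proof (rule comp_inj_on)
    show "inj_on \<phi> W" using inj W(3) by (meson inf.boundedE inj_on_subset)
    have "\<phi> ` W \<subseteq> topspace (subtopology X (O' i \<inter> C i))"
      using \<phi>W openin_subset[OF OC(1)[OF i]] by auto
    then show "inj_on g (\<phi> ` W)"
      using homeomorphic_imp_injective_map[OF g] inj_on_subset by blast
  qed
  then have "2 * d \<le> 2 * l i"
    using injective_map_Euclidean_space_le[OF WE W(2) cg] by blast
  then show ?thesis using l[OF i] by linarith
qed

section \<open>Matrices with prescribed support\<close>

definition supported :: "('n \<times> 'n) set \<Rightarrow> (complex^('n::finite)^('n::finite)) set" where
  "supported E = {A. \<forall>i j. (i, j) \<notin> E \<longrightarrow> A $ i $ j = 0}"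

text \<open>
  The identity matrix perturbed at the positions in \<open>E\<close>. It is a group of unipotent matrices for the
  sets \<open>E\<close> used below.
\<close>

definition unipotent :: "('n \<times> 'n) set \<Rightarrow> (complex^('n::finite)^('n::finite)) set" where
  "unipotent E = {A. \<forall>i j. (i, j) \<notin> E \<longrightarrow> A $ i $ j = (if i = j then 1 else 0)}"

lemma subspace_supported: "subspace (supported E)"
  by (auto simp: subspace_def supported_def)

text \<open>
  The real dimension; every complex entry contributes two real coordinates.
\<close>

lemma dim_supported: "dim (supported E :: (complex^'n^'n) set) = 2 * card E"
proof -
  \<comment> \<open>The standard real basis, indexed by positions and the choice between real and imaginary part.\<close>
  define b :: "'n \<times> 'n \<times> bool \<Rightarrow> complex^'n^'n"
    where "b = (\<lambda>(i, j, r). axis i (axis j (if r then 1 else \<i>)))"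
  define d where "d = b ` {(i, j, r). (i, j) \<in> E}"
  have Basis: "(Basis :: (complex^'n^'n) set) = range b"
    unfolding Basis_vec_def Basis_complex_def b_def by (auto simp: image_iff) metis+
  have inj: "inj b"
    by (rule injI) (auto simp: b_def axis_eq_axis split: if_splits)
  have inner: "A \<bullet> b (i, j, r) = (if r then Re (A $ i $ j) else Im (A $ i $ j))" for A i j r
    by (simp add: b_def inner_axis inner_complex_def)
  have mem: "b (i, j, r) \<in> d \<longleftrightarrow> (i, j) \<in> E" for i j r
    using inj by (auto simp: d_def dest: injD)
  have "supported E = {A. \<forall>u\<in>Basis. u \<notin> d \<longrightarrow> A \<bullet> u = 0}"
  proof (intro equalityI subsetI)
    fix A assume "A \<in> supported E"
    then show "A \<in> {A. \<forall>u\<in>Basis. u \<notin> d \<longrightarrow> A \<bullet> u = 0}"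
      unfolding Basis by (auto simp: supported_def mem inner)
  next
    fix A :: "complex^'n^'n" assume A: "A \<in> {A. \<forall>u\<in>Basis. u \<notin> d \<longrightarrow> A \<bullet> u = 0}"
    show "A \<in> supported E"
      unfolding supported_def
    proof (intro CollectI allI impI)
      fix i j assume "(i, j) \<notin> E"
      then have "A \<bullet> b (i, j, True) = 0" "A \<bullet> b (i, j, False) = 0"
        using A mem unfolding Basis by blast+
      then show "A $ i $ j = 0" by (simp add: inner complex_eq_iff)
    qed
  qed
  moreover have "d \<subseteq> Basis" by (auto simp: d_def Basis)
  ultimately have "dim (supported E) = card d" by (simp add: dim_substandard)
  also have "\<dots> = card {(i, j, r::bool). (i, j) \<in> E}"
    unfolding d_def using inj by (meson card_image inj_on_subset subset_UNIV)
  also have "{(i, j, r::bool). (i, j) \<in> E} = (\<lambda>((i, j), r). (i, j, r)) ` (E \<times> UNIV)"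
    by force
  also have "card \<dots> = card (E \<times> (UNIV :: bool set))"
    by (rule card_image) (auto simp: inj_on_def)
  also have "\<dots> = 2 * card E" by (simp add: card_cartesian_product)
  finally show ?thesis .
qed

lemma unipotent_homeomorphic_Euclidean_space:
  "top_of_set (unipotent E :: (complex^'n^'n) set) homeomorphic_space Euclidean_space (2 * card E)"
proof -
  have "homeomorphism (unipotent E :: (complex^'n^'n) set) (supported E) (\<lambda>A. A - mat 1) (\<lambda>A. A + mat 1)"
    by (rule homeomorphismI) (auto intro!: continuous_intros simp: unipotent_def supported_def mat_def)
  then have "top_of_set (unipotent E :: (complex^'n^'n) set) homeomorphic_space top_of_set (supported E)"
    unfolding homeomorphic_space_iff_homeomorphic homeomorphic_def by blast
  moreover have "top_of_set (supported E :: (complex^'n^'n) set) homeomorphic_space Euclidean_space (2 * card E)"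
    using homeomorphic_subspace_Euclidean_space_dim[OF subspace_supported[of E]] dim_supported[of E] by simp
  ultimately show ?thesis by (rule homeomorphic_space_trans)
qed

lemma closed_unipotent: "closed (unipotent E)"
  unfolding unipotent_def
  by (intro closed_Collect_all closed_Collect_imp open_Collect_const closed_Collect_eq continuous_intros)

lemma one_in_unipotent: "mat 1 \<in> unipotent E"
  by (auto simp: unipotent_def mat_def)

lemma unipotent_mono: "E \<subseteq> E' \<Longrightarrow> unipotent E \<subseteq> unipotent E'"
  by (auto simp: unipotent_def)

section \<open>Charts of the flag manifold\<close>

text \<open>
  The positions strictly below the block diagonal when indices are ordered by their labels. The
  unipotent matrices supported there form the unipotent radical of the parabolic
  subgroup opposite to the stabilizer of the coordinate flag.
\<close>

definition drops :: "('n \<Rightarrow> nat) \<Rightarrow> ('n \<times> 'n) set" where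
  "drops \<beta> = {(i, j). \<beta> j < \<beta> i}"

text \<open>
  In one-line notation, pairs of values \<open>i < j\<close> such that \<open>i\<close> stands in a later block than \<open>j\<close>.
  These are the drops at positions above the diagonal.
\<close>

definition inversions :: "('n::linorder \<Rightarrow> nat) \<Rightarrow> ('n \<times> 'n) set" where
  "inversions \<beta> = {(i, j). i < j \<and> \<beta> j < \<beta> i}"

lemma unipotent_drops_entry:
  "A \<in> unipotent (drops \<beta>) \<Longrightarrow> \<beta> i \<le> \<beta> j \<Longrightarrow> A $ i $ j = (if i = j then 1 else 0)"
  by (simp add: unipotent_def drops_def)

lemma unipotent_inversions_subset: "unipotent (inversions \<beta>) \<subseteq> unipotent (drops \<beta>)"
  by (rule unipotent_mono) (auto simp: inversions_def drops_def)

text \<open>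
  Transversality of the subspaces in a chart to the opposite coordinate subspaces. In the lowest block
  where \<open>y\<close> is nonzero, \<open>A *v y\<close> has the same coordinates as \<open>y\<close>.
\<close>

lemma chart_transversal:
  fixes A :: "complex^'n^'n"
  assumes A: "A \<in> unipotent (drops \<beta>)" and y: "y \<in> coord_space {i. \<beta> i \<le> k}"
    and Ay: "A *v y \<in> coord_space {i. k < \<beta> i}"
  shows "y = 0"
proof (rule ccontr)
  assume "y \<noteq> 0"
  then obtain i0 where "y $ i0 \<noteq> 0" by (auto simp: vec_eq_iff)
  then obtain i where i: "y $ i \<noteq> 0" and min: "\<And>j. \<beta> j < \<beta> i \<Longrightarrow> y $ j = 0"
    using exists_least_iff[of "\<lambda>n. \<exists>i. \<beta> i = n \<and> y $ i \<noteq> 0"] by blast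
  have "(A *v y) $ i = (\<Sum>j\<in>UNIV. A $ i $ j * y $ j)"
    by (simp add: matrix_vector_mult_def)
  also have "\<dots> = (\<Sum>j\<in>{i}. A $ i $ j * y $ j)"
  proof (intro sum.mono_neutral_right ballI)
    fix j assume "j \<in> UNIV - {i}"
    then show "A $ i $ j * y $ j = 0"
      using min[of j] unipotent_drops_entry[OF A, of i j] by (cases "\<beta> j < \<beta> i") auto
  qed auto
  also have "\<dots> = y $ i" using unipotent_drops_entry[OF A, of i i] by simp
  finally have "(A *v y) $ i = y $ i" .
  moreover have "\<beta> i \<le> k" using y i by (auto simp: coord_space_def)
  ultimately show False using Ay i by (auto simp: coord_space_def)
qed

lemma invertible_unipotent_drops:
  fixes A :: "complex^'n^'n"
  assumes "A \<in> unipotent (drops \<beta>)"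
  shows "invertible A"
proof -
  have "y = 0" if "A *v y = 0" for y
  proof (rule chart_transversal[OF assms])
    show "y \<in> coord_space {i. \<beta> i \<le> Max (range \<beta>)}" by (simp add: coord_space_def)
    show "A *v y \<in> coord_space {i. Max (range \<beta>) < \<beta> i}" using that by (simp add: coord_space_def)
  qed
  then show ?thesis
    unfolding invertible_left_inverse matrix_left_invertible_ker by blast
qed

text \<open>
  The \<open>j\<close>-th columns of two matrices with the same image flag differ by a vector of the \<open>\<beta> j\<close>-th subspace
  whose coordinates in the blocks up to \<open>\<beta> j\<close> vanish, so \<open>chart_transversal\<close> applies.
\<close>

lemma inj_on_chart:
  fixes \<beta> :: "'n::finite \<Rightarrow> nat"
  assumes \<beta>: "\<And>i. \<beta> i < m"
  shows "inj_on (\<lambda>A. act A (coord_flag m \<beta>)) (unipotent (drops \<beta>))"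
proof (rule inj_onI)
  fix A B :: "complex^'n^'n"
  assume A: "A \<in> unipotent (drops \<beta>)" and B: "B \<in> unipotent (drops \<beta>)"
    and eq: "act A (coord_flag m \<beta>) = act B (coord_flag m \<beta>)"
  have "column j A = column j B" for j
  proof -
    let ?F = "coord_space {i. \<beta> i \<le> \<beta> j}"
    have "(*v) A ` ?F = (*v) B ` ?F"
      using arg_cong[OF eq, of "\<lambda>V. V ! \<beta> j"] \<beta>[of j] by (simp add: nth_act)
    moreover have ax: "axis j 1 \<in> ?F" by (simp add: axis_in_coord_space)
    ultimately obtain y where y: "y \<in> ?F" "B *v axis j 1 = A *v y" by blast
    have "y - axis j 1 = 0"
    proof (rule chart_transversal[OF A])
      show "y - axis j 1 \<in> ?F" using y ax subspace_coord_space vec.subspace_diff by blast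
      have "(column j B - column j A) $ i = 0" if "\<beta> i \<le> \<beta> j" for i
        using unipotent_drops_entry[OF A that] unipotent_drops_entry[OF B that] by (simp add: column_def)
      then have "column j B - column j A \<in> coord_space {i. \<beta> j < \<beta> i}"
        by (simp add: coord_space_def)
      moreover have "A *v (y - axis j 1) = column j B - column j A"
        using y(2) by (simp add: matrix_vector_mult_diff_distrib mult_axis)
      ultimately show "A *v (y - axis j 1) \<in> coord_space {i. \<beta> j < \<beta> i}" by simp
    qed
    then show ?thesis using y(2) by (simp add: mult_axis)
  qed
  then show "A = B" by (simp add: column_def vec_eq_iff)
qed

text \<open>
  A matrix \<open>X\<close> encodes a pair: its entries at the drops give an element of the chart, its remaining
  entries an element of the stabilizer. The product of the two parts turns this into coordinates near the identity.
\<close>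

definition lower_part :: "('n \<Rightarrow> nat) \<Rightarrow> complex^('n::finite)^('n::finite) \<Rightarrow> complex^('n::finite)^('n::finite)" where
  "lower_part \<beta> X = (\<chi> i j. if \<beta> j < \<beta> i then X $ i $ j else if i = j then 1 else 0)"

definition upper_part :: "('n \<Rightarrow> nat) \<Rightarrow> complex^('n::finite)^('n::finite) \<Rightarrow> complex^('n::finite)^('n::finite)" where
  "upper_part \<beta> X = (\<chi> i j. if \<beta> j < \<beta> i then 0 else X $ i $ j)"

lemma lower_part_unipotent: "lower_part \<beta> X \<in> unipotent (drops \<beta>)"
  by (auto simp: lower_part_def unipotent_def drops_def)

lemma lower_part_of_unipotent: "A \<in> unipotent (drops \<beta>) \<Longrightarrow> lower_part \<beta> A = A"
  by (auto simp: lower_part_def unipotent_def drops_def vec_eq_iff)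

lemma upper_part_of_unipotent: "A \<in> unipotent (drops \<beta>) \<Longrightarrow> upper_part \<beta> A = mat 1"
  by (auto simp: upper_part_def unipotent_def drops_def vec_eq_iff mat_def)

lemma upper_part_block_upper: "invertible (upper_part \<beta> X) \<Longrightarrow> upper_part \<beta> X \<in> block_upper \<beta>"
  by (simp add: block_upper_def upper_part_def)

lemma continuous_on_lower_part: "continuous_on S (lower_part \<beta>)"
  unfolding lower_part_def
proof (intro continuous_on_vec_lambda)
  show "continuous_on S (\<lambda>X. if \<beta> j < \<beta> i then X $ i $ j else if i = j then 1 else 0)" for i j
    by (cases "\<beta> j < \<beta> i") (auto intro!: continuous_intros)
qed

lemma continuous_on_upper_part: "continuous_on S (upper_part \<beta>)"
  unfolding upper_part_def
proof (intro continuous_on_vec_lambda)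
  show "continuous_on S (\<lambda>X. if \<beta> j < \<beta> i then 0 else X $ i $ j)" for i j
    by (cases "\<beta> j < \<beta> i") (auto intro!: continuous_intros)
qed

lemma act_lower_upper:
  assumes "invertible (upper_part \<beta> X)" "\<And>i. \<beta> i < m"
  shows "act (lower_part \<beta> X ** upper_part \<beta> X) (coord_flag m \<beta>) = act (lower_part \<beta> X) (coord_flag m \<beta>)"
  using act_coord_flag_fixed_iff[OF assms(1), of \<beta> m] assms(2) upper_part_block_upper[OF assms(1)]
  by (simp add: act_mult)

lemma inj_on_lower_upper:
  fixes \<beta> :: "'n::finite \<Rightarrow> nat"
  assumes \<beta>: "\<And>i. \<beta> i < m"
  shows "inj_on (\<lambda>X. lower_part \<beta> X ** upper_part \<beta> X) {X. invertible (upper_part \<beta> X)}"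
proof (rule inj_onI)
  fix X Y assume X: "X \<in> {X. invertible (upper_part \<beta> X)}" and Y: "Y \<in> {X. invertible (upper_part \<beta> X)}"
    and eq: "lower_part \<beta> X ** upper_part \<beta> X = lower_part \<beta> Y ** upper_part \<beta> Y"
  have "act (lower_part \<beta> X) (coord_flag m \<beta>) = act (lower_part \<beta> Y) (coord_flag m \<beta>)"
    using act_lower_upper[of \<beta> X m] act_lower_upper[of \<beta> Y m] X Y eq \<beta> by simp
  then have l: "lower_part \<beta> X = lower_part \<beta> Y"
    using inj_onD[OF inj_on_chart[of \<beta> m]] \<beta> lower_part_unipotent by blast
  obtain L where "L ** lower_part \<beta> Y = mat 1"
    using matrix_inverse_exists[OF invertible_unipotent_drops[OF lower_part_unipotent[of \<beta> Y]]] by blast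
  then have u: "upper_part \<beta> X = upper_part \<beta> Y"
    using arg_cong[OF eq, of "\<lambda>Z. L ** Z"] unfolding l by (simp add: matrix_mul_assoc)
  show "X = Y"
  proof (intro vec_eq_iff[THEN iffD2] allI)
    fix i j
    show "X $ i $ j = Y $ i $ j"
      using arg_cong[OF l, of "\<lambda>Z. Z $ i $ j"] arg_cong[OF u, of "\<lambda>Z. Z $ i $ j"]
      by (auto simp: lower_part_def upper_part_def split: if_splits)
  qed
qed

text \<open>
  The product of a lower and an upper part depends injectively and continuously on the matrix that
  encodes them, hence is open by invariance of domain. The upper part does not change the flag, and the orbit map is open.
\<close>

lemma open_map_chart:
  fixes \<beta> :: "'n::{finite,linorder} \<Rightarrow> nat"
  assumes f: "sum_list f = CARD('n)" and \<beta>: "labelling f \<beta>"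
  shows "open_map (top_of_set (unipotent (drops \<beta>))) (flag_topology f) (\<lambda>A. act A (coord_flag (length f) \<beta>))"
  unfolding open_map_def
proof (intro allI impI)
  let ?F = "coord_flag (length f) \<beta>"
  fix U assume "openin (top_of_set (unipotent (drops \<beta>))) U"
  then obtain W where W: "open W" "U = unipotent (drops \<beta>) \<inter> W" by (auto simp: openin_open)
  have len: "\<beta> i < length f" for i using \<beta> by (simp add: labelling_def)
  let ?\<Phi> = "\<lambda>X. lower_part \<beta> X ** upper_part \<beta> X"
  let ?S = "{X. invertible (upper_part \<beta> X)} \<inter> lower_part \<beta> -` W"
  have "open {X. invertible (upper_part \<beta> X)}"
    unfolding invertible_det_nz by (intro open_Collect_neq continuous_intros continuous_on_upper_part)
  then have "open ?S"
    using W(1) continuous_on_lower_part by (intro open_Int open_vimage) auto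
  moreover have "continuous_on ?S ?\<Phi>"
    by (intro continuous_intros continuous_on_lower_part continuous_on_upper_part)
  moreover have "inj_on ?\<Phi> ?S"
    using inj_on_lower_upper[of \<beta>, OF len] by (rule inj_on_subset) blast
  ultimately have "open (?\<Phi> ` ?S)" using invariance_of_domain by blast
  moreover have "?\<Phi> ` ?S \<subseteq> GL"
    using invertible_mult invertible_unipotent_drops[OF lower_part_unipotent] by blast
  ultimately have "openin (top_of_set GL) (?\<Phi> ` ?S)"
    by (simp add: openin_open_eq open_GL)
  then have "openin (flag_topology f) ((\<lambda>A. act A ?F) ` ?\<Phi> ` ?S)"
    using open_map_orbit_map[OF f coord_flag_in_flags[OF \<beta>]] unfolding open_map_def by blast
  also have "(\<lambda>A. act A ?F) ` ?\<Phi> ` ?S = (\<lambda>A. act A ?F) ` U"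
  proof (intro equalityI subsetI)
    fix V assume "V \<in> (\<lambda>A. act A ?F) ` ?\<Phi> ` ?S"
    then obtain X where X: "X \<in> ?S" "V = act (?\<Phi> X) ?F" by blast
    then have "V = act (lower_part \<beta> X) ?F" using act_lower_upper[of \<beta> X "length f", OF _ len] by simp
    then show "V \<in> (\<lambda>A. act A ?F) ` U" using X(1) lower_part_unipotent W(2) by blast
  next
    fix V assume "V \<in> (\<lambda>A. act A ?F) ` U"
    then obtain A where A: "A \<in> unipotent (drops \<beta>)" "A \<in> W" "V = act A ?F" using W(2) by blast
    then have "A \<in> ?S" "?\<Phi> A = A"
      by (simp_all add: lower_part_of_unipotent upper_part_of_unipotent invertible_det_nz)
    then show "V \<in> (\<lambda>A. act A ?F) ` ?\<Phi> ` ?S" using A(3) by force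
  qed
  finally show "openin (flag_topology f) ((\<lambda>A. act A ?F) ` U)" .
qed

lemma embedding_map_chart:
  fixes \<beta> :: "'n::{finite,linorder} \<Rightarrow> nat"
  assumes f: "sum_list f = CARD('n)" and \<beta>: "labelling f \<beta>"
  shows "embedding_map (top_of_set (unipotent (drops \<beta>))) (flag_topology f) (\<lambda>A. act A (coord_flag (length f) \<beta>))"
proof (rule injective_open_imp_embedding_map)
  have "unipotent (drops \<beta>) \<subseteq> GL" using invertible_unipotent_drops by blast
  then show "continuous_map (top_of_set (unipotent (drops \<beta>))) (flag_topology f) (\<lambda>A. act A (coord_flag (length f) \<beta>))"
    using continuous_map_orbit_map[OF f coord_flag_in_flags[OF \<beta>]] continuous_map_from_subtopology_mono by blast
  show "inj_on (\<lambda>A. act A (coord_flag (length f) \<beta>)) (topspace (top_of_set (unipotent (drops \<beta>))))"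
    using inj_on_chart[of \<beta> "length f"] \<beta> by (simp add: labelling_def)
qed (rule open_map_chart[OF assms])

definition chart :: "nat \<Rightarrow> ('n::finite \<Rightarrow> nat) \<Rightarrow> 'n flag set" where
  "chart m \<beta> = (\<lambda>A. act A (coord_flag m \<beta>)) ` unipotent (drops \<beta>)"

text \<open>
  By \<open>orbit_borel_subgroup\<close> this is the orbit of the Borel group; the present form exhibits it as a
  coordinate subspace of the chart.
\<close>

definition cell :: "nat \<Rightarrow> ('n::{finite,linorder} \<Rightarrow> nat) \<Rightarrow> 'n flag set" where
  "cell m \<beta> = (\<lambda>A. act A (coord_flag m \<beta>)) ` unipotent (inversions \<beta>)"

lemma coord_flag_in_chart: "coord_flag m \<beta> \<in> chart m \<beta>"
  unfolding chart_def by (rule image_eqI[OF _ one_in_unipotent]) simp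

lemma openin_chart:
  fixes \<beta> :: "'n::{finite,linorder} \<Rightarrow> nat"
  assumes "sum_list f = CARD('n)" "labelling f \<beta>"
  shows "openin (flag_topology f) (chart (length f) \<beta>)"
proof -
  have "openin (top_of_set (unipotent (drops \<beta>))) (unipotent (drops \<beta>) :: 'n cmat set)" by simp
  then show ?thesis using open_map_chart[OF assms] unfolding open_map_def chart_def by blast
qed

lemma homeomorphic_space_chart_piece:
  fixes \<beta> :: "'n::{finite,linorder} \<Rightarrow> nat"
  assumes f: "sum_list f = CARD('n)" and \<beta>: "labelling f \<beta>" and E: "E \<subseteq> drops \<beta>"
  shows "Euclidean_space (2 * card E) homeomorphic_space
    subtopology (flag_topology f) ((\<lambda>A. act A (coord_flag (length f) \<beta>)) ` unipotent E)"
proof -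
  have sub: "unipotent (drops \<beta>) \<inter> unipotent E = unipotent E" using unipotent_mono[OF E] by blast
  have "embedding_map (top_of_set (unipotent E)) (flag_topology f) (\<lambda>A. act A (coord_flag (length f) \<beta>))"
    using embedding_map_restrict[OF embedding_map_chart[OF f \<beta>], of "unipotent E"]
    by (simp add: subtopology_subtopology sub)
  then have "top_of_set (unipotent E) homeomorphic_space
    subtopology (flag_topology f) ((\<lambda>A. act A (coord_flag (length f) \<beta>)) ` unipotent E)"
    by (drule_tac embedding_map_imp_homeomorphic_space) simp
  moreover have "Euclidean_space (2 * card E) homeomorphic_space top_of_set (unipotent E :: 'n cmat set)"
    using unipotent_homeomorphic_Euclidean_space homeomorphic_space_sym by blast
  ultimately show ?thesis using homeomorphic_space_trans by blast
qed

lemma homeomorphic_space_cell: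
  fixes \<beta> :: "'n::{finite,linorder} \<Rightarrow> nat"
  assumes f: "sum_list f = CARD('n)" and \<beta>: "labelling f \<beta>"
  shows "Euclidean_space (2 * card (inversions \<beta>)) homeomorphic_space
    subtopology (flag_topology f) (cell (length f) \<beta>)"
  unfolding cell_def
  by (rule homeomorphic_space_chart_piece[OF assms]) (auto simp: inversions_def drops_def)

lemma homeomorphic_space_chart:
  fixes \<beta> :: "'n::{finite,linorder} \<Rightarrow> nat"
  assumes f: "sum_list f = CARD('n)" and \<beta>: "labelling f \<beta>"
  shows "Euclidean_space (2 * card (drops \<beta>)) homeomorphic_space
    subtopology (flag_topology f) (chart (length f) \<beta>)"
  unfolding chart_def by (rule homeomorphic_space_chart_piece[OF assms order_refl])

text \<open>
  The cell is closed in its chart, which is open.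
\<close>

lemma cell_locally_closed:
  fixes \<beta> :: "'n::{finite,linorder} \<Rightarrow> nat"
  assumes f: "sum_list f = CARD('n)" and \<beta>: "labelling f \<beta>"
  obtains C where "closedin (flag_topology f) C" "cell (length f) \<beta> = chart (length f) \<beta> \<inter> C"
proof -
  let ?\<psi> = "\<lambda>A. act A (coord_flag (length f) \<beta>)"
  have hom: "homeomorphic_map (top_of_set (unipotent (drops \<beta>)))
      (subtopology (flag_topology f) (chart (length f) \<beta>)) ?\<psi>"
    using embedding_map_chart[OF assms] by (simp add: embedding_map_def chart_def)
  have sub: "unipotent (inversions \<beta>) \<subseteq> unipotent (drops \<beta>)" by (rule unipotent_inversions_subset)
  have "closedin (top_of_set (unipotent (drops \<beta>))) (unipotent (inversions \<beta>))"
    by (rule closed_subset[OF sub closed_unipotent])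
  then have "closedin (subtopology (flag_topology f) (chart (length f) \<beta>)) (cell (length f) \<beta>)"
    using homeomorphic_map_closedness[OF hom, of "unipotent (inversions \<beta>)"] sub by (simp add: cell_def)
  then show ?thesis using that unfolding closedin_subtopology by blast
qed

section \<open>Bruhat decomposition\<close>

text \<open>
  The solution cannot have its last nonzero coordinate beyond \<open>j\<close>, because the diagonal entry there is nonzero.
\<close>

lemma upper_triangular_solution:
  fixes M :: "complex^('n::{finite,linorder})^('n::{finite,linorder})"
  assumes up: "\<And>i j. j < i \<Longrightarrow> M $ i $ j = 0" and dg: "\<And>i. M $ i $ i \<noteq> 0"
  obtains z where "M *v z = axis j 1" "\<And>i. j < i \<Longrightarrow> z $ i = 0"
proof -
  have "invertible M" using dg up by (rule invertible_upper)
  then obtain M' where "M ** M' = mat 1" using matrix_inverse_exists by blast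
  then have z: "M *v (M' *v axis j 1) = axis j 1" by (simp add: matrix_vector_mul_assoc)
  define z where "z = M' *v axis j 1"
  have "z $ i = 0" if "j < i" for i
  proof (rule ccontr)
    assume "z $ i \<noteq> 0"
    define S where "S = {i. j < i \<and> z $ i \<noteq> 0}"
    have "S \<noteq> {}" "finite S" using \<open>z $ i \<noteq> 0\<close> that by (auto simp: S_def)
    define k where "k = Max S"
    have k: "j < k" "z $ k \<noteq> 0" using Max_in[OF \<open>finite S\<close> \<open>S \<noteq> {}\<close>] by (auto simp: k_def S_def)
    have max: "z $ l = 0" if "k < l" for l
    proof (rule ccontr)
      assume "z $ l \<noteq> 0"
      then have "l \<in> S" using that k(1) by (simp add: S_def)
      then show False using Max_ge[OF \<open>finite S\<close>] that unfolding k_def by (meson not_less)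
    qed
    have "(M *v z) $ k = (\<Sum>l\<in>UNIV. M $ k $ l * z $ l)" by (simp add: matrix_vector_mult_def)
    also have "\<dots> = (\<Sum>l\<in>{k}. M $ k $ l * z $ l)"
    proof (intro sum.mono_neutral_right ballI)
      fix l assume "l \<in> UNIV - {k}"
      then show "M $ k $ l * z $ l = 0" using up[of l k] max[of l] by (cases l k rule: linorder_cases) auto
    qed auto
    finally have "(M *v z) $ k \<noteq> 0" using k dg by simp
    moreover have "(M *v z) $ k = axis j 1 $ k" using z by (simp add: z_def)
    ultimately show False using k(1) by (simp add: axis_def split: if_splits)
  qed
  with z that show ?thesis unfolding z_def by blast
qed

text \<open>
  For each \<open>j\<close> the \<open>\<beta> j\<close>-th subspace of the translated flag contains a vector with leading coordinate \<open>1\<close>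
  at \<open>j\<close> and otherwise supported at indices \<open>i < j\<close> of later blocks. It is obtained by solving an upper triangular system
  in which the columns of the later blocks are replaced by basis vectors.
\<close>

lemma upper_act_eq_unipotent_act:
  fixes A :: "complex^('n::{finite,linorder})^('n::{finite,linorder})"
  assumes inv: "invertible A" and up: "\<And>i j. j < i \<Longrightarrow> A $ i $ j = 0" and \<beta>: "\<And>i. \<beta> i < m"
  obtains N where "N \<in> unipotent (inversions \<beta>)" "act N (coord_flag m \<beta>) = act A (coord_flag m \<beta>)"
proof -
  have "det A = (\<Prod>i\<in>UNIV. A $ i $ i)"
    using up by (intro det_of_order[OF inj_card_greaterThan]) (simp add: card_greaterThan_less_iff)
  then have dg: "A $ i $ i \<noteq> 0" for i using inv by (simp add: invertible_det_nz)
  have "\<exists>y. y \<in> coord_space {l. \<beta> l \<le> \<beta> j} \<and>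
      (\<forall>i. (A *v y) $ i = (if i = j then 1 else if i < j \<and> \<beta> j < \<beta> i then (A *v y) $ i else 0))" for j
  proof -
    \<comment> \<open>Solving \<open>M *v z = axis j 1\<close> splits the basis vector into a vector of the flag and a vector of later blocks.\<close>
    define M :: "'n cmat" where "M = (\<chi> i l. if \<beta> l \<le> \<beta> j then A $ i $ l else if i = l then 1 else 0)"
    have M: "\<And>i l. l < i \<Longrightarrow> M $ i $ l = 0" "\<And>i. M $ i $ i \<noteq> 0"
      using up dg by (auto simp: M_def)
    obtain z where z: "M *v z = axis j 1" "\<And>i. j < i \<Longrightarrow> z $ i = 0"
      by (rule upper_triangular_solution[where j = j and M = M]) (erule M, rule M, rule that)
    define y :: "'n cvec" where "y = (\<chi> l. if \<beta> l \<le> \<beta> j then z $ l else 0)"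
    have "(A *v y) $ i = axis j 1 $ i - (if \<beta> i \<le> \<beta> j then 0 else z $ i)" for i
    proof -
      have "(M *v z) $ i = (\<Sum>l\<in>UNIV. A $ i $ l * y $ l + (if l = i then if \<beta> i \<le> \<beta> j then 0 else z $ i else 0))"
        unfolding matrix_vector_mult_def vec_lambda_beta by (rule sum.cong) (auto simp: M_def y_def)
      also have "\<dots> = (A *v y) $ i + (if \<beta> i \<le> \<beta> j then 0 else z $ i)"
        by (simp add: sum.distrib matrix_vector_mult_def)
      finally show ?thesis unfolding z(1) by simp
    qed
    then have "(A *v y) $ i = (if i = j then 1 else if i < j \<and> \<beta> j < \<beta> i then (A *v y) $ i else 0)" for i
      using z(2)[of i] by (cases i j rule: linorder_cases) (auto simp: axis_def)
    moreover have "y \<in> coord_space {l. \<beta> l \<le> \<beta> j}" by (simp add: y_def coord_space_def)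
    ultimately show ?thesis by blast
  qed
  then obtain Y where Y: "\<And>j. Y j \<in> coord_space {l. \<beta> l \<le> \<beta> j}"
    and AY: "\<And>i j. (A *v Y j) $ i = (if i = j then 1 else if i < j \<and> \<beta> j < \<beta> i then (A *v Y j) $ i else 0)"
    by metis
  define N :: "'n cmat" where "N = (\<chi> i j. (A *v Y j) $ i)"
  have col: "column j N = A *v Y j" for j by (simp add: N_def column_def vec_eq_iff)
  have N: "N \<in> unipotent (inversions \<beta>)"
    unfolding unipotent_def
  proof (intro CollectI allI impI)
    fix i j assume "(i, j) \<notin> inversions \<beta>"
    then show "N $ i $ j = (if i = j then 1 else 0)"
      using AY[where i = i and j = j] by (simp add: N_def inversions_def split: if_splits)
  qed
  then have invN: "invertible N"
    using invertible_unipotent_drops unipotent_inversions_subset by blast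
  have "(*v) N ` coord_space {i. \<beta> i \<le> k} = (*v) A ` coord_space {i. \<beta> i \<le> k}" for k
  proof (rule image_eq_of_subset[OF invN subspace_coord_space])
    show sub: "vec.subspace ((*v) A ` coord_space {i. \<beta> i \<le> k})"
      by (simp add: vec.subspace_image subspace_coord_space)
    show "(*v) N ` coord_space {i. \<beta> i \<le> k} \<subseteq> (*v) A ` coord_space {i. \<beta> i \<le> k}"
    proof
      fix v assume "v \<in> (*v) N ` coord_space {i. \<beta> i \<le> k}"
      then obtain x where x: "x \<in> coord_space {i. \<beta> i \<le> k}" "v = N *v x" by blast
      have "v = (\<Sum>j\<in>UNIV. x $ j *s (A *v Y j))" using x(2) by (simp add: matrix_mult_sum col)
      also have "\<dots> \<in> (*v) A ` coord_space {i. \<beta> i \<le> k}"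
      proof (rule vec.subspace_sum[OF sub])
        fix j
        show "x $ j *s (A *v Y j) \<in> (*v) A ` coord_space {i. \<beta> i \<le> k}"
        proof (cases "\<beta> j \<le> k")
          case True
          then have "{l. \<beta> l \<le> \<beta> j} \<subseteq> {i. \<beta> i \<le> k}" by auto
          then have "Y j \<in> coord_space {i. \<beta> i \<le> k}"
            using Y[of j] coord_space_mono by blast
          then show ?thesis using sub vec.subspace_scale by blast
        next
          case False
          then have "x $ j = 0" using x(1) by (simp add: coord_space_def)
          then show ?thesis using sub vec.subspace_0 by simp
        qed
      qed
      finally show "v \<in> (*v) A ` coord_space {i. \<beta> i \<le> k}" .
    qed
    show "vec.dim ((*v) A ` coord_space {i. \<beta> i \<le> k}) \<le> vec.dim (coord_space {i. \<beta> i \<le> k})"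
      using inv by (simp add: dim_image_invertible)
  qed
  then have "act N (coord_flag m \<beta>) = act A (coord_flag m \<beta>)"
    by (simp add: list_eq_iff_nth_eq nth_act)
  with N that show ?thesis by blast
qed

lemma unipotent_inversions_upper:
  assumes "A \<in> unipotent (inversions \<beta>)" "j < i"
  shows "A $ i $ j = 0"
proof -
  have "(i, j) \<notin> inversions \<beta>" using assms(2) by (auto simp: inversions_def)
  then show ?thesis using assms by (auto simp: unipotent_def)
qed

lemma upper_act_in_cell:
  fixes A :: "complex^('n::{finite,linorder})^('n::{finite,linorder})"
  assumes "invertible A" "\<And>i j. j < i \<Longrightarrow> A $ i $ j = 0" "\<And>i. \<beta> i < m"
  shows "act A (coord_flag m \<beta>) \<in> cell m \<beta>"
proof -
  obtain N where "N \<in> unipotent (inversions \<beta>)" "act N (coord_flag m \<beta>) = act A (coord_flag m \<beta>)"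
    using assms by (rule upper_act_eq_unipotent_act)
  then show ?thesis unfolding cell_def by (metis imageI)
qed

lemma upper_mult:
  fixes A B :: "complex^('n::{finite,linorder})^('n::{finite,linorder})"
  assumes "\<And>i j. j < i \<Longrightarrow> A $ i $ j = 0" "\<And>i j. j < i \<Longrightarrow> B $ i $ j = 0" "j < i"
  shows "(A ** B) $ i $ j = 0"
proof -
  have "A $ i $ k * B $ k $ j = 0" for k
    using assms(1)[of k i] assms(2)[of j k] assms(3) by (cases "k < i") auto
  then show ?thesis unfolding matrix_matrix_mult_def by (simp add: sum.neutral del: mult_eq_0_iff)
qed

lemma upper_act_cell:
  fixes A :: "complex^('n::{finite,linorder})^('n::{finite,linorder})"
  assumes "invertible A" "\<And>i j. j < i \<Longrightarrow> A $ i $ j = 0" "\<And>i. \<beta> i < m" "V \<in> cell m \<beta>"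
  shows "act A V \<in> cell m \<beta>"
proof -
  obtain N where N: "N \<in> unipotent (inversions \<beta>)" "V = act N (coord_flag m \<beta>)"
    using assms(4) unfolding cell_def by blast
  have "invertible N"
    using N(1) invertible_unipotent_drops unipotent_inversions_subset by blast
  then have "act (A ** N) (coord_flag m \<beta>) \<in> cell m \<beta>"
    using upper_mult[OF assms(2) unipotent_inversions_upper[OF N(1)]] assms(1,3)
    by (intro upper_act_in_cell invertible_mult) auto
  then show ?thesis by (simp add: N(2) act_mult)
qed

lemma orbit_borel_subgroup:
  fixes \<beta> :: "'n::{finite,linorder} \<Rightarrow> nat"
  assumes \<beta>: "\<And>i. \<beta> i < m"
  shows "orbit borel_subgroup (coord_flag m \<beta>) = cell m \<beta>"
proof
  show "orbit borel_subgroup (coord_flag m \<beta>) \<subseteq> cell m \<beta>"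
    unfolding orbit_def
  proof (rule image_subsetI)
    fix A :: "'n cmat" assume "A \<in> borel_subgroup"
    then show "act A (coord_flag m \<beta>) \<in> cell m \<beta>"
      using SL_subset_GL[of A] \<beta> by (intro upper_act_in_cell) (auto simp: borel_subgroup_def)
  qed
  show "cell m \<beta> \<subseteq> orbit borel_subgroup (coord_flag m \<beta>)"
  proof
    fix V assume "V \<in> cell m \<beta>"
    then obtain N where N: "N \<in> unipotent (inversions \<beta>)" "V = act N (coord_flag m \<beta>)"
      unfolding cell_def by blast
    have inv: "invertible N"
      using N(1) invertible_unipotent_drops unipotent_inversions_subset by blast
    have "normalize_det N $ i $ j = 0" if "j < i" for i j
      unfolding normalize_det_def
      by (rule upper_mult[OF unipotent_inversions_upper[OF N(1)] _ that]) (auto simp: det_fix_def)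
    then have "normalize_det N \<in> borel_subgroup"
      using normalize_det_in_SL[OF inv] by (simp add: borel_subgroup_def)
    moreover have "V = act (normalize_det N) (coord_flag m \<beta>)"
      using act_normalize_det[OF inv \<beta>] N(2) by simp
    ultimately show "V \<in> orbit borel_subgroup (coord_flag m \<beta>)" unfolding orbit_def by blast
  qed
qed

text \<open>
  With the last nonzero coordinate as pivot, the pivoted basis is an upper triangular matrix.
\<close>

lemma bruhat_decomposition:
  fixes V :: "('n::{finite,linorder}) flag"
  assumes V: "V \<in> flags f" and f: "sum_list f = CARD('n)"
  obtains \<beta> where "labelling f \<beta>" "V \<in> cell (length f) \<beta>"
proof -
  define Q where "Q i y \<longleftrightarrow> (\<forall>j>i. y $ j = 0)" for i :: 'n and y :: "'n cvec"
  have Q: "\<exists>i. x $ i \<noteq> 0 \<and> Q i (inverse (x $ i) *s x)" if "x \<noteq> 0" for x :: "'n cvec"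
  proof -
    let ?S = "{i. x $ i \<noteq> 0}"
    have ne: "?S \<noteq> {}" using that by (auto simp: vec_eq_iff)
    define k where "k = Max ?S"
    have "x $ k \<noteq> 0" using Max_in[OF _ ne] by (simp add: k_def)
    moreover have "x $ j = 0" if "k < j" for j
    proof (rule ccontr)
      assume "x $ j \<noteq> 0"
      then have "j \<le> k" unfolding k_def by (intro Max_ge) auto
      then show False using that by simp
    qed
    ultimately have "x $ k \<noteq> 0 \<and> Q k (inverse (x $ k) *s x)" by (simp add: Q_def)
    then show ?thesis ..
  qed
  obtain A :: "'n cmat" and \<tau> where \<tau>: "bij_betw \<tau> UNIV {..<CARD('n)}"
    and A: "\<And>i. A $ i $ i = 1" "\<And>i j. \<tau> i < \<tau> j \<Longrightarrow> A $ i $ j = 0" "\<And>j. Q j (column j A)" "invertible A"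
    and VA: "\<And>k. k < length f \<Longrightarrow> V ! k = (*v) A ` coord_space {i. \<tau> i < partial_sum f (Suc k)}"
    by (rule pivot_basis[OF V f Q]) (assumption, rule that)
  obtain \<beta> where \<beta>: "labelling f \<beta>" "\<And>i j. \<tau> i \<le> \<tau> j \<Longrightarrow> \<beta> i \<le> \<beta> j"
    "\<And>k. k < length f \<Longrightarrow> {i. \<beta> i \<le> k} = {i. \<tau> i < partial_sum f (Suc k)}"
    by (rule labelling_of_order[OF \<tau> f]) (rule that)
  have "V = act A (coord_flag (length f) \<beta>)"
  proof (rule nth_equalityI)
    show "length V = length (act A (coord_flag (length f) \<beta>))" using V by (simp add: flags_def)
    fix k assume "k < length V"
    then have "k < length f" using V by (simp add: flags_def)
    then show "V ! k = act A (coord_flag (length f) \<beta>) ! k" by (simp add: nth_act VA \<beta>(3))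
  qed
  moreover have "A $ i $ j = 0" if "j < i" for i j
    using A(3)[of j] that by (simp add: Q_def column_def)
  ultimately have "V \<in> cell (length f) \<beta>"
    using upper_act_in_cell[OF A(4), of \<beta> "length f"] \<beta>(1) by (simp add: labelling_def)
  with \<beta>(1) that show ?thesis by blast
qed

lemma finite_labellings: "finite {\<beta> :: 'n::finite \<Rightarrow> nat. labelling f \<beta>}"
proof (rule finite_subset)
  show "finite {\<beta> :: 'n \<Rightarrow> nat. \<forall>i. (i \<in> UNIV \<longrightarrow> \<beta> i \<in> {..<length f}) \<and> (i \<notin> UNIV \<longrightarrow> \<beta> i = 0)}"
    by (rule finite_set_of_finite_funs) auto
qed (auto simp: labelling_def)

section \<open>Dimensions of Schubert varieties and of the flag manifold\<close>

text \<open>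
  A nonzero term \<open>A $ i $ k * B $ k $ j\<close> has labels weakly decreasing from \<open>i\<close> over \<open>k\<close> to \<open>j\<close>.
\<close>

lemma unipotent_drops_mult:
  fixes A B :: "complex^'n^'n"
  assumes A: "A \<in> unipotent (drops \<beta>)" and B: "B \<in> unipotent (drops \<beta>)"
  shows "A ** B \<in> unipotent (drops \<beta>)"
  unfolding unipotent_def
proof (intro CollectI allI impI)
  fix i j assume ij: "(i, j) \<notin> drops \<beta>"
  have "(A ** B) $ i $ j = (\<Sum>k\<in>UNIV. A $ i $ k * B $ k $ j)"
    by (simp add: matrix_matrix_mult_def)
  also have "\<dots> = (\<Sum>k\<in>{i}. A $ i $ k * B $ k $ j)"
  proof (intro sum.mono_neutral_right ballI)
    fix k assume "k \<in> UNIV - {i}"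
    then show "A $ i $ k * B $ k $ j = 0"
      using unipotent_drops_entry[OF A, of i k] unipotent_drops_entry[OF B, of k j] ij
      by (cases "\<beta> i \<le> \<beta> k") (auto simp: drops_def)
  qed auto
  also have "\<dots> = (if i = j then 1 else 0)"
    using unipotent_drops_entry[OF A, of i i] unipotent_drops_entry[OF B, of i j] ij
    by (auto simp: drops_def)
  finally show "(A ** B) $ i $ j = (if i = j then 1 else 0)" .
qed

text \<open>
  The group of unipotent upper triangular matrices in the chart of \<open>\<beta>\<close> acts freely on this chart
  and preserves the cell of \<open>\<gamma>\<close>. Its orbit through a common point embeds an affine space with the inversions of \<open>\<beta>\<close> as
  coordinates into one with the inversions of \<open>\<gamma>\<close> as coordinates. This replaces the combinatorics of the Bruhat order.
\<close>

lemma card_inversions_le_of_meets_chart: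
  fixes \<beta> \<gamma> :: "'n::{finite,linorder} \<Rightarrow> nat"
  assumes f: "sum_list f = CARD('n)" and \<beta>: "labelling f \<beta>" and \<gamma>: "labelling f \<gamma>"
    and meet: "cell (length f) \<gamma> \<inter> chart (length f) \<beta> \<noteq> {}"
  shows "card (inversions \<beta>) \<le> card (inversions \<gamma>)"
proof -
  let ?X = "flag_topology f :: 'n flag topology" and ?F = "coord_flag (length f) \<beta>"
  obtain V where V: "V \<in> cell (length f) \<gamma>" "V \<in> chart (length f) \<beta>" using meet by blast
  then obtain N where N: "N \<in> unipotent (drops \<beta>)" "V = act N ?F" unfolding chart_def by blast
  have len: "\<beta> i < length f" "\<gamma> i < length f" for i using \<beta> \<gamma> by (simp_all add: labelling_def)
  have inv: "invertible u" if "u \<in> unipotent (inversions \<beta>)" for u :: "'n cmat"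
    using that invertible_unipotent_drops unipotent_inversions_subset by blast
  have inj: "inj_on (\<lambda>u. act u V) (unipotent (inversions \<beta>))"
  proof (rule inj_onI)
    fix u v assume u: "u \<in> unipotent (inversions \<beta>)" and v: "v \<in> unipotent (inversions \<beta>)"
      and eq: "act u V = act v V"
    have "u ** N \<in> unipotent (drops \<beta>)" "v ** N \<in> unipotent (drops \<beta>)"
      using u v N(1) unipotent_inversions_subset unipotent_drops_mult by blast+
    moreover have "act (u ** N) ?F = act (v ** N) ?F" using eq by (simp add: N(2) act_mult)
    ultimately have "u ** N = v ** N" using inj_on_chart[of \<beta> "length f", OF len(1)] by (simp add: inj_onD)
    moreover obtain N' where "N ** N' = mat 1"
      using matrix_inverse_exists[OF invertible_unipotent_drops[OF N(1)]] by blast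
    ultimately show "u = v" by (metis matrix_mul_assoc matrix_mul_rid)
  qed
  have VF: "V \<in> flags f"
    using N invertible_unipotent_drops[OF N(1)] act_in_flags coord_flag_in_flags[OF \<beta>] by blast
  have "unipotent (inversions \<beta>) \<subseteq> (GL :: 'n cmat set)" using inv by blast
  then have "continuous_map (top_of_set (unipotent (inversions \<beta>))) ?X (\<lambda>u. act u V)"
    using continuous_map_orbit_map[OF f VF] continuous_map_from_subtopology_mono by blast
  moreover have "act u V \<in> cell (length f) \<gamma>" if "u \<in> unipotent (inversions \<beta>)" for u
    using upper_act_cell[OF inv[OF that] unipotent_inversions_upper[OF that] len(2) V(1)] by blast
  ultimately have cont: "continuous_map (top_of_set (unipotent (inversions \<beta>)))
      (subtopology ?X (cell (length f) \<gamma>)) (\<lambda>u. act u V)"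
    by (auto simp: continuous_map_in_subtopology)
  let ?a = "2 * card (inversions \<beta>)" and ?b = "2 * card (inversions \<gamma>)"
  obtain g where g: "homeomorphic_map (Euclidean_space ?a) (top_of_set (unipotent (inversions \<beta>) :: 'n cmat set)) g"
    using homeomorphic_space_sym[THEN iffD1, OF unipotent_homeomorphic_Euclidean_space] homeomorphic_space by blast
  obtain h where h: "homeomorphic_map (subtopology ?X (cell (length f) \<gamma>)) (Euclidean_space ?b) h"
    using homeomorphic_space_sym[THEN iffD1, OF homeomorphic_space_cell[OF f \<gamma>]] homeomorphic_space by blast
  let ?G = "h \<circ> ((\<lambda>u. act u V) \<circ> g)"
  have gim: "g ` topspace (Euclidean_space ?a) = unipotent (inversions \<beta>)"
    using homeomorphic_imp_surjective_map[OF g] by simp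
  have "continuous_map (Euclidean_space ?a) (Euclidean_space ?b) ?G"
    by (intro continuous_map_compose[OF continuous_map_compose[OF homeomorphic_imp_continuous_map[OF g] cont]]
        homeomorphic_imp_continuous_map[OF h])
  moreover have "inj_on ?G (topspace (Euclidean_space ?a))"
  proof (intro comp_inj_on homeomorphic_imp_injective_map[OF g])
    show "inj_on (\<lambda>u. act u V) (g ` topspace (Euclidean_space ?a))" unfolding gim by (rule inj)
    have "((\<lambda>u. act u V) \<circ> g) ` topspace (Euclidean_space ?a) \<subseteq> topspace (subtopology ?X (cell (length f) \<gamma>))"
      using continuous_map_image_subset_topspace[OF continuous_map_compose[OF homeomorphic_imp_continuous_map[OF g] cont]] by simp
    then show "inj_on h (((\<lambda>u. act u V) \<circ> g) ` topspace (Euclidean_space ?a))"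
      using homeomorphic_imp_injective_map[OF h] inj_on_subset by blast
  qed
  moreover have "topspace (Euclidean_space ?a) \<noteq> {}" by (auto simp: topspace_Euclidean_space)
  ultimately have "?a \<le> ?b"
    using injective_map_Euclidean_space_le[of ?a "topspace (Euclidean_space ?a)" ?b ?G] by simp
  then show ?thesis by simp
qed

lemma cell_in_flags:
  assumes "labelling f \<beta>" "V \<in> cell (length f) \<beta>"
  shows "V \<in> flags f"
proof -
  obtain N where N: "N \<in> unipotent (inversions \<beta>)" "V = act N (coord_flag (length f) \<beta>)"
    using assms(2) unfolding cell_def by blast
  have "invertible N"
    using N(1) invertible_unipotent_drops unipotent_inversions_subset by blast
  then show ?thesis using N(2) act_in_flags coord_flag_in_flags[OF assms(1)] by blast
qed

text \<open>
  A translate of the chart of \<open>\<beta>\<close> is a neighbourhood of the point \<open>V\<close>, so it meets the cell of \<open>\<gamma>\<close>.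
\<close>

lemma card_inversions_le_in_closure:
  fixes \<beta> \<gamma> :: "'n::{finite,linorder} \<Rightarrow> nat"
  assumes f: "sum_list f = CARD('n)" and \<beta>: "labelling f \<beta>" and \<gamma>: "labelling f \<gamma>"
    and V: "V \<in> cell (length f) \<beta>" "V \<in> flag_topology f closure_of cell (length f) \<gamma>"
  shows "card (inversions \<beta>) \<le> card (inversions \<gamma>)"
proof -
  let ?X = "flag_topology f :: 'n flag topology" and ?F = "coord_flag (length f) \<beta>"
  obtain N where N: "N \<in> unipotent (inversions \<beta>)" "V = act N ?F"
    using V(1) unfolding cell_def by blast
  have inv: "invertible N"
    using N(1) invertible_unipotent_drops unipotent_inversions_subset by blast
  have len: "\<gamma> i < length f" for i using \<gamma> by (simp add: labelling_def)
  have "openin ?X (act N ` chart (length f) \<beta>)"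
    using homeomorphic_imp_open_map[OF homeomorphic_map_act[OF f inv]] openin_chart[OF f \<beta>]
    unfolding open_map_def by blast
  moreover have "V \<in> act N ` chart (length f) \<beta>"
    using N(2) coord_flag_in_chart by blast
  ultimately obtain W where W: "W \<in> cell (length f) \<gamma>" "W \<in> act N ` chart (length f) \<beta>"
    using V(2) unfolding in_closure_of by blast
  then obtain M where M: "M \<in> unipotent (drops \<beta>)" "W = act N (act M ?F)" unfolding chart_def by blast
  have "act (N ** M) ?F = W" using M by (simp add: act_mult)
  moreover have "N ** M \<in> unipotent (drops \<beta>)"
    using N(1) M(1) unipotent_inversions_subset unipotent_drops_mult by blast
  ultimately have "W \<in> chart (length f) \<beta>" unfolding chart_def by blast
  then show ?thesis using card_inversions_le_of_meets_chart[OF f \<beta> \<gamma>] W(1) by blast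
qed

text \<open>
  The Bruhat decomposition provides the finite cover by locally closed cells.
\<close>

lemma embeds_dim_flags_le:
  fixes S :: "('n::{finite,linorder}) flag set"
  assumes f: "sum_list f = CARD('n)" and S: "S \<subseteq> flags f" and d: "embeds_dim d (flag_topology f) S"
    and m: "\<And>\<beta>. labelling f \<beta> \<Longrightarrow> cell (length f) \<beta> \<inter> S \<noteq> {} \<Longrightarrow> card (inversions \<beta>) \<le> m"
  shows "d \<le> m"
proof -
  let ?I = "{\<beta>. labelling f \<beta> \<and> cell (length f) \<beta> \<inter> S \<noteq> {}}"
  have "\<exists>C. labelling f \<beta> \<longrightarrow> closedin (flag_topology f) C \<and> cell (length f) \<beta> = chart (length f) \<beta> \<inter> C"
    for \<beta> :: "'n \<Rightarrow> nat"
    using cell_locally_closed[OF f, of \<beta>] by blast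
  then have "\<exists>C. \<forall>\<beta> :: 'n \<Rightarrow> nat. labelling f \<beta> \<longrightarrow> closedin (flag_topology f) (C \<beta>) \<and>
      cell (length f) \<beta> = chart (length f) \<beta> \<inter> C \<beta>"
    by (intro choice allI)
  then obtain C where *: "\<forall>\<beta> :: 'n \<Rightarrow> nat. labelling f \<beta> \<longrightarrow> closedin (flag_topology f) (C \<beta>) \<and>
      cell (length f) \<beta> = chart (length f) \<beta> \<inter> C \<beta>" by (rule exE)
  have C: "closedin (flag_topology f) (C \<beta>)" "cell (length f) \<beta> = chart (length f) \<beta> \<inter> C \<beta>"
    if "labelling f \<beta>" for \<beta> :: "'n \<Rightarrow> nat"
    using * that by simp_all
  show ?thesis
  proof (rule embeds_dim_le_of_cells[OF d, of ?I "chart (length f)" C "\<lambda>\<beta>. card (inversions \<beta>)"])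
    show "finite ?I" using finite_labellings by (rule rev_finite_subset) blast
    show "S \<subseteq> (\<Union>\<beta>\<in>?I. chart (length f) \<beta> \<inter> C \<beta>)"
    proof
      fix V assume V: "V \<in> S"
      then obtain \<beta> where "labelling f \<beta>" "V \<in> cell (length f) \<beta>"
        using S by (meson bruhat_decomposition f subsetD)
      then show "V \<in> (\<Union>\<beta>\<in>?I. chart (length f) \<beta> \<inter> C \<beta>)" using V C(2) by blast
    qed
    show "subtopology (flag_topology f) (chart (length f) \<beta> \<inter> C \<beta>) homeomorphic_space
        Euclidean_space (2 * card (inversions \<beta>))" if "\<beta> \<in> ?I" for \<beta>
      using homeomorphic_space_cell[OF f, of \<beta>] C(2)[of \<beta>] that homeomorphic_space_sym by force
    show "card (inversions \<beta>) \<le> m" if "\<beta> \<in> ?I" for \<beta> using m that by blast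
  qed (use C openin_chart[OF f] in auto)
qed

lemma complex_dim_schubert_variety:
  fixes \<beta> :: "'n::{finite,linorder} \<Rightarrow> nat"
  assumes f: "sum_list f = CARD('n)" and \<beta>: "labelling f \<beta>"
  shows "complex_dim (flag_topology f) (flag_topology f closure_of cell (length f) \<beta>) = card (inversions \<beta>)"
proof (rule complex_dim_eqI)
  let ?X = "flag_topology f :: 'n flag topology"
  have "cell (length f) \<beta> \<subseteq> topspace ?X"
    using cell_in_flags[OF \<beta>] by (auto simp: topspace_flag_topology[OF f])
  then have "cell (length f) \<beta> \<subseteq> ?X closure_of cell (length f) \<beta>" by (rule closure_of_subset)
  then show "embeds_dim (card (inversions \<beta>)) ?X (?X closure_of cell (length f) \<beta>)"
    using embeds_dim_if_homeomorphic[OF homeomorphic_space_cell[OF f \<beta>]] by (rule embeds_dim_mono)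
  fix d assume d: "embeds_dim d ?X (?X closure_of cell (length f) \<beta>)"
  have "?X closure_of cell (length f) \<beta> \<subseteq> flags f"
    unfolding topspace_flag_topology[OF f, symmetric] by (rule closure_of_subset_topspace)
  then show "d \<le> card (inversions \<beta>)"
    using d
  proof (rule embeds_dim_flags_le[OF f])
    fix \<gamma> assume \<gamma>: "labelling f \<gamma>" "cell (length f) \<gamma> \<inter> ?X closure_of cell (length f) \<beta> \<noteq> {}"
    then obtain V where "V \<in> cell (length f) \<gamma>" "V \<in> ?X closure_of cell (length f) \<beta>" by blast
    then show "card (inversions \<gamma>) \<le> card (inversions \<beta>)"
      by (rule card_inversions_le_in_closure[OF f \<gamma>(1) \<beta>])
  qed
qed

text \<open>
  The number of drops depends only on the dimension sequence. The summand for \<open>k\<close> counts the pairs whose second entry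
  has label \<open>k\<close>.
\<close>

lemma card_drops:
  fixes \<beta> :: "'n::finite \<Rightarrow> nat"
  assumes f: "sum_list f = CARD('n)" and \<beta>: "labelling f \<beta>"
  shows "card (drops \<beta>) = (\<Sum>k<length f. (CARD('n) - partial_sum f (Suc k)) * (partial_sum f (Suc k) - partial_sum f k))"
proof -
  have le: "card {i. \<beta> i \<le> k} = partial_sum f (Suc k)" if "k < length f" for k
    using \<beta> that by (simp add: labelling_def)
  have less: "card {i. \<beta> i < k} = partial_sum f k" if "k < length f" for k
    using le[of "k - 1"] that by (cases k) (simp_all add: partial_sum_def less_Suc_eq_le)
  have eq: "card {i. \<beta> i = k} = partial_sum f (Suc k) - partial_sum f k" if "k < length f" for k
  proof -
    have "{i. \<beta> i = k} = {i. \<beta> i \<le> k} - {i. \<beta> i < k}" by auto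
    also have "card \<dots> = card {i. \<beta> i \<le> k} - card {i. \<beta> i < k}" by (rule card_Diff_subset) auto
    finally show ?thesis using le less that by simp
  qed
  have gt: "card {i. k < \<beta> i} = CARD('n) - partial_sum f (Suc k)" if "k < length f" for k
  proof -
    have "{i. k < \<beta> i} = UNIV - {i. \<beta> i \<le> k}" by auto
    also have "card \<dots> = CARD('n) - card {i. \<beta> i \<le> k}" by (rule card_Diff_subset) auto
    finally show ?thesis using le that by simp
  qed
  have "drops \<beta> = (\<Union>k<length f. {i. k < \<beta> i} \<times> {j. \<beta> j = k})"
    using \<beta> by (auto simp: drops_def labelling_def)
  also have "card \<dots> = (\<Sum>k<length f. card ({i. k < \<beta> i} \<times> {j. \<beta> j = k}))"
    by (rule card_UN_disjoint) auto
  also have "\<dots> = (\<Sum>k<length f. (CARD('n) - partial_sum f (Suc k)) * (partial_sum f (Suc k) - partial_sum f k))"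
    by (rule sum.cong) (simp_all add: card_cartesian_product gt eq)
  finally show ?thesis .
qed

lemma complex_dim_flags:
  fixes \<beta> :: "'n::{finite,linorder} \<Rightarrow> nat"
  assumes f: "sum_list f = CARD('n)" and \<beta>: "labelling f \<beta>"
  shows "complex_dim (flag_topology f) (flags f :: 'n flag set) = card (drops \<beta>)"
proof (rule complex_dim_eqI)
  let ?X = "flag_topology f :: 'n flag topology"
  have "chart (length f) \<beta> \<subseteq> flags f"
    using openin_subset[OF openin_chart[OF f \<beta>]] topspace_flag_topology[OF f] by blast
  then show "embeds_dim (card (drops \<beta>)) ?X (flags f)"
    using embeds_dim_if_homeomorphic[OF homeomorphic_space_chart[OF f \<beta>]] by (rule embeds_dim_mono)
  fix d assume "embeds_dim d ?X (flags f)"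
  then show "d \<le> card (drops \<beta>)"
  proof (rule embeds_dim_flags_le[OF f order_refl])
    fix \<gamma> :: "'n \<Rightarrow> nat" assume \<gamma>: "labelling f \<gamma>"
    have "card (inversions \<gamma>) \<le> card (drops \<gamma>)"
      by (rule card_mono) (auto simp: inversions_def drops_def)
    then show "card (inversions \<gamma>) \<le> card (drops \<beta>)"
      using card_drops[OF f \<beta>] card_drops[OF f \<gamma>] by simp
  qed
qed

section \<open>The bilinear form and Witt's theorem\<close>

definition bil :: "complex^('n::finite) \<Rightarrow> complex^('n::finite) \<Rightarrow> complex" where
  "bil v w = (\<Sum>i\<in>UNIV. v $ i * w $ i)"

lemma perp_bil: "perp W = {v. \<forall>w\<in>W. bil v w = 0}"
  by (simp add: perp_def bil_def)

lemma bil_commute: "bil v w = bil w v"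
  by (simp add: bil_def mult.commute)

lemma bil_add_left: "bil (u + v) w = bil u w + bil v w"
  by (simp add: bil_def distrib_right sum.distrib)

lemma bil_diff_left: "bil (u - v) w = bil u w - bil v w"
  by (simp add: bil_def left_diff_distrib sum_subtractf)

lemma bil_scale_left: "bil (c *s v) w = c * bil v w"
  by (simp add: bil_def sum_distrib_left mult.assoc)

lemma bil_add_right: "bil w (u + v) = bil w u + bil w v"
  by (simp add: bil_def distrib_left sum.distrib)

lemma bil_diff_right: "bil w (u - v) = bil w u - bil w v"
  by (simp add: bil_def right_diff_distrib sum_subtractf)

lemma bil_scale_right: "bil w (c *s v) = c * bil w v"
  by (simp add: bil_def sum_distrib_left mult.assoc mult.left_commute)

lemmas bil_simps = bil_add_left bil_diff_left bil_scale_left bil_add_right bil_diff_right bil_scale_right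

lemma bil_zero_left [simp]: "bil 0 w = 0"
  by (simp add: bil_def)

lemma bil_matrix_right:
  fixes A :: "complex^'n^'n"
  shows "bil v (A *v w) = bil (transpose A *v v) w"
proof -
  have "bil v (A *v w) = (\<Sum>i\<in>UNIV. \<Sum>j\<in>UNIV. v $ i * (A $ i $ j * w $ j))"
    by (simp add: bil_def matrix_vector_mult_def sum_distrib_left)
  also have "\<dots> = (\<Sum>j\<in>UNIV. \<Sum>i\<in>UNIV. v $ i * (A $ i $ j * w $ j))" by (rule sum.swap)
  also have "\<dots> = bil (transpose A *v v) w"
    by (simp add: bil_def matrix_vector_mult_def transpose_def sum_distrib_right sum_distrib_left mult_ac)
  finally show ?thesis .
qed

lemma subspace_perp: "vec.subspace (perp W)"
  unfolding vec.subspace_def perp_bil by (auto simp: bil_simps)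

lemma perp_antimono: "U \<subseteq> W \<Longrightarrow> perp W \<subseteq> perp U"
  by (auto simp: perp_bil)

lemma subset_perp_perp: "W \<subseteq> perp (perp W)"
  by (auto simp: perp_bil bil_commute)

lemma perp_coord_space: "perp (coord_space S) = coord_space (- S)"
proof (intro equalityI subsetI)
  fix v :: "complex^'a" assume v: "v \<in> perp (coord_space S)"
  have "v $ i = 0" if "i \<in> S" for i
  proof -
    have "bil v (axis i 1) = 0" using v axis_in_coord_space[OF that] by (simp add: perp_bil)
    then show ?thesis by (simp add: bil_def axis_def if_distrib cong: if_cong)
  qed
  then show "v \<in> coord_space (- S)" by (simp add: coord_space_def)
next
  fix v :: "complex^'a" assume v: "v \<in> coord_space (- S)"
  have "bil v w = 0" if w: "w \<in> coord_space S" for w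
    unfolding bil_def
  proof (rule sum.neutral, rule ballI)
    fix i show "v $ i * w $ i = 0" using v w by (cases "i \<in> S") (auto simp: coord_space_def)
  qed
  then show "v \<in> perp (coord_space S)" by (simp add: perp_bil)
qed

lemma dim_le_CARD: "vec.dim (W :: (complex^'n) set) \<le> CARD('n)"
  using vec.dim_subset[of W UNIV] by (simp add: card_cart_basis)

text \<open>
  A subspace together with the whole space is a flag, so this is transitivity on flags.
\<close>

lemma subspace_eq_image_coord_space:
  fixes W :: "(complex^('n::{finite,linorder})) set"
  assumes W: "vec.subspace W"
  obtains h :: "'n cmat" and S where "invertible h" "W = (*v) h ` coord_space S"
proof -
  let ?f = "[vec.dim W, CARD('n) - vec.dim W]"
  have le: "vec.dim W \<le> CARD('n)" by (rule dim_le_CARD)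
  then have f: "sum_list ?f = CARD('n)" by simp
  have VF: "[W, UNIV] \<in> flags ?f"
    using W le by (auto simp: flags_def less_Suc_eq partial_sum_def card_cart_basis nth_Cons')
  obtain h where h: "invertible h" "[W, UNIV] = act h (standard_flag ?f)"
    by (rule flags_transitive[OF standard_flag_in_flags[OF f] VF f]) (rule that)
  have "W = act h (standard_flag ?f) ! 0" unfolding h(2)[symmetric] by simp
  also have "\<dots> = (*v) h ` (standard_flag ?f ! 0)"
    by (rule nth_act) (simp add: standard_flag_def coordinate_flag_def)
  also have "standard_flag ?f ! 0 = coord_space {i::'n. card {..<i} < partial_sum ?f (Suc 0)}"
    by (rule nth_standard_flag) simp
  finally show ?thesis using h(1) that by blast
qed

text \<open>
  The transpose of \<open>h\<close> carries the complement of \<open>W\<close> to the complement of a coordinate subspace.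
\<close>

lemma dim_perp:
  fixes W :: "(complex^('n::{finite,linorder})) set"
  assumes "vec.subspace W"
  shows "vec.dim (perp W) = CARD('n) - vec.dim W"
proof -
  obtain h :: "'n cmat" and S where h: "invertible h" "W = (*v) h ` coord_space S"
    using assms by (rule subspace_eq_image_coord_space)
  have ht: "invertible (transpose h)" using h(1) by (simp add: invertible_det_nz det_transpose)
  have *: "v \<in> perp W \<longleftrightarrow> transpose h *v v \<in> coord_space (- S)" for v
    unfolding perp_coord_space[symmetric] by (simp add: h(2) perp_bil bil_matrix_right)
  have "(*v) (transpose h) ` perp W = coord_space (- S)"
  proof (intro equalityI subsetI)
    fix y :: "'n cvec" assume y: "y \<in> coord_space (- S)"
    obtain g where "transpose h ** g = mat 1" using matrix_inverse_exists[OF ht] by blast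
    then have "transpose h *v (g *v y) = y" by (simp add: matrix_vector_mul_assoc)
    then show "y \<in> (*v) (transpose h) ` perp W" using y * by (metis image_eqI)
  qed (use * in blast)
  then have "vec.dim (perp W) = vec.dim (coord_space (- S) :: 'n cvec set)"
    using dim_image_invertible[OF ht, of "perp W"] by simp
  also have "\<dots> = CARD('n) - card S"
    by (simp add: dim_coord_space Compl_eq_Diff_UNIV card_Diff_subset)
  also have "card S = vec.dim W"
    unfolding h(2) dim_image_invertible[OF h(1)] by (simp add: dim_coord_space)
  finally show ?thesis .
qed

lemma perp_perp:
  fixes W :: "(complex^('n::{finite,linorder})) set"
  assumes "vec.subspace W"
  shows "perp (perp W) = W"
proof -
  have "W = perp (perp W)"
  proof (rule vec.subspace_dim_equal[OF assms subspace_perp subset_perp_perp])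
    show "vec.dim (perp (perp W)) \<le> vec.dim W"
      using dim_le_CARD[of W] by (simp add: dim_perp[OF subspace_perp] dim_perp[OF assms])
  qed
  then show ?thesis by simp
qed

definition preserves_bil :: "complex^('n::finite)^('n::finite) \<Rightarrow> bool" where
  "preserves_bil A \<longleftrightarrow> transpose A ** A = mat 1"

lemma preserves_bil_invertible: "preserves_bil A \<Longrightarrow> invertible A"
  unfolding preserves_bil_def invertible_left_inverse by blast

lemma preserves_bil_bil:
  fixes A :: "complex^'n^'n"
  assumes "preserves_bil A"
  shows "bil (A *v v) (A *v w) = bil v w"
  using assms by (simp add: bil_matrix_right preserves_bil_def matrix_vector_mul_assoc)

lemma preserves_bil_mult:
  fixes A B :: "complex^'n^'n"
  assumes "preserves_bil A" "preserves_bil B"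
  shows "preserves_bil (A ** B)"
proof -
  have "transpose (A ** B) ** (A ** B) = transpose B ** ((transpose A ** A) ** B)"
    by (simp add: matrix_transpose_mul matrix_mul_assoc)
  then show ?thesis using assms by (simp add: preserves_bil_def)
qed

lemma preserves_bil_one: "preserves_bil (mat 1)"
  by (simp add: preserves_bil_def)

lemma preserves_bil_inverse:
  fixes A :: "complex^'n^'n"
  assumes "preserves_bil A"
  shows "preserves_bil (transpose A)" "A ** transpose A = mat 1"
  using assms matrix_left_right_inverse[of "transpose A" A] by (simp_all add: preserves_bil_def)

lemma perp_image:
  fixes A :: "complex^'n^'n"
  assumes A: "preserves_bil A"
  shows "perp ((*v) A ` W) = (*v) A ` perp W"
proof (intro equalityI subsetI)
  fix v assume v: "v \<in> perp ((*v) A ` W)"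
  have "A *v (transpose A *v v) = v"
    unfolding matrix_vector_mul_assoc preserves_bil_inverse(2)[OF A] by (rule matrix_vector_mul_lid)
  moreover have "transpose A *v v \<in> perp W"
    using v by (simp add: perp_bil bil_matrix_right)
  ultimately show "v \<in> (*v) A ` perp W" by (metis image_eqI)
next
  fix v assume "v \<in> (*v) A ` perp W"
  then show "v \<in> perp ((*v) A ` W)" by (auto simp: perp_bil preserves_bil_bil[OF A])
qed

text \<open>
  The reflection in \<open>v - w\<close>, which is defined because \<open>bil (v - w) (v - w) = - 2 * bil v w\<close> is nonzero.
\<close>

lemma reflection_exists:
  fixes v w :: "complex^'n"
  assumes v: "bil v v = 0" and w: "bil w w = 0" and vw: "bil v w \<noteq> 0"
  obtains A where "preserves_bil A" "A *v v = w" "\<And>x. bil x v = bil x w \<Longrightarrow> A *v x = x"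
proof -
  define u where "u = v - w"
  define q where "q = bil u u"
  have q: "q = - 2 * bil v w" using v w by (simp add: q_def u_def bil_simps bil_commute[of w v])
  then have q0: "q \<noteq> 0" using vw by simp
  define A :: "complex^'n^'n" where "A = (\<chi> i j. (if i = j then 1 else 0) - 2 * u $ i * u $ j / q)"
  have Ax: "A *v x = x - (2 * bil u x / q) *s u" for x
  proof (rule vec_eq_iff[THEN iffD2], rule allI)
    fix i
    have "(A *v x) $ i = (\<Sum>j\<in>UNIV. (if j = i then x $ i else 0) - 2 / q * u $ i * (u $ j * x $ j))"
      unfolding matrix_vector_mult_def vec_lambda_beta
      by (rule sum.cong) (auto simp: A_def left_diff_distrib)
    also have "\<dots> = x $ i - 2 / q * u $ i * bil u x"
      by (simp add: sum_subtractf bil_def sum_distrib_left)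
    finally show "(A *v x) $ i = (x - (2 * bil u x / q) *s u) $ i" by simp
  qed
  have "A *v (A *v x) = x" for x
  proof -
    have "bil u (x - (2 * bil u x / q) *s u) = - bil u x"
      using q0 by (simp add: bil_simps q_def)
    then show ?thesis by (simp add: Ax vec_eq_iff)
  qed
  then have "A ** A = mat 1" by (simp add: matrix_eq matrix_vector_mul_assoc[symmetric])
  moreover have "transpose A = A" by (simp add: transpose_def A_def vec_eq_iff)
  ultimately have "preserves_bil A" by (simp add: preserves_bil_def)
  moreover have "A *v v = w"
  proof -
    have "2 * bil u v / q = 1" using v q0 by (simp add: u_def bil_simps q bil_commute[of w v])
    then show ?thesis by (simp add: Ax u_def)
  qed
  moreover have "A *v x = x" if "bil x v = bil x w" for x
    using that by (simp add: Ax u_def bil_simps bil_commute[of _ x])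
  ultimately show ?thesis using that by blast
qed

text \<open>
  If \<open>v\<close> and \<open>w\<close> are orthogonal, no single reflection works. The condition on \<open>v\<close> yields an isotropic vector \<open>z\<close>
  orthogonal to \<open>R\<close> but to neither \<open>v\<close> nor \<open>w\<close>, and two reflections are composed.
\<close>

lemma isometry_moving_isotropic_vector:
  fixes v w :: "complex^('n::{finite,linorder})"
  assumes v: "bil v v = 0" and w: "bil w w = 0" and R: "vec.subspace R"
    and Rv: "\<And>x. x \<in> R \<Longrightarrow> bil x v = 0" and Rw: "\<And>x. x \<in> R \<Longrightarrow> bil x w = 0"
    and ni: "v \<notin> vec.span (insert (v - w) R)"
  obtains A where "preserves_bil A" "A *v v = w" "\<And>x. x \<in> R \<Longrightarrow> A *v x = x"
proof (cases "bil v w = 0")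
  case False
  then obtain A where "preserves_bil A" "A *v v = w" "\<And>x. bil x v = bil x w \<Longrightarrow> A *v x = x"
    by (rule reflection_exists[OF v w]) (rule that)
  then show ?thesis using that Rv Rw by simp
next
  case True
  let ?U = "vec.span (insert (v - w) R)"
  have "perp (perp ?U) = ?U" by (rule perp_perp) simp
  then have "v \<notin> perp (perp ?U)" using ni by simp
  then obtain y where y: "y \<in> perp ?U" "bil v y \<noteq> 0" by (auto simp: perp_bil)
  have yU: "bil y x = 0" if "x \<in> insert (v - w) R" for x
    using y(1) vec.span_base[OF that] by (simp add: perp_bil)
  have yR: "bil x y = 0" if "x \<in> R" for x using yU that by (simp add: bil_commute)
  have yvw: "bil w y = bil v y" using yU[of "v - w"] by (simp add: bil_simps bil_commute)
  \<comment> \<open>Adding a multiple of \<open>v\<close> makes \<open>y\<close> isotropic and keeps its products with \<open>v\<close> and \<open>w\<close>.\<close>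
  define z where "z = y - (bil y y / (2 * bil v y)) *s v"
  have z: "bil z z = 0" "bil v z = bil v y" "bil z w = bil v y" "\<And>x. x \<in> R \<Longrightarrow> bil x z = 0"
    using v y(2) yvw True yR Rv by (simp_all add: z_def bil_simps bil_commute[of y v] bil_commute[of y w])
  obtain A where A: "preserves_bil A" "A *v v = z" "\<And>x. bil x v = bil x z \<Longrightarrow> A *v x = x"
    using y(2) z(2) by (metis reflection_exists[OF v z(1)])
  obtain B where B: "preserves_bil B" "B *v z = w" "\<And>x. bil x z = bil x w \<Longrightarrow> B *v x = x"
    using y(2) z(3) by (metis reflection_exists[OF z(1) w])
  show ?thesis
  proof (rule that[of "B ** A"])
    show "preserves_bil (B ** A)" using preserves_bil_mult A(1) B(1) by blast
    show "(B ** A) *v v = w" by (simp add: A B flip: matrix_vector_mul_assoc)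
    show "(B ** A) *v x = x" if "x \<in> R" for x
      using A(3)[of x] B(3)[of x] Rv[OF that] Rw[OF that] z(4)[OF that]
      by (simp flip: matrix_vector_mul_assoc)
  qed
qed

text \<open>
  Moving a vector of \<open>T\<close> outside \<open>T'\<close> to a vector of \<open>T'\<close> outside \<open>T\<close>, while fixing the intersection, enlarges the
  intersection.
\<close>

lemma witt_extension:
  fixes T T' :: "(complex^('n::{finite,linorder})) set"
  assumes "vec.subspace T" "vec.subspace T'" "T \<subseteq> perp T" "T' \<subseteq> perp T'" "vec.dim T = vec.dim T'"
  shows "\<exists>A. preserves_bil A \<and> (*v) A ` T = T' \<and> (\<forall>x\<in>T \<inter> T'. A *v x = x)"
  using assms
proof (induction "vec.dim T - vec.dim (T \<inter> T')" arbitrary: T rule: less_induct)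
  case less
  show ?case
  proof (cases "T \<subseteq> T'")
    case True
    then have "T = T'" using less.prems by (intro vec.subspace_dim_equal) auto
    then show ?thesis using preserves_bil_one by (intro exI[of _ "mat 1"]) simp
  next
    case False
    let ?R = "T \<inter> T'"
    have R: "vec.subspace ?R" using less.prems by (simp add: vec.subspace_inter)
    have "\<not> T' \<subseteq> T"
    proof
      assume "T' \<subseteq> T"
      then have "T' = T" using less.prems by (intro vec.subspace_dim_equal) auto
      then show False using False by simp
    qed
    then obtain w where w: "w \<in> T'" "w \<notin> T" by blast
    obtain v where v: "v \<in> T" "v \<notin> T'" using False by blast
    have T0: "bil x y = 0" if "x \<in> T" "y \<in> T" for x y using that less.prems(3) by (auto simp: perp_bil)
    have T'0: "bil x y = 0" if "x \<in> T'" "y \<in> T'" for x y using that less.prems(4) by (auto simp: perp_bil)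
    have ni: "v \<notin> vec.span (insert (v - w) ?R)"
    proof
      assume "v \<in> vec.span (insert (v - w) ?R)"
      then obtain k where "v - k *s (v - w) \<in> vec.span ?R"
        unfolding vec.span_breakdown_eq by (rule exE)
      then have k: "v - k *s (v - w) \<in> ?R"
        unfolding vec.span_eq_iff[THEN iffD2, OF R] .
      show False
      proof (cases "k = 0")
        case True
        then show False using k v by simp
      next
        case False
        have T: "vec.subspace T" by (rule less.prems(1))
        have kw: "k *s w = (v - k *s (v - w)) - (v - k *s v)" by (simp add: vec_eq_iff algebra_simps)
        have "k *s w \<in> T"
          unfolding kw
        proof (rule vec.subspace_diff[OF T])
          show "v - k *s (v - w) \<in> T" using k by blast
          show "v - k *s v \<in> T" using v(1) T by (intro vec.subspace_diff vec.subspace_scale)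
        qed
        then have "inverse k *s (k *s w) \<in> T" by (rule vec.subspace_scale[OF T])
        moreover have "inverse k *s (k *s w) = w" using False by simp
        ultimately show False using w by simp
      qed
    qed
    obtain A where A: "preserves_bil A" "A *v v = w" "\<And>x. x \<in> ?R \<Longrightarrow> A *v x = x"
      by (rule isometry_moving_isotropic_vector[OF T0[OF v(1) v(1)] T'0[OF w(1) w(1)] R _ _ ni])
        (use T0 T'0 v(1) w(1) that in auto)
    let ?T1 = "(*v) A ` T"
    have inv: "invertible A" by (rule preserves_bil_invertible[OF A(1)])
    have T1: "vec.subspace ?T1" using less.prems(1) by (simp add: vec.subspace_image)
    have "?R \<subseteq> ?T1 \<inter> T'"
    proof
      fix x assume "x \<in> ?R"
      then show "x \<in> ?T1 \<inter> T'" using A(3)[of x] by (metis IntD1 IntD2 IntI image_eqI)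
    qed
    moreover have "w \<in> ?T1 \<inter> T'" "w \<notin> ?R" using A(2) v w by auto
    ultimately have "?R \<subset> ?T1 \<inter> T'" by blast
    moreover have "vec.subspace (?T1 \<inter> T')" using T1 less.prems(2) by (simp add: vec.subspace_inter)
    ultimately have lt: "vec.dim ?R < vec.dim (?T1 \<inter> T')"
      by (intro vec.dim_psubset) (simp only: R vec.span_eq_iff[THEN iffD2])
    have d1: "vec.dim ?T1 = vec.dim T" by (rule dim_image_invertible[OF inv])
    have "vec.dim (?T1 \<inter> T') \<le> vec.dim ?T1" by (rule vec.dim_subset) blast
    then have lt2: "vec.dim ?T1 - vec.dim (?T1 \<inter> T') < vec.dim T - vec.dim ?R" using lt d1 by simp
    have iso1: "?T1 \<subseteq> perp ?T1" unfolding perp_image[OF A(1)] using less.prems(3) by blast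
    have "\<exists>B. preserves_bil B \<and> (*v) B ` ?T1 = T' \<and> (\<forall>x\<in>?T1 \<inter> T'. B *v x = x)"
      by (rule less.hyps[OF lt2 T1 less.prems(2) iso1 less.prems(4)]) (simp add: d1 less.prems(5))
    then obtain B where B: "preserves_bil B" "(*v) B ` ?T1 = T'" "\<forall>x\<in>?T1 \<inter> T'. B *v x = x"
      by (elim exE conjE) (rule that)
    have "(*v) (B ** A) ` T = T'" using B(2) by (simp add: image_image matrix_vector_mul_assoc)
    moreover have "(B ** A) *v x = x" if "x \<in> ?R" for x
      using A(3)[OF that] B(3) \<open>?R \<subseteq> ?T1 \<inter> T'\<close> that by (simp add: subset_iff flip: matrix_vector_mul_assoc)
    ultimately show ?thesis using preserves_bil_mult[OF B(1) A(1)] by blast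
  qed
qed

text \<open>
  The members are matched in order of dimension. The isometry for dimension \<open>k\<close> fixes the intersection of the
  two members of dimension \<open>k\<close>, which contains everything matched before.
\<close>

lemma witt_chain:
  fixes T T' :: "'i \<Rightarrow> (complex^('n::{finite,linorder})) set"
  assumes S: "\<And>i. i \<in> I \<Longrightarrow> vec.subspace (T i)" "\<And>i. i \<in> I \<Longrightarrow> vec.subspace (T' i)"
    and iso: "\<And>i. i \<in> I \<Longrightarrow> T i \<subseteq> perp (T i)" "\<And>i. i \<in> I \<Longrightarrow> T' i \<subseteq> perp (T' i)"
    and dim: "\<And>i. i \<in> I \<Longrightarrow> vec.dim (T i) = vec.dim (T' i)"
    and chain: "\<And>i j. i \<in> I \<Longrightarrow> j \<in> I \<Longrightarrow> T i \<subseteq> T j \<or> T j \<subseteq> T i"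
      "\<And>i j. i \<in> I \<Longrightarrow> j \<in> I \<Longrightarrow> T' i \<subseteq> T' j \<or> T' j \<subseteq> T' i"
  shows "\<exists>A. preserves_bil A \<and> (\<forall>i\<in>I. vec.dim (T i) < k \<longrightarrow> (*v) A ` T i = T' i)"
proof (induction k)
  case 0
  show ?case using preserves_bil_one by blast
next
  case (Suc k)
  then obtain A where A: "preserves_bil A" "\<And>i. i \<in> I \<Longrightarrow> vec.dim (T i) < k \<Longrightarrow> (*v) A ` T i = T' i"
    by blast
  show ?case
  proof (cases "\<exists>i\<in>I. vec.dim (T i) = k")
    case False
    then show ?thesis using A by (metis less_Suc_eq)
  next
    case True
    then obtain m where m: "m \<in> I" "vec.dim (T m) = k" by blast
    let ?T1 = "(*v) A ` T m"
    have inv: "invertible A" by (rule preserves_bil_invertible[OF A(1)])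
    have "?T1 \<subseteq> perp ?T1" unfolding perp_image[OF A(1)] using iso(1)[OF m(1)] by blast
    then have "\<exists>B. preserves_bil B \<and> (*v) B ` ?T1 = T' m \<and> (\<forall>x\<in>?T1 \<inter> T' m. B *v x = x)"
      using S m iso dim by (intro witt_extension) (simp_all add: vec.subspace_image dim_image_invertible[OF inv])
    then obtain B where B: "preserves_bil B" "(*v) B ` ?T1 = T' m" "\<forall>x\<in>?T1 \<inter> T' m. B *v x = x"
      by (elim exE conjE) (rule that)
    have "(*v) (B ** A) ` T i = T' i" if i: "i \<in> I" "vec.dim (T i) < Suc k" for i
    proof (cases "vec.dim (T i) = k")
      case True
      have "T i = T m"
        using chain(1)[OF i(1) m(1)] vec.subspace_dim_equal[OF S(1)[OF i(1)] S(1)[OF m(1)]]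
          vec.subspace_dim_equal[OF S(1)[OF m(1)] S(1)[OF i(1)]] True m(2) by auto
      moreover have "T' i = T' m"
        using chain(2)[OF i(1) m(1)] vec.subspace_dim_equal[OF S(2)[OF i(1)] S(2)[OF m(1)]]
          vec.subspace_dim_equal[OF S(2)[OF m(1)] S(2)[OF i(1)]] True m(2) dim[OF i(1)] dim[OF m(1)] by auto
      ultimately show ?thesis using B(2) by (simp add: image_image matrix_vector_mul_assoc)
    next
      case False
      then have lt: "vec.dim (T i) < vec.dim (T m)" using i(2) m(2) by simp
      have "T i \<subseteq> T m"
        using chain(1)[OF i(1) m(1)] vec.dim_subset[of "T m" "T i"] lt by auto
      moreover have "T' i \<subseteq> T' m"
        using chain(2)[OF i(1) m(1)] vec.dim_subset[of "T' m" "T' i"] lt dim[OF i(1)] dim[OF m(1)] by auto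
      moreover have Ai: "(*v) A ` T i = T' i" using A(2) i(1) lt m(2) by simp
      ultimately have "T' i \<subseteq> ?T1 \<inter> T' m" by blast
      then have "B *v x = x" if "x \<in> T' i" for x using B(3) that by blast
      then have "(*v) B ` T' i = T' i" by simp
      moreover have "(*v) (B ** A) ` T i = (*v) B ` (*v) A ` T i"
        by (simp add: image_image matrix_vector_mul_assoc)
      ultimately show ?thesis using Ai by simp
    qed
    then show ?thesis using preserves_bil_mult[OF B(1) A(1)] by blast
  qed
qed

section \<open>Isotropic flags\<close>

definition isotropic_flags :: "nat list \<Rightarrow> ('n::{finite,linorder}) flag set" where
  "isotropic_flags f = {V \<in> flags f. isotropic V}"

lemma isotropic_iff_set:
  fixes V :: "('n::finite) flag"
  shows "isotropic V \<longleftrightarrow> (\<forall>U\<in>set V. \<forall>W\<in>set V.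
     vec.dim (U \<inter> perp W) = min (vec.dim U) (CARD('n) - vec.dim W))"
  unfolding isotropic_def all_set_conv_all_nth by blast

lemma flag_member:
  assumes "V \<in> flags f" "U \<in> set V"
  obtains i where "i < length f" "U = V ! i" "vec.subspace U" "vec.dim U = partial_sum f (Suc i)"
proof -
  obtain i where "i < length V" "V ! i = U" using assms(2) by (auto simp: in_set_conv_nth)
  then show ?thesis using assms(1) that by (auto simp: flags_def)
qed

lemma flag_member_subspace: "V \<in> flags f \<Longrightarrow> U \<in> set V \<Longrightarrow> vec.subspace U"
  by (rule flag_member)

lemma nth_in_flag: "V \<in> flags f \<Longrightarrow> i < length f \<Longrightarrow> V ! i \<in> set V"
  by (simp add: flags_def)

lemma dim_nth_flag: "V \<in> flags f \<Longrightarrow> i < length f \<Longrightarrow> vec.dim (V ! i) = partial_sum f (Suc i)"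
  by (simp add: flags_def)

lemma flag_chain:
  assumes V: "V \<in> flags f" and U: "U \<in> set V" and W: "W \<in> set V"
  shows "U \<subseteq> W \<or> W \<subseteq> U"
proof -
  obtain i where i: "i < length f" "U = V ! i" using V U by (rule flag_member)
  obtain j where j: "j < length f" "W = V ! j" using V W by (rule flag_member)
  show ?thesis using V i j by (cases i j rule: linorder_cases) (auto simp: flags_def)
qed

lemma subspace_chain_eq:
  assumes "vec.subspace U" "vec.subspace W" "U \<subseteq> W \<or> W \<subseteq> U" "vec.dim U = vec.dim W"
  shows "U = W"
  using assms vec.subspace_dim_equal[of U W] vec.subspace_dim_equal[of W U] by auto

lemma isotropic_small:
  fixes V :: "('n::{finite,linorder}) flag"
  assumes V: "V \<in> flags f" "isotropic V" and U: "U \<in> set V" and W: "W \<in> set V"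
    and le: "vec.dim U + vec.dim W \<le> CARD('n)"
  shows "U \<subseteq> perp W"
proof -
  have sU: "vec.subspace U" using V(1) U by (rule flag_member_subspace)
  have "vec.dim (U \<inter> perp W) = vec.dim U"
    using V(2) U W le by (auto simp: isotropic_iff_set)
  then have "U \<inter> perp W = U"
    using vec.subspace_dim_equal[OF vec.subspace_inter[OF sU subspace_perp] sU] by simp
  then show ?thesis by blast
qed

lemma isotropic_large:
  fixes V :: "('n::{finite,linorder}) flag"
  assumes V: "V \<in> flags f" "isotropic V" and U: "U \<in> set V" and W: "W \<in> set V"
    and ge: "CARD('n) \<le> vec.dim U + vec.dim W"
  shows "perp W \<subseteq> U"
proof -
  have s: "vec.subspace U" "vec.subspace W" using V(1) U W by (blast intro: flag_member_subspace)+
  have "vec.dim (U \<inter> perp W) = vec.dim (perp W)"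
    using V(2) U W ge s by (simp add: isotropic_iff_set dim_perp)
  then have "U \<inter> perp W = perp W"
    using vec.subspace_dim_equal[OF vec.subspace_inter[OF s(1) subspace_perp] subspace_perp] by simp
  then show ?thesis by blast
qed

text \<open>
  For an isotropic flag this is a chain closed under orthogonal complements; its members include
  those of the corresponding flag in the measurable model.
\<close>

definition perp_closure :: "('n::finite) flag \<Rightarrow> (complex^('n::finite)) set set" where
  "perp_closure V = set V \<union> perp ` set V"

lemma perp_closure_subspace: "V \<in> flags f \<Longrightarrow> U \<in> perp_closure V \<Longrightarrow> vec.subspace U"
  using flag_member_subspace subspace_perp unfolding perp_closure_def by blast

lemma perp_in_perp_closure:
  fixes V :: "('n::{finite,linorder}) flag"
  assumes "V \<in> flags f" "U \<in> perp_closure V"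
  shows "perp U \<in> perp_closure V"
  using assms perp_perp[OF flag_member_subspace[OF assms(1)]] unfolding perp_closure_def by auto

lemma perp_closure_chain:
  fixes V :: "('n::{finite,linorder}) flag"
  assumes V: "V \<in> flags f" "isotropic V" and U: "U \<in> perp_closure V" and W: "W \<in> perp_closure V"
  shows "U \<subseteq> W \<or> W \<subseteq> U"
proof -
  have mixed: "X \<subseteq> perp Y \<or> perp Y \<subseteq> X" if "X \<in> set V" "Y \<in> set V" for X Y
    using isotropic_small[OF V that] isotropic_large[OF V that]
    by (cases "vec.dim X + vec.dim Y \<le> CARD('n)") auto
  have both: "perp X \<subseteq> perp Y \<or> perp Y \<subseteq> perp X" if "X \<in> set V" "Y \<in> set V" for X Y
    using flag_chain[OF V(1) that] perp_antimono by blast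
  have "U \<in> set V \<or> (\<exists>X\<in>set V. U = perp X)" "W \<in> set V \<or> (\<exists>Y\<in>set V. W = perp Y)"
    using U W unfolding perp_closure_def by blast+
  then consider "U \<in> set V" "W \<in> set V" | Y where "U \<in> set V" "Y \<in> set V" "W = perp Y"
    | X where "X \<in> set V" "U = perp X" "W \<in> set V"
    | X Y where "X \<in> set V" "Y \<in> set V" "U = perp X" "W = perp Y"
    by blast
  then show ?thesis
  proof cases
    case 1
    then show ?thesis by (rule flag_chain[OF V(1)])
  next
    case 2
    then show ?thesis using mixed[of U Y] by simp
  next
    case 3
    then show ?thesis using mixed[of W X] by auto
  next
    case 4
    then show ?thesis using both[of X Y] by simp
  qed
qed

lemma dim_inter_perp_closure:
  fixes V :: "('n::{finite,linorder}) flag"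
  assumes V: "V \<in> flags f" "isotropic V" and U: "U \<in> perp_closure V" and W: "W \<in> perp_closure V"
  shows "vec.dim (U \<inter> perp W) = min (vec.dim U) (CARD('n) - vec.dim W)"
proof -
  have "vec.dim (perp W) = CARD('n) - vec.dim W"
    using perp_closure_subspace[OF V(1) W] by (rule dim_perp)
  moreover consider "U \<subseteq> perp W" | "perp W \<subseteq> U"
    using perp_closure_chain[OF V U perp_in_perp_closure[OF V(1) W]] by blast
  then have "vec.dim (U \<inter> perp W) = min (vec.dim U) (vec.dim (perp W))"
    by cases (auto simp: Int_absorb1 Int_absorb2 min_def dest: vec.dim_subset)
  ultimately show ?thesis by simp
qed

lemma act_isotropic:
  fixes V :: "('n::{finite,linorder}) flag"
  assumes A: "preserves_bil A" and V: "isotropic V"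
  shows "isotropic (act A V)"
proof -
  have inv: "invertible A" by (rule preserves_bil_invertible[OF A])
  have "(*v) A ` U \<inter> perp ((*v) A ` W) = (*v) A ` (U \<inter> perp W)" for U W
    unfolding perp_image[OF A] using inj_matrix_vector_mult[OF inv] by (simp add: image_Int)
  then show ?thesis using V by (simp add: isotropic_iff_set act_def dim_image_invertible[OF inv])
qed

text \<open>
  A member or its complement is totally isotropic, according to its dimension. These totally isotropic spaces form
  a chain that determines the flag, and Witt's theorem moves one such chain to the other.
\<close>

lemma isotropic_flags_transitive:
  fixes V V' :: "('n::{finite,linorder}) flag"
  assumes V: "V \<in> flags f" "isotropic V" and V': "V' \<in> flags f" "isotropic V'"
  obtains A where "preserves_bil A" "act A V = V'"
proof -
  define T where "T X i = (if 2 * partial_sum f (Suc i) \<le> CARD('n) then X ! i else perp (X ! i))"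
    for X :: "'n flag" and i
  have *: "vec.subspace (T X i)" "T X i \<subseteq> perp (T X i)" "T X i \<in> perp_closure X"
    "vec.dim (T X i) = (if 2 * partial_sum f (Suc i) \<le> CARD('n) then partial_sum f (Suc i)
       else CARD('n) - partial_sum f (Suc i))"
    if X: "X \<in> flags f" "isotropic X" and i: "i < length f" for X i
  proof -
    have mem: "X ! i \<in> set X" using X(1) i by (rule nth_in_flag)
    have d: "vec.dim (X ! i) = partial_sum f (Suc i)" using X(1) i by (rule dim_nth_flag)
    have s: "vec.subspace (X ! i)" using X(1) mem by (rule flag_member_subspace)
    show "vec.subspace (T X i)" by (simp add: T_def s subspace_perp)
    show "T X i \<in> perp_closure X" using mem by (simp add: T_def perp_closure_def)
    show "vec.dim (T X i) = (if 2 * partial_sum f (Suc i) \<le> CARD('n) then partial_sum f (Suc i)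
       else CARD('n) - partial_sum f (Suc i))" by (simp add: T_def d dim_perp[OF s])
    show "T X i \<subseteq> perp (T X i)"
      using isotropic_small[OF X mem mem] isotropic_large[OF X mem mem] by (auto simp: T_def d perp_perp[OF s])
  qed
  have "\<exists>A. preserves_bil A \<and> (\<forall>i\<in>{..<length f}. vec.dim (T V i) < Suc CARD('n) \<longrightarrow> (*v) A ` T V i = T V' i)"
  proof (rule witt_chain)
    show "T V i \<subseteq> T V j \<or> T V j \<subseteq> T V i" if "i \<in> {..<length f}" "j \<in> {..<length f}" for i j
      using perp_closure_chain[OF V *(3)[OF V] *(3)[OF V]] that by blast
    show "T V' i \<subseteq> T V' j \<or> T V' j \<subseteq> T V' i" if "i \<in> {..<length f}" "j \<in> {..<length f}" for i j
      using perp_closure_chain[OF V' *(3)[OF V'] *(3)[OF V']] that by blast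
  qed (use *[OF V] *[OF V'] in simp_all)
  then obtain A where A: "preserves_bil A"
    and AT: "\<forall>i\<in>{..<length f}. vec.dim (T V i) < Suc CARD('n) \<longrightarrow> (*v) A ` T V i = T V' i"
    by (elim exE conjE)
  have "act A V = V'"
  proof (rule nth_equalityI)
    show "length (act A V) = length V'" using V V' by (simp add: flags_def)
    fix i assume "i < length (act A V)"
    then have i: "i < length f" "i < length V" using V by (simp_all add: flags_def)
    have AT: "(*v) A ` T V i = T V' i"
      using AT i(1) dim_le_CARD[of "T V i"] by (simp add: less_Suc_eq_le)
    have sub: "vec.subspace (V ! i)" "vec.subspace (V' ! i)"
      using V(1) V'(1) i(1) by (simp_all add: flags_def)
    have subA: "vec.subspace ((*v) A ` (V ! i))"
      using sub(1) by (simp add: vec.subspace_image)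
    have "(*v) A ` (V ! i) = V' ! i"
    proof (cases "2 * partial_sum f (Suc i) \<le> CARD('n)")
      case True
      then show ?thesis using AT by (simp add: T_def)
    next
      case False
      then have "perp ((*v) A ` (V ! i)) = perp (V' ! i)"
        using AT by (simp add: T_def perp_image[OF A])
      then have "perp (perp ((*v) A ` (V ! i))) = perp (perp (V' ! i))" by simp
      then show ?thesis unfolding perp_perp[OF subA] perp_perp[OF sub(2)] .
    qed
    then show "act A V ! i = V' ! i" using i(2) by (simp add: nth_act)
  qed
  with A that show ?thesis by blast
qed

text \<open>
  The base cycle is open in the space of all isotropic flags, on which the complex orthogonal group acts
  transitively by homeomorphisms.
\<close>

lemma complex_dim_base_cycle:
  fixes D :: "('n::{finite,linorder}) flag set"
  assumes f: "sum_list f = CARD('n)" and D: "open_orbit f D" "base_cycle D \<noteq> {}"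
  shows "complex_dim (flag_topology f) (base_cycle D) =
    complex_dim (flag_topology f) (isotropic_flags f :: 'n flag set)"
proof (rule complex_dim_open_in_homogeneous)
  let ?X = "flag_topology f :: 'n flag topology" and ?I = "isotropic_flags f :: 'n flag set"
  have op: "openin ?X D" using D(1) by (simp add: open_orbit_def)
  then have "D \<subseteq> flags f" using openin_subset topspace_flag_topology[OF f] by blast
  then have "base_cycle D = D \<inter> ?I" by (auto simp: base_cycle_def isotropic_flags_def)
  then show "openin (subtopology ?X ?I) (base_cycle D)"
    using op by (simp add: openin_subtopology_Int)
  show "base_cycle D \<noteq> {}" by (rule D(2))
  show "?I \<subseteq> topspace ?X" by (auto simp: topspace_flag_topology[OF f] isotropic_flags_def)
  show "\<exists>h. homeomorphic_map (subtopology ?X ?I) (subtopology ?X ?I) h \<and> h x = y"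
    if "x \<in> ?I" "y \<in> ?I" for x y
  proof -
    have xy: "x \<in> flags f" "isotropic x" "y \<in> flags f" "isotropic y"
      using that by (simp_all add: isotropic_flags_def)
    obtain A where A: "preserves_bil A" "act A x = y"
      by (rule isotropic_flags_transitive[OF xy]) (rule that)
    have inv: "invertible A" by (rule preserves_bil_invertible[OF A(1)])
    have sub: "act B ` ?I \<subseteq> ?I" if B: "preserves_bil B" for B :: "'n cmat"
      using act_isotropic[OF B] act_in_flags[OF preserves_bil_invertible[OF B]]
      by (auto simp: isotropic_flags_def)
    have "?I \<subseteq> act A ` ?I"
    proof
      fix V assume "V \<in> ?I"
      then have "act (transpose A) V \<in> ?I" using sub[OF preserves_bil_inverse(1)[OF A(1)]] by blast
      moreover have "act A (act (transpose A) V) = V"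
        using preserves_bil_inverse(2)[OF A(1)] by (simp flip: act_mult)
      ultimately show "V \<in> act A ` ?I" by (metis image_eqI)
    qed
    then have "act A ` ?I = ?I" using sub[OF A(1)] by blast
    moreover have "?I \<subseteq> topspace ?X" by (auto simp: topspace_flag_topology[OF f] isotropic_flags_def)
    ultimately have "homeomorphic_map (subtopology ?X ?I) (subtopology ?X ?I) (act A)"
      by (intro homeomorphic_map_subtopologies[OF homeomorphic_map_act[OF f inv]]) (simp add: Int_absorb1)
    then show ?thesis using A(2) by blast
  qed
qed

section \<open>Forgetting subspaces\<close>

lemma partial_sum_strict_mono:
  assumes pos: "\<forall>x\<in>set f. 0 < x" and ij: "i < j" "j \<le> length f"
  shows "partial_sum f i < partial_sum f j"
proof -
  have "partial_sum f i < partial_sum f (Suc i)"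
    using pos ij nth_mem[of i f] by (simp add: partial_sum_def take_Suc_conv_app_nth)
  also have "\<dots> \<le> partial_sum f j" using ij by (intro partial_sum_mono) simp
  finally show ?thesis .
qed

lemma partial_sums_iff: "r \<in> partial_sums f \<longleftrightarrow> (\<exists>i<length f. r = partial_sum f (Suc i))"
proof -
  have "{1..length f} = Suc ` {..<length f}" by (simp add: image_Suc_lessThan)
  then show ?thesis unfolding partial_sums_def by auto
qed

lemma partial_sum_Suc_inj:
  assumes "\<forall>x\<in>set f. 0 < x" "i < length f" "j < length f" "partial_sum f (Suc i) = partial_sum f (Suc j)"
  shows "i = j"
  using partial_sum_strict_mono[OF assms(1), of "Suc i" "Suc j"]
    partial_sum_strict_mono[OF assms(1), of "Suc j" "Suc i"] assms(2-4)
  by (cases i j rule: linorder_cases) auto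

text \<open>
  The map \<open>idx\<close> locates the \<open>j\<close>-th subspace of the coarser flag within the finer flag.
\<close>

lemma partial_sum_index:
  assumes d: "\<forall>x\<in>set d. 0 < x" and f: "\<forall>x\<in>set f. 0 < x" and sub: "partial_sums f \<subseteq> partial_sums d"
  obtains idx where "\<forall>j<length f. idx j < length d \<and> partial_sum d (Suc (idx j)) = partial_sum f (Suc j) \<and> (\<forall>i<j. idx i < idx j)"
proof -
  have "\<exists>i. i < length d \<and> partial_sum d (Suc i) = partial_sum f (Suc j)" if "j < length f" for j
  proof -
    have "partial_sum f (Suc j) \<in> partial_sums d" using sub that partial_sums_iff by blast
    then show ?thesis unfolding partial_sums_iff by auto
  qed
  then have "\<forall>j\<in>{..<length f}. \<exists>i. i < length d \<and> partial_sum d (Suc i) = partial_sum f (Suc j)"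
    by simp
  then obtain idx where idx: "\<forall>j\<in>{..<length f}. idx j < length d \<and> partial_sum d (Suc (idx j)) = partial_sum f (Suc j)"
    by (rule bchoice[THEN exE])
  have "idx i < idx j" if ij: "i < j" "j < length f" for i j
  proof (rule ccontr)
    assume "\<not> idx i < idx j"
    then have "partial_sum d (Suc (idx j)) \<le> partial_sum d (Suc (idx i))"
      by (intro partial_sum_mono) simp
    then have "partial_sum f (Suc j) \<le> partial_sum f (Suc i)" using idx ij by simp
    then show False using partial_sum_strict_mono[OF f, of "Suc i" "Suc j"] ij by simp
  qed
  then show ?thesis using idx by (intro that[of idx]) auto
qed

lemma forget_eq_map:
  assumes d: "\<forall>x\<in>set d. 0 < x" and f: "\<forall>x\<in>set f. 0 < x"
    and idx: "\<forall>j<length f. idx j < length d \<and> partial_sum d (Suc (idx j)) = partial_sum f (Suc j) \<and> (\<forall>i<j. idx i < idx j)"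
    and V: "V \<in> flags d"
  shows "forget f V = map (\<lambda>j. V ! idx j) [0..<length f]"
proof -
  have len: "length V = length d" using V by (simp add: flags_def)
  have "V = map ((!) V) [0..<length d]" using map_nth[of V] len by simp
  then have "forget f V = filter (\<lambda>W. vec.dim W \<in> partial_sums f) (map ((!) V) [0..<length d])"
    by (simp add: forget_def)
  also have "\<dots> = map ((!) V) (filter (\<lambda>i. vec.dim (V ! i) \<in> partial_sums f) [0..<length d])"
    by (simp add: filter_map o_def)
  also have "filter (\<lambda>i. vec.dim (V ! i) \<in> partial_sums f) [0..<length d] = map idx [0..<length f]"
  proof (rule sorted_distinct_set_unique)
    have less: "idx i < idx j" if "i < j" "j < length f" for i j
      using idx that by blast
    have mono: "idx i \<le> idx j" if "i \<le> j" "j < length f" for i j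
      using less[of i j] that by (cases "i = j") auto
    show "sorted (map idx [0..<length f])"
      by (auto simp: sorted_iff_nth_mono intro!: mono)
    show "distinct (map idx [0..<length f])"
      unfolding distinct_map
    proof (intro conjI inj_onI)
      fix i j assume "i \<in> set [0..<length f]" "j \<in> set [0..<length f]" "idx i = idx j"
      then show "i = j" using less[of i j] less[of j i] by (cases i j rule: linorder_cases) auto
    qed simp
    show "set (filter (\<lambda>i. vec.dim (V ! i) \<in> partial_sums f) [0..<length d]) = set (map idx [0..<length f])"
    proof (intro equalityI subsetI)
      fix i assume "i \<in> set (filter (\<lambda>i. vec.dim (V ! i) \<in> partial_sums f) [0..<length d])"
      then have i: "i < length d" "partial_sum d (Suc i) \<in> partial_sums f"
        using dim_nth_flag[OF V] by auto
      then obtain j where j: "j < length f" "partial_sum d (Suc i) = partial_sum f (Suc j)"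
        unfolding partial_sums_iff by blast
      then have "i = idx j" using partial_sum_Suc_inj[OF d i(1), of "idx j"] idx by simp
      then show "i \<in> set (map idx [0..<length f])" using j by simp
    next
      fix i assume "i \<in> set (map idx [0..<length f])"
      then obtain j where j: "j < length f" "i = idx j" by auto
      have "partial_sum f (Suc j) \<in> partial_sums f" using j(1) unfolding partial_sums_iff by blast
      then show "i \<in> set (filter (\<lambda>i. vec.dim (V ! i) \<in> partial_sums f) [0..<length d])"
        using idx j dim_nth_flag[OF V] by simp
    qed
    show "sorted (filter (\<lambda>i. vec.dim (V ! i) \<in> partial_sums f) [0..<length d])"
      by (rule sorted_wrt_filter) simp
  qed simp_all
  finally show ?thesis by (simp add: o_def)
qed

lemma forget_in_flags:
  assumes d: "\<forall>x\<in>set d. 0 < x" and f: "\<forall>x\<in>set f. 0 < x" and sub: "partial_sums f \<subseteq> partial_sums d"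
    and V: "V \<in> flags d"
  shows "forget f V \<in> flags f"
proof -
  obtain idx where idx: "\<forall>j<length f. idx j < length d \<and> partial_sum d (Suc (idx j)) = partial_sum f (Suc j) \<and> (\<forall>i<j. idx i < idx j)"
    by (rule partial_sum_index[OF d f sub]) (rule that)
  show ?thesis
    unfolding forget_eq_map[OF d f idx V] using V idx by (auto simp: flags_def)
qed

lemma forget_act:
  fixes A :: "complex^'n^'n"
  assumes "invertible A"
  shows "forget f (act A V) = act A (forget f V)"
  by (simp add: forget_def act_def filter_map o_def dim_image_invertible[OF assms])

lemma forget_isotropic: "isotropic V \<Longrightarrow> isotropic (forget f V)"
  by (simp add: isotropic_iff_set forget_def)

text \<open>
  By equivariance the composition with the orbit map is again an orbit map.
\<close>

lemma continuous_map_forget: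
  assumes d: "\<forall>x\<in>set d. 0 < x" "sum_list d = CARD('n)" and f: "\<forall>x\<in>set f. 0 < x" "sum_list f = CARD('n)"
    and sub: "partial_sums f \<subseteq> partial_sums d"
  shows "continuous_map (flag_topology d) (flag_topology f :: ('n::{finite,linorder}) flag topology) (forget f)"
proof -
  let ?V = "standard_flag d :: 'n flag"
  have V: "?V \<in> flags d" by (rule standard_flag_in_flags[OF d(2)])
  have "continuous_map (top_of_set GL) (flag_topology f) (\<lambda>A. act A (forget f ?V))"
    by (rule continuous_map_orbit_map[OF f(2) forget_in_flags[OF d(1) f(1) sub V]])
  then have "continuous_map (top_of_set GL) (flag_topology f) (forget f \<circ> (\<lambda>A. act A ?V))"
    by (rule continuous_map_eq) (simp add: forget_act)
  then show ?thesis by (rule continuous_compose_quotient_map[OF quotient_map_orbit_map[OF d(2) V]])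
qed

lemma closed_map_forget:
  assumes d: "\<forall>x\<in>set d. 0 < x" "sum_list d = CARD('n)" and f: "\<forall>x\<in>set f. 0 < x" "sum_list f = CARD('n)"
    and sub: "partial_sums f \<subseteq> partial_sums d"
  shows "closed_map (flag_topology d) (flag_topology f :: ('n::{finite,linorder}) flag topology) (forget f)"
  by (rule continuous_imp_closed_map[OF continuous_map_forget[OF assms] compact_space_flag_topology[OF d(2)]
        Hausdorff_space_flag_topology[OF f(2)]])

text \<open>
  Sublevel sets of \<open>\<beta>\<close> and of \<open>\<beta>'\<close> are nested by monotonicity, so they coincide when their cardinalities do.
\<close>

lemma forget_coord_flag:
  fixes \<beta> \<beta>' :: "'n::finite \<Rightarrow> nat"
  assumes d: "\<forall>x\<in>set d. 0 < x" and f: "\<forall>x\<in>set f. 0 < x" and sub: "partial_sums f \<subseteq> partial_sums d"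
    and \<beta>': "labelling d \<beta>'" and \<beta>: "labelling f \<beta>" and mono: "\<And>i j. \<beta>' i \<le> \<beta>' j \<Longrightarrow> \<beta> i \<le> \<beta> j"
  shows "forget f (coord_flag (length d) \<beta>') = coord_flag (length f) \<beta>"
proof -
  obtain idx where idx: "\<forall>j<length f. idx j < length d \<and> partial_sum d (Suc (idx j)) = partial_sum f (Suc j) \<and> (\<forall>i<j. idx i < idx j)"
    by (rule partial_sum_index[OF d f sub]) (rule that)
  have "{i. \<beta>' i \<le> idx j} = {i. \<beta> i \<le> j}" if j: "j < length f" for j
  proof -
    have card: "card {i. \<beta>' i \<le> idx j} = card {i. \<beta> i \<le> j}"
      using \<beta>' \<beta> j idx by (simp add: labelling_def)
    have "{i. \<beta>' i \<le> idx j} \<subseteq> {i. \<beta> i \<le> j} \<or> {i. \<beta> i \<le> j} \<subseteq> {i. \<beta>' i \<le> idx j}"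
    proof (rule disjCI)
      assume "\<not> {i. \<beta> i \<le> j} \<subseteq> {i. \<beta>' i \<le> idx j}"
      then obtain a where "\<beta> a \<le> j" "\<not> \<beta>' a \<le> idx j" by blast
      then have a: "\<beta> a \<le> j" "idx j < \<beta>' a" by simp_all
      show "{i. \<beta>' i \<le> idx j} \<subseteq> {i. \<beta> i \<le> j}"
      proof
        fix i assume "i \<in> {i. \<beta>' i \<le> idx j}"
        then have "\<beta>' i \<le> \<beta>' a" using a by simp
        then show "i \<in> {i. \<beta> i \<le> j}" using mono a(1) by fastforce
      qed
    qed
    then show ?thesis
    proof
      assume "{i. \<beta>' i \<le> idx j} \<subseteq> {i. \<beta> i \<le> j}"
      then show ?thesis using card by (intro card_subset_eq) simp_all
    next
      assume "{i. \<beta> i \<le> j} \<subseteq> {i. \<beta>' i \<le> idx j}"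
      then have "{i. \<beta> i \<le> j} = {i. \<beta>' i \<le> idx j}" using card by (intro card_subset_eq) simp_all
      then show ?thesis ..
    qed
  qed
  then show ?thesis
    unfolding forget_eq_map[OF d f idx coord_flag_in_flags[OF \<beta>']]
    by (intro nth_equalityI) (simp_all add: idx)
qed

lemma unipotent_act_in_cell:
  fixes \<gamma> :: "'n::{finite,linorder} \<Rightarrow> nat"
  assumes N: "N \<in> unipotent (inversions \<gamma>)" and \<beta>: "\<forall>i. \<beta> i < m"
  shows "act N (coord_flag m \<beta>) \<in> cell m \<beta>"
proof (rule upper_act_in_cell)
  show "invertible N" using N invertible_unipotent_drops unipotent_inversions_subset by blast
  show "N $ i $ j = 0" if "j < i" for i j by (rule unipotent_inversions_upper[OF N that])
qed (simp add: \<beta>)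

lemma forget_image_cell:
  fixes \<beta> \<beta>' :: "'n::{finite,linorder} \<Rightarrow> nat"
  assumes d: "\<forall>x\<in>set d. 0 < x" and f: "\<forall>x\<in>set f. 0 < x" and sub: "partial_sums f \<subseteq> partial_sums d"
    and \<beta>': "labelling d \<beta>'" and \<beta>: "labelling f \<beta>" and mono: "\<And>i j. \<beta>' i \<le> \<beta>' j \<Longrightarrow> \<beta> i \<le> \<beta> j"
  shows "forget f ` cell (length d) \<beta>' = cell (length f) \<beta>"
proof (intro equalityI subsetI)
  have len: "\<forall>i. \<beta>' i < length d" "\<forall>i. \<beta> i < length f" using \<beta>' \<beta> by (simp_all add: labelling_def)
  have inv: "invertible N" if "N \<in> unipotent (inversions \<gamma>)" for N :: "'n cmat" and \<gamma>
    using that invertible_unipotent_drops unipotent_inversions_subset by blast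
  have fg: "forget f (act N (coord_flag (length d) \<beta>')) = act N (coord_flag (length f) \<beta>)"
    if "invertible N" for N :: "'n cmat"
    using forget_coord_flag[OF d f sub \<beta>' \<beta>] mono forget_act[OF that] by simp
  fix V
  {
    assume "V \<in> forget f ` cell (length d) \<beta>'"
    then obtain N where N: "N \<in> unipotent (inversions \<beta>')" "V = forget f (act N (coord_flag (length d) \<beta>'))"
      unfolding cell_def by blast
    then show "V \<in> cell (length f) \<beta>"
      using fg[OF inv[OF N(1)]] unipotent_act_in_cell[OF N(1) len(2)] by simp
  next
    assume "V \<in> cell (length f) \<beta>"
    then obtain N where N: "N \<in> unipotent (inversions \<beta>)" "V = act N (coord_flag (length f) \<beta>)"
      unfolding cell_def by blast
    then have "V = forget f (act N (coord_flag (length d) \<beta>'))" using fg[OF inv[OF N(1)]] by simp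
    then show "V \<in> forget f ` cell (length d) \<beta>'"
      using unipotent_act_in_cell[OF N(1) len(1)] by blast
  }
qed

text \<open>
  Continuity gives one inclusion, and the other holds because the image of a closed set is closed.
\<close>

lemma forget_image_closure_cell:
  fixes \<beta> \<beta>' :: "'n::{finite,linorder} \<Rightarrow> nat"
  assumes d: "\<forall>x\<in>set d. 0 < x" "sum_list d = CARD('n)" and f: "\<forall>x\<in>set f. 0 < x" "sum_list f = CARD('n)"
    and sub: "partial_sums f \<subseteq> partial_sums d"
    and \<beta>': "labelling d \<beta>'" and \<beta>: "labelling f \<beta>" and mono: "\<And>i j. \<beta>' i \<le> \<beta>' j \<Longrightarrow> \<beta> i \<le> \<beta> j"
  shows "forget f ` (flag_topology d closure_of cell (length d) \<beta>') = flag_topology f closure_of cell (length f) \<beta>"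
proof
  let ?X = "flag_topology d :: 'n flag topology" and ?Y = "flag_topology f :: 'n flag topology"
  have im: "forget f ` cell (length d) \<beta>' = cell (length f) \<beta>"
    by (rule forget_image_cell[OF d(1) f(1) sub \<beta>' \<beta> mono])
  show "forget f ` (?X closure_of cell (length d) \<beta>') \<subseteq> ?Y closure_of cell (length f) \<beta>"
    using continuous_map_image_closure_subset[OF continuous_map_forget[OF d f sub], of "cell (length d) \<beta>'"]
    unfolding im .
  have "cell (length d) \<beta>' \<subseteq> topspace ?X"
    using cell_in_flags[OF \<beta>'] by (auto simp: topspace_flag_topology[OF d(2)])
  then have "cell (length d) \<beta>' \<subseteq> ?X closure_of cell (length d) \<beta>'" by (rule closure_of_subset)
  then have "cell (length f) \<beta> \<subseteq> forget f ` (?X closure_of cell (length d) \<beta>')"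
    unfolding im[symmetric] by (rule image_mono)
  moreover have "closedin ?Y (forget f ` (?X closure_of cell (length d) \<beta>'))"
    using closed_map_forget[OF d f sub] closedin_closure_of unfolding closed_map_def by blast
  ultimately show "?Y closure_of cell (length f) \<beta> \<subseteq> forget f ` (?X closure_of cell (length d) \<beta>')"
    by (rule closure_of_minimal)
qed

section \<open>Isotropic flags of the measurable model\<close>

text \<open>
  For a symmetric dimension sequence isotropy is a set of orthogonality relations: the complement of a
  member is again a member, so the conditions on large dimensions follow from those on small ones.
\<close>

lemma isotropic_iff_small:
  fixes V :: "('n::{finite,linorder}) flag"
  assumes V: "V \<in> flags d" and sym: "\<And>r. r \<in> partial_sums d \<Longrightarrow> r < CARD('n) \<Longrightarrow> CARD('n) - r \<in> partial_sums d"
  shows "isotropic V \<longleftrightarrow> (\<forall>i<length d. \<forall>j<length d.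
    partial_sum d (Suc i) + partial_sum d (Suc j) \<le> CARD('n) \<longrightarrow> V ! i \<subseteq> perp (V ! j))"
proof
  assume "isotropic V"
  then show "\<forall>i<length d. \<forall>j<length d.
    partial_sum d (Suc i) + partial_sum d (Suc j) \<le> CARD('n) \<longrightarrow> V ! i \<subseteq> perp (V ! j)"
    using isotropic_small[OF V] nth_in_flag[OF V] dim_nth_flag[OF V] by simp
next
  assume small: "\<forall>i<length d. \<forall>j<length d.
    partial_sum d (Suc i) + partial_sum d (Suc j) \<le> CARD('n) \<longrightarrow> V ! i \<subseteq> perp (V ! j)"
  let ?r = "\<lambda>i. partial_sum d (Suc i)"
  have s: "vec.subspace (V ! i)" if "i < length d" for i using V that by (simp add: flags_def)
  have dim: "vec.dim (V ! i) = ?r i" if "i < length d" for i using V that by (rule dim_nth_flag)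
  have large: "perp (V ! j) \<subseteq> V ! i" if ij: "i < length d" "j < length d" "CARD('n) < ?r i + ?r j" for i j
  proof (cases "?r i < CARD('n)")
    case False
    have "V ! i = UNIV"
      using False dim[OF ij(1)] s[OF ij(1)] by (intro vec.subspace_dim_equal) (auto simp: card_cart_basis)
    then show ?thesis by simp
  next
    case True
    have "?r i \<in> partial_sums d" using ij(1) unfolding partial_sums_iff by blast
    then obtain k where k: "k < length d" "CARD('n) - ?r i = ?r k"
      using sym True unfolding partial_sums_iff by blast
    have ki: "V ! k = perp (V ! i)"
    proof (rule vec.subspace_dim_equal[OF s[OF k(1)] subspace_perp])
      show "V ! k \<subseteq> perp (V ! i)" using small k ij(1) True by simp
      show "vec.dim (perp (V ! i)) \<le> vec.dim (V ! k)"
        using k dim[OF k(1)] dim[OF ij(1)] dim_perp[OF s[OF ij(1)]] by simp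
    qed
    have "?r k < ?r j" using k(2) True ij(3) by simp
    then have "k \<le> j" using partial_sum_mono[of "Suc j" "Suc k" d] by (cases "k \<le> j") auto
    then have "V ! k \<subseteq> V ! j" using V ij(2) by (cases "k = j") (auto simp: flags_def)
    then have "perp (V ! j) \<subseteq> perp (perp (V ! i))" unfolding ki[symmetric] by (rule perp_antimono)
    then show ?thesis unfolding perp_perp[OF s[OF ij(1)]] .
  qed
  have "vec.dim (V ! i \<inter> perp (V ! j)) = min (vec.dim (V ! i)) (CARD('n) - vec.dim (V ! j))"
    if ij: "i < length d" "j < length d" for i j
  proof (cases "?r i + ?r j \<le> CARD('n)")
    case True
    then have "V ! i \<inter> perp (V ! j) = V ! i" using small ij by blast
    then show ?thesis using True ij by (simp add: dim)
  next
    case False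
    then have "perp (V ! j) \<subseteq> V ! i" using ij by (intro large) simp_all
    then have "V ! i \<inter> perp (V ! j) = perp (V ! j)" by blast
    then show ?thesis using False ij by (simp add: dim dim_perp[OF s])
  qed
  then show "isotropic V" using V by (simp add: isotropic_def flags_def)
qed

text \<open>
  The relations of \<open>isotropic_iff_small\<close> are polynomial equations in a matrix representing the flag.
\<close>

lemma closedin_isotropic_flags:
  assumes d: "sum_list d = CARD('n)"
    and sym: "\<And>r. r \<in> partial_sums d \<Longrightarrow> r < CARD('n) \<Longrightarrow> CARD('n) - r \<in> partial_sums d"
  shows "closedin (flag_topology d) (isotropic_flags d :: ('n::{finite,linorder}) flag set)"
proof -
  let ?V = "standard_flag d :: 'n flag" and ?I = "isotropic_flags d :: 'n flag set"
  let ?r = "\<lambda>i. partial_sum d (Suc i)"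
  have V: "?V \<in> flags d" by (rule standard_flag_in_flags[OF d])
  have len: "length ?V = length d" using V by (simp add: flags_def)
  let ?C = "{A :: 'n cmat. \<forall>i j. i < length d \<and> j < length d \<and> ?r i + ?r j \<le> CARD('n) \<longrightarrow>
      (\<forall>x y. x \<in> ?V ! i \<and> y \<in> ?V ! j \<longrightarrow> bil (A *v x) (A *v y) = 0)}"
  have "closed ?C"
    unfolding bil_def matrix_vector_mult_def vec_lambda_beta
    by (intro closed_Collect_all closed_Collect_imp open_Collect_const closed_Collect_eq continuous_intros)
  have mem: "act A ?V \<in> ?I \<longleftrightarrow> A \<in> ?C" if A: "invertible A" for A
    using act_in_flags[OF A V] isotropic_iff_small[OF act_in_flags[OF A V] sym] len
    by (auto simp: isotropic_flags_def nth_act subset_eq perp_bil)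
  have "{A \<in> topspace (top_of_set GL). act A ?V \<in> ?I} = GL \<inter> ?C" using mem by auto
  then have "closedin (top_of_set GL) {A \<in> topspace (top_of_set GL). act A ?V \<in> ?I}"
    using \<open>closed ?C\<close> by (simp add: closedin_closed_Int)
  moreover have "?I \<subseteq> topspace (flag_topology d)"
    by (auto simp: topspace_flag_topology[OF d] isotropic_flags_def)
  ultimately show ?thesis
    using quotient_map_orbit_map[OF d V] unfolding quotient_map_closedin by blast
qed

text \<open>
  The members of \<open>perp_closure V\<close> with dimensions among the partial sums of \<open>d\<close> form a flag.
\<close>

lemma isotropic_lift:
  fixes V :: "('n::{finite,linorder}) flag"
  assumes d: "\<forall>x\<in>set d. 0 < x" and f: "\<forall>x\<in>set f. 0 < x"
    and ps: "partial_sums d = (partial_sums f \<union> (\<lambda>r. CARD('n) - r) ` partial_sums f) - {0}"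
    and sub: "partial_sums f \<subseteq> partial_sums d"
    and V: "V \<in> flags f" "isotropic V"
  obtains W where "W \<in> flags d" "isotropic W" "forget f W = V"
proof -
  have "\<exists>U. U \<in> perp_closure V \<and> vec.dim U = partial_sum d (Suc k)" if k: "k < length d" for k
  proof -
    have "partial_sum d (Suc k) \<in> partial_sums d" using k unfolding partial_sums_iff by blast
    then consider "partial_sum d (Suc k) \<in> partial_sums f"
      | s where "s \<in> partial_sums f" "partial_sum d (Suc k) = CARD('n) - s" unfolding ps by blast
    then show ?thesis
    proof cases
      case 1
      then obtain i where i: "i < length f" "partial_sum d (Suc k) = partial_sum f (Suc i)"
        unfolding partial_sums_iff by blast
      then show ?thesis using nth_in_flag[OF V(1) i(1)] dim_nth_flag[OF V(1) i(1)]
        by (intro exI[of _ "V ! i"]) (simp add: perp_closure_def)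
    next
      case 2
      then obtain i where i: "i < length f" "s = partial_sum f (Suc i)"
        unfolding partial_sums_iff by blast
      have "vec.dim (perp (V ! i)) = CARD('n) - s"
        using dim_perp[OF flag_member_subspace[OF V(1) nth_in_flag[OF V(1) i(1)]]] dim_nth_flag[OF V(1) i(1)] i(2) by simp
      then show ?thesis using nth_in_flag[OF V(1) i(1)] 2(2)
        by (intro exI[of _ "perp (V ! i)"]) (simp add: perp_closure_def)
    qed
  qed
  then have "\<forall>k\<in>{..<length d}. \<exists>U. U \<in> perp_closure V \<and> vec.dim U = partial_sum d (Suc k)" by simp
  then obtain w where w: "\<forall>k\<in>{..<length d}. w k \<in> perp_closure V \<and> vec.dim (w k) = partial_sum d (Suc k)"
    by (rule bchoice[THEN exE])
  define W where "W = map w [0..<length d]"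
  have sw: "vec.subspace (w k)" if "k < length d" for k
    using w that by (intro perp_closure_subspace[OF V(1)]) simp
  have W: "W \<in> flags d"
    unfolding flags_def
  proof (intro CollectI conjI allI impI)
    fix i j assume ij: "i < j" "j < length d"
    have "w i \<subseteq> w j \<or> w j \<subseteq> w i"
      using w ij by (intro perp_closure_chain[OF V]) simp_all
    moreover have "w i = w j" if "w j \<subseteq> w i"
    proof -
      have "vec.dim (w i) \<le> vec.dim (w j)"
        using w ij partial_sum_mono[of "Suc i" "Suc j" d] by simp
      then show ?thesis using vec.subspace_dim_equal[OF sw sw that] ij by simp
    qed
    ultimately show "W ! i \<subseteq> W ! j" using ij by (auto simp: W_def)
  qed (use w sw in \<open>simp_all add: W_def\<close>)
  have isoW: "isotropic W"
    unfolding isotropic_iff_set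
  proof (intro ballI)
    fix X Y assume "X \<in> set W" "Y \<in> set W"
    then have "X \<in> perp_closure V" "Y \<in> perp_closure V" using w by (auto simp: W_def)
    then show "vec.dim (X \<inter> perp Y) = min (vec.dim X) (CARD('n) - vec.dim Y)"
      by (rule dim_inter_perp_closure[OF V])
  qed
  obtain idx where idx: "\<forall>j<length f. idx j < length d \<and> partial_sum d (Suc (idx j)) = partial_sum f (Suc j) \<and> (\<forall>i<j. idx i < idx j)"
    by (rule partial_sum_index[OF d f sub]) (rule that)
  have "forget f W = V"
    unfolding forget_eq_map[OF d f idx W]
  proof (rule nth_equalityI)
    show "length (map (\<lambda>j. W ! idx j) [0..<length f]) = length V" using V by (simp add: flags_def)
    fix j assume "j < length (map (\<lambda>j. W ! idx j) [0..<length f])"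
    then have j: "j < length f" by simp
    have "w (idx j) = V ! j"
    proof (rule subspace_chain_eq)
      have m: "V ! j \<in> perp_closure V" using nth_in_flag[OF V(1) j] by (simp add: perp_closure_def)
      show "vec.subspace (w (idx j))" using idx j by (intro sw) simp
      show "vec.subspace (V ! j)" by (rule perp_closure_subspace[OF V(1) m])
      show "w (idx j) \<subseteq> V ! j \<or> V ! j \<subseteq> w (idx j)"
        using w idx j m by (intro perp_closure_chain[OF V]) simp_all
      show "vec.dim (w (idx j)) = vec.dim (V ! j)"
        using w idx j dim_nth_flag[OF V(1) j] by simp
    qed
    then show "map (\<lambda>j. W ! idx j) [0..<length f] ! j = V ! j" using j idx by (simp add: W_def)
  qed
  with W isoW that show ?thesis by blast
qed

text \<open>
  A member whose dimension is not a partial sum of \<open>f\<close> is the complement of a member that is not forgotten.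
\<close>

lemma isotropic_lift_unique:
  fixes V W :: "('n::{finite,linorder}) flag"
  assumes d: "\<forall>x\<in>set d. 0 < x"
    and ps: "partial_sums d = (partial_sums f \<union> (\<lambda>r. CARD('n) - r) ` partial_sums f) - {0}"
    and sub: "partial_sums f \<subseteq> partial_sums d"
    and V: "V \<in> flags d" "isotropic V" and W: "W \<in> flags d" "isotropic W"
    and eq: "forget f V = forget f W"
  shows "V = W"
proof -
  have common: "V ! k = W ! k" if k: "k < length d" "partial_sum d (Suc k) \<in> partial_sums f" for k
  proof -
    have "V ! k \<in> set (forget f V)"
      using nth_in_flag[OF V(1) k(1)] dim_nth_flag[OF V(1) k(1)] k(2) by (simp add: forget_def)
    then have "V ! k \<in> set W" unfolding eq by (simp add: forget_def)
    then obtain l where l: "l < length d" "V ! k = W ! l" "vec.dim (V ! k) = partial_sum d (Suc l)"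
      by (rule flag_member[OF W(1)])
    then have "k = l" using dim_nth_flag[OF V(1) k(1)] by (intro partial_sum_Suc_inj[OF d k(1) l(1)]) simp
    then show ?thesis using l(2) by simp
  qed
  have dual: "X ! k = perp (X ! l)"
    if X: "X \<in> flags d" "isotropic X" and k: "k < length d" and l: "l < length d"
      and r: "partial_sum d (Suc k) = CARD('n) - partial_sum d (Suc l)" for X :: "'n flag" and k l
  proof (rule vec.subspace_dim_equal)
    show sk: "vec.subspace (X ! k)" by (rule flag_member_subspace[OF X(1) nth_in_flag[OF X(1) k]])
    have sl: "vec.subspace (X ! l)" by (rule flag_member_subspace[OF X(1) nth_in_flag[OF X(1) l]])
    have dk: "vec.dim (X ! k) = CARD('n) - vec.dim (X ! l)" using r dim_nth_flag[OF X(1)] k l by simp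
    show "X ! k \<subseteq> perp (X ! l)"
      using dk dim_le_CARD[of "X ! l"]
      by (intro isotropic_small[OF X nth_in_flag[OF X(1) k] nth_in_flag[OF X(1) l]]) simp
    show "vec.dim (perp (X ! l)) \<le> vec.dim (X ! k)" by (simp add: dk dim_perp[OF sl])
  qed (rule subspace_perp)
  show ?thesis
  proof (rule nth_equalityI)
    show "length V = length W" using V W by (simp add: flags_def)
    fix k assume "k < length V"
    then have k: "k < length d" using V by (simp add: flags_def)
    show "V ! k = W ! k"
    proof (cases "partial_sum d (Suc k) \<in> partial_sums f")
      case True
      then show ?thesis by (rule common[OF k])
    next
      case False
      have "partial_sum d (Suc k) \<in> partial_sums d" using k unfolding partial_sums_iff by blast
      then obtain s where s: "s \<in> partial_sums f" "partial_sum d (Suc k) = CARD('n) - s"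
        using False unfolding ps by blast
      then have "s \<in> partial_sums d" using sub by blast
      then obtain l where l: "l < length d" "s = partial_sum d (Suc l)"
        unfolding partial_sums_iff by blast
      have "V ! l = W ! l" using s(1) unfolding l(2) by (rule common[OF l(1)])
      then show ?thesis using dual[OF V k l(1)] dual[OF W k l(1)] s(2) l(2) by simp
    qed
  qed
qed

text \<open>
  Forgetting is a continuous bijection from a compact space to a Hausdorff space.
\<close>

lemma complex_dim_isotropic_flags:
  assumes d: "\<forall>x\<in>set d. 0 < x" "sum_list d = CARD('n)" and f: "\<forall>x\<in>set f. 0 < x" "sum_list f = CARD('n)"
    and ps: "partial_sums d = (partial_sums f \<union> (\<lambda>r. CARD('n) - r) ` partial_sums f) - {0}"
    and sub: "partial_sums f \<subseteq> partial_sums d"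
  shows "complex_dim (flag_topology d) (isotropic_flags d :: ('n::{finite,linorder}) flag set) =
    complex_dim (flag_topology f) (isotropic_flags f :: 'n flag set)"
proof (rule complex_dim_homeomorphic_space)
  let ?X = "flag_topology d :: 'n flag topology" and ?Y = "flag_topology f :: 'n flag topology"
  let ?I = "isotropic_flags d :: 'n flag set" and ?J = "isotropic_flags f :: 'n flag set"
  have IX: "topspace (subtopology ?X ?I) = ?I" "topspace (subtopology ?Y ?J) = ?J"
    by (auto simp: topspace_flag_topology[OF d(2)] topspace_flag_topology[OF f(2)] isotropic_flags_def)
  have le: "r \<le> CARD('n)" if "r \<in> partial_sums f" for r
    using that partial_sum_le[of f] f(2) by (auto simp: partial_sums_def)
  have sym: "CARD('n) - r \<in> partial_sums d" if r: "r \<in> partial_sums d" "r < CARD('n)" for r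
  proof -
    consider "r \<in> partial_sums f" | s where "s \<in> partial_sums f" "r = CARD('n) - s"
      using r(1) unfolding ps by blast
    then show ?thesis
    proof cases
      case 1
      then show ?thesis unfolding ps using r(2) by auto
    next
      case 2
      then have "CARD('n) - r = s" using le by simp
      then show ?thesis using 2(1) sub by auto
    qed
  qed
  have im: "forget f ` ?I = ?J"
  proof
    show "forget f ` ?I \<subseteq> ?J"
      using forget_in_flags[OF d(1) f(1) sub] forget_isotropic by (auto simp: isotropic_flags_def)
    show "?J \<subseteq> forget f ` ?I"
    proof
      fix V assume "V \<in> ?J"
      then have V: "V \<in> flags f" "isotropic V" by (simp_all add: isotropic_flags_def)
      obtain W where "W \<in> flags d" "isotropic W" "forget f W = V"
        by (rule isotropic_lift[OF d(1) f(1) ps sub V]) (rule that)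
      then show "V \<in> forget f ` ?I" by (auto simp: isotropic_flags_def)
    qed
  qed
  have "homeomorphic_map (subtopology ?X ?I) (subtopology ?Y ?J) (forget f)"
  proof (rule continuous_imp_homeomorphic_map)
    show "continuous_map (subtopology ?X ?I) (subtopology ?Y ?J) (forget f)"
      using continuous_map_from_subtopology[OF continuous_map_forget[OF d f sub]] im
      by (auto simp: continuous_map_in_subtopology)
    show "compact_space (subtopology ?X ?I)"
      by (intro compact_space_subtopology closedin_compact_space compact_space_flag_topology[OF d(2)]
          closedin_isotropic_flags[OF d(2) sym])
    show "Hausdorff_space (subtopology ?Y ?J)"
      using Hausdorff_space_flag_topology[OF f(2)] by (rule Hausdorff_space_subtopology)
    show "forget f ` topspace (subtopology ?X ?I) = topspace (subtopology ?Y ?J)" unfolding IX by (rule im)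
    show "inj_on (forget f) (topspace (subtopology ?X ?I))"
      unfolding IX using isotropic_lift_unique[OF d(1) ps sub] by (auto simp: inj_on_def isotropic_flags_def)
  qed
  then show "subtopology ?X ?I homeomorphic_space subtopology ?Y ?J"
    using homeomorphic_space by blast
qed

section \<open>Permutations in block form\<close>

text \<open>
  The least block containing \<open>x\<close>; for a permutation in block form it is the only one.
\<close>

definition block_label :: "'n list list \<Rightarrow> 'n \<Rightarrow> nat" where
  "block_label Bs x = (LEAST k. k < length Bs \<and> x \<in> set (Bs ! k))"

lemma distinct_concat_nth_disjoint:
  assumes dis: "distinct (concat Bs)" and kl: "k < l" "l < length Bs" and x: "x \<in> set (Bs ! k)"
  shows "x \<notin> set (Bs ! l)"
proof
  assume xl: "x \<in> set (Bs ! l)"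
  have "concat Bs = concat (take l Bs) @ Bs ! l @ concat (drop (Suc l) Bs)"
    using id_take_nth_drop[OF kl(2)] by (metis concat.simps(2) concat_append)
  then have "set (concat (take l Bs)) \<inter> set (Bs ! l) = {}" using dis by auto
  moreover have "Bs ! k \<in> set (take l Bs)"
    using kl by (auto simp: in_set_conv_nth intro!: exI[of _ k])
  ultimately show False using x xl by auto
qed

lemma in_concat_nth:
  assumes "x \<in> set (concat Bs)"
  obtains k where "k < length Bs" "x \<in> set (Bs ! k)"
proof -
  obtain B where B: "B \<in> set Bs" "x \<in> set B" using assms by auto
  then obtain k where "k < length Bs" "Bs ! k = B" unfolding in_set_conv_nth by blast
  then show ?thesis using B(2) that by blast
qed

lemma block_label_eq_iff:
  assumes dis: "distinct (concat Bs)" and all: "set (concat Bs) = UNIV"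
  shows "block_label Bs x = k \<longleftrightarrow> k < length Bs \<and> x \<in> set (Bs ! k)"
proof -
  let ?P = "\<lambda>k. k < length Bs \<and> x \<in> set (Bs ! k)"
  have "x \<in> set (concat Bs)" using all by simp
  then obtain l where "l < length Bs" "x \<in> set (Bs ! l)" by (rule in_concat_nth)
  then have "?P l" by simp
  then have label: "?P (block_label Bs x)" unfolding block_label_def by (rule LeastI)
  have "block_label Bs x = k" if k: "?P k"
    using distinct_concat_nth_disjoint[OF dis, of k "block_label Bs x" x]
      distinct_concat_nth_disjoint[OF dis, of "block_label Bs x" k x] k label
    by (cases k "block_label Bs x" rule: linorder_cases) auto
  then show ?thesis using label by blast
qed

lemma take_partial_sum_concat:
  "take (partial_sum (map length Bs) k) (concat Bs) = concat (take k Bs)"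
proof -
  have "concat Bs = concat (take k Bs) @ concat (drop k Bs)"
    by (metis append_take_drop_id concat_append)
  moreover have "partial_sum (map length Bs) k = length (concat (take k Bs))"
    by (simp add: partial_sum_def length_concat take_map)
  ultimately show ?thesis by simp
qed

lemma block_label_le:
  assumes dis: "distinct (concat Bs)" and all: "set (concat Bs) = UNIV" and k: "k < length Bs"
  shows "{x. block_label Bs x \<le> k} = set (concat (take (Suc k) Bs))"
proof (intro equalityI subsetI)
  fix x assume "x \<in> {x. block_label Bs x \<le> k}"
  then have "block_label Bs x \<le> k" by simp
  moreover have "x \<in> set (Bs ! block_label Bs x)" using block_label_eq_iff[OF dis all] by blast
  moreover have "Bs ! block_label Bs x \<in> set (take (Suc k) Bs)" if "block_label Bs x \<le> k"
    using that k by (auto simp: in_set_conv_nth intro!: exI[of _ "block_label Bs x"])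
  ultimately show "x \<in> set (concat (take (Suc k) Bs))" by auto
next
  fix x assume "x \<in> set (concat (take (Suc k) Bs))"
  then obtain B where B: "B \<in> set (take (Suc k) Bs)" "x \<in> set B" by auto
  then obtain l where l: "l < length (take (Suc k) Bs)" "take (Suc k) Bs ! l = B"
    by (auto simp: in_set_conv_nth)
  then have "block_label Bs x = l" using B block_label_eq_iff[OF dis all] by auto
  then show "x \<in> {x. block_label Bs x \<le> k}" using l by auto
qed

lemma labelling_block_label:
  fixes Bs :: "'n::finite list list"
  assumes len: "map length Bs = f" and dis: "distinct (concat Bs)" and all: "set (concat Bs) = UNIV"
  shows "labelling f (block_label Bs)"
  unfolding labelling_def
proof (intro conjI allI impI)
  have lf: "length f = length Bs" using len by auto
  show "block_label Bs x < length f" for x using block_label_eq_iff[OF dis all] lf by metis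
  fix k assume k: "k < length f"
  have "distinct (concat (take (Suc k) Bs))"
    using dis distinct_take[of "concat Bs"] by (metis take_partial_sum_concat)
  then have "card {x. block_label Bs x \<le> k} = length (concat (take (Suc k) Bs))"
    using block_label_le[OF dis all] k lf by (simp add: distinct_card del: set_concat)
  then show "card {x. block_label Bs x \<le> k} = partial_sum f (Suc k)"
    by (simp add: len[symmetric] partial_sum_def length_concat take_map)
qed

lemma coordinate_flag_concat:
  fixes Bs :: "'n::finite list list"
  assumes len: "map length Bs = f" and dis: "distinct (concat Bs)" and all: "set (concat Bs) = UNIV"
  shows "coordinate_flag f (concat Bs) = coord_flag (length f) (block_label Bs)"
proof (rule coordinate_flag_eq_coord_flag)
  fix k assume "k < length f"
  then have "k < length Bs" using len by auto
  then show "set (take (partial_sum f (Suc k)) (concat Bs)) = {i. block_label Bs i \<le> k}"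
    unfolding len[symmetric] take_partial_sum_concat by (simp only: block_label_le[OF dis all])
qed

lemma schubert_variety_concat:
  fixes Bs :: "('n::{finite,linorder}) list list"
  assumes len: "map length Bs = f" and dis: "distinct (concat Bs)" and all: "set (concat Bs) = UNIV"
  shows "schubert_variety f (concat Bs) = flag_topology f closure_of cell (length f) (block_label Bs)"
  using labelling_block_label[OF assms] orbit_borel_subgroup[of "block_label Bs" "length f"]
  by (simp add: schubert_variety_def coordinate_flag_concat[OF assms] labelling_def)

section \<open>Merging groups of blocks\<close>

lemma partial_sum_Suc: "j < length t \<Longrightarrow> partial_sum t (Suc j) = partial_sum t j + t ! j"
  by (simp add: partial_sum_def take_Suc_conv_app_nth)

lemma length_block_group:
  assumes "sum_list t = length xs" "j < length t"
  shows "length (block_group t xs j) = t ! j"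
proof -
  have "partial_sum t j + t ! j \<le> length xs"
    using partial_sum_Suc[OF assms(2)] partial_sum_le[of t "Suc j"] assms(1) by simp
  then show ?thesis by (simp add: block_group_def)
qed

lemma nth_block_group:
  assumes "sum_list t = length xs" "j < length t" "a < t ! j"
  shows "block_group t xs j ! a = xs ! (partial_sum t j + a)" "partial_sum t j + a < length xs"
proof -
  have "partial_sum t j + t ! j \<le> length xs"
    using partial_sum_Suc[OF assms(2)] partial_sum_le[of t "Suc j"] assms(1) by simp
  then show "block_group t xs j ! a = xs ! (partial_sum t j + a)" "partial_sum t j + a < length xs"
    using assms(3) by (simp_all add: block_group_def)
qed

lemma length_merge_groups [simp]: "length (merge_groups t Bs) = length t"
  by (simp add: merge_groups_def)

lemma nth_merge_groups: "j < length t \<Longrightarrow> merge_groups t Bs ! j = sort (concat (block_group t Bs j))"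
  by (simp add: merge_groups_def)

lemma in_merge_groups_iff:
  assumes t: "sum_list t = length Bs" and j: "j < length t"
  shows "x \<in> set (merge_groups t Bs ! j) \<longleftrightarrow>
    (\<exists>k. partial_sum t j \<le> k \<and> k < partial_sum t (Suc j) \<and> x \<in> set (Bs ! k))"
proof
  assume "x \<in> set (merge_groups t Bs ! j)"
  then obtain B where "B \<in> set (block_group t Bs j)" "x \<in> set B" by (auto simp: nth_merge_groups[OF j])
  then obtain a where "a < t ! j" "x \<in> set (block_group t Bs j ! a)"
    using length_block_group[OF t j] by (auto simp: in_set_conv_nth)
  then show "\<exists>k. partial_sum t j \<le> k \<and> k < partial_sum t (Suc j) \<and> x \<in> set (Bs ! k)"
    using nth_block_group[OF t j] partial_sum_Suc[OF j] by (intro exI[of _ "partial_sum t j + a"]) simp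
next
  assume "\<exists>k. partial_sum t j \<le> k \<and> k < partial_sum t (Suc j) \<and> x \<in> set (Bs ! k)"
  then obtain k where k: "partial_sum t j \<le> k" "k < partial_sum t (Suc j)" "x \<in> set (Bs ! k)" by blast
  let ?a = "k - partial_sum t j"
  have a: "?a < t ! j" using k partial_sum_Suc[OF j] by simp
  then have "block_group t Bs j ! ?a = Bs ! k" using nth_block_group(1)[OF t j a] k(1) by simp
  moreover have "block_group t Bs j ! ?a \<in> set (block_group t Bs j)"
    using a length_block_group[OF t j] by (intro nth_mem) simp
  ultimately show "x \<in> set (merge_groups t Bs ! j)"
    using k(3) by (auto simp: nth_merge_groups[OF j])
qed

lemma map_length_merge_groups:
  assumes "length t = length f" "\<forall>j<length f. f ! j = sum_list (block_group t (map length Bs) j)"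
  shows "map length (merge_groups t Bs) = f"
proof (rule nth_equalityI)
  fix j assume "j < length (map length (merge_groups t Bs))"
  then have j: "j < length t" by simp
  have "block_group t (map length Bs) j = map length (block_group t Bs j)"
    by (simp add: block_group_def take_map drop_map)
  then show "map length (merge_groups t Bs) ! j = f ! j"
    using j assms by (simp add: nth_merge_groups length_concat)
qed (simp add: assms(1))

lemma group_index_exists:
  assumes "k < sum_list t"
  obtains j where "j < length t" "partial_sum t j \<le> k" "k < partial_sum t (Suc j)"
proof -
  have "k < partial_sum t (length t)" using assms by (simp add: partial_sum_full)
  then obtain j where j: "k < partial_sum t j" and least: "\<And>i. i < j \<Longrightarrow> \<not> k < partial_sum t i"
    using exists_least_iff[of "\<lambda>j. k < partial_sum t j"] by blast
  have "j \<noteq> 0" using j by (intro notI) (simp add: partial_sum_def)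
  then obtain i where i: "j = Suc i" using not0_implies_Suc by blast
  have "partial_sum t i \<le> k" using least[of i] i by simp
  moreover have "i < length t"
  proof (rule ccontr)
    assume "\<not> i < length t"
    then have "partial_sum t i = partial_sum t j" by (simp add: partial_sum_full i)
    then show False using j \<open>partial_sum t i \<le> k\<close> by simp
  qed
  ultimately show ?thesis using that j i by blast
qed

text \<open>
  The merged list contains every element and has the right length, so it has no repetitions.
\<close>

lemma merge_groups_permutation:
  fixes Bs :: "('n::{finite,linorder}) list list"
  assumes t: "sum_list t = length Bs" and len: "map length (merge_groups t Bs) = f" "sum_list f = CARD('n)"
    and all: "set (concat Bs) = UNIV"
  shows "set (concat (merge_groups t Bs)) = UNIV" "distinct (concat (merge_groups t Bs))"
proof -
  have "x \<in> set (concat (merge_groups t Bs))" for x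
  proof -
    have "x \<in> set (concat Bs)" using all by simp
    then obtain k where k: "k < length Bs" "x \<in> set (Bs ! k)" by (rule in_concat_nth)
    have "k < sum_list t" using k(1) t by simp
    then obtain j where j: "j < length t" "partial_sum t j \<le> k" "k < partial_sum t (Suc j)"
      by (rule group_index_exists)
    have "x \<in> set (merge_groups t Bs ! j)"
      unfolding in_merge_groups_iff[OF t j(1)] using j(2,3) k(2) by blast
    moreover have "merge_groups t Bs ! j \<in> set (merge_groups t Bs)" using j(1) by simp
    ultimately show ?thesis by auto
  qed
  then show all': "set (concat (merge_groups t Bs)) = UNIV" by blast
  have "length (concat (merge_groups t Bs)) = CARD('n)"
    using len by (simp add: length_concat)
  then show "distinct (concat (merge_groups t Bs))"
    using all' by (intro card_distinct) (simp del: set_concat)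
qed

text \<open>
  The merged label is the index of the group that contains the original label.
\<close>

lemma block_label_merge_groups:
  fixes Bs :: "('n::{finite,linorder}) list list"
  assumes t: "sum_list t = length Bs"
    and dis: "distinct (concat Bs)" and all: "set (concat Bs) = UNIV"
    and dis': "distinct (concat (merge_groups t Bs))" and all': "set (concat (merge_groups t Bs)) = UNIV"
  shows "block_label (merge_groups t Bs) x = j \<longleftrightarrow>
    j < length t \<and> partial_sum t j \<le> block_label Bs x \<and> block_label Bs x < partial_sum t (Suc j)"
proof -
  have "(\<exists>k. partial_sum t j \<le> k \<and> k < partial_sum t (Suc j) \<and> x \<in> set (Bs ! k)) \<longleftrightarrow>
      partial_sum t j \<le> block_label Bs x \<and> block_label Bs x < partial_sum t (Suc j)"
  proof
    assume "\<exists>k. partial_sum t j \<le> k \<and> k < partial_sum t (Suc j) \<and> x \<in> set (Bs ! k)"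
    then obtain k where k: "partial_sum t j \<le> k" "k < partial_sum t (Suc j)" "x \<in> set (Bs ! k)" by blast
    then have "k < length Bs" using partial_sum_le[of t "Suc j"] t by simp
    then have "block_label Bs x = k" using block_label_eq_iff[OF dis all] k(3) by blast
    then show "partial_sum t j \<le> block_label Bs x \<and> block_label Bs x < partial_sum t (Suc j)"
      using k by simp
  next
    assume "partial_sum t j \<le> block_label Bs x \<and> block_label Bs x < partial_sum t (Suc j)"
    moreover have "x \<in> set (Bs ! block_label Bs x)" using block_label_eq_iff[OF dis all] by blast
    ultimately show "\<exists>k. partial_sum t j \<le> k \<and> k < partial_sum t (Suc j) \<and> x \<in> set (Bs ! k)" by blast
  qed
  then show ?thesis
    unfolding block_label_eq_iff[OF dis' all'] using in_merge_groups_iff[OF t, of j x] by auto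
qed

lemma block_label_merge_groups_mono:
  fixes Bs :: "('n::{finite,linorder}) list list"
  assumes t: "sum_list t = length Bs"
    and dis: "distinct (concat Bs)" and all: "set (concat Bs) = UNIV"
    and dis': "distinct (concat (merge_groups t Bs))" and all': "set (concat (merge_groups t Bs)) = UNIV"
    and le: "block_label Bs x \<le> block_label Bs y"
  shows "block_label (merge_groups t Bs) x \<le> block_label (merge_groups t Bs) y"
proof (rule ccontr)
  let ?\<gamma> = "block_label (merge_groups t Bs)"
  assume "\<not> ?\<gamma> x \<le> ?\<gamma> y"
  then have "partial_sum t (Suc (?\<gamma> y)) \<le> partial_sum t (?\<gamma> x)" by (intro partial_sum_mono) simp
  moreover have "partial_sum t (?\<gamma> x) \<le> block_label Bs x"
    using block_label_merge_groups[OF assms(1-5), of x "?\<gamma> x"] by simp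
  moreover have "block_label Bs y < partial_sum t (Suc (?\<gamma> y))"
    using block_label_merge_groups[OF assms(1-5), of y "?\<gamma> y"] by simp
  ultimately show False using le by simp
qed

section \<open>Decreasing groups and the count of inversions\<close>

text \<open>
  Both differences, of drops and of inversions, count pairs with equal merged label, the second one a
  subset of the first. The number \<open>c\<close> is the common dimension of the base cycles.
\<close>

lemma card_inversions_drops_refine:
  fixes \<beta> \<beta>' :: "'n::{finite,linorder} \<Rightarrow> nat"
  assumes mono: "\<And>i j. \<beta>' i \<le> \<beta>' j \<Longrightarrow> \<beta> i \<le> \<beta> j"
    and eq: "card (inversions \<beta>') + c = card (drops \<beta>')"
  shows "card (inversions \<beta>) + c = card (drops \<beta>) \<longleftrightarrow> (\<forall>i j. \<beta>' j < \<beta>' i \<longrightarrow> \<beta> i = \<beta> j \<longrightarrow> i < j)"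
proof -
  define A where "A = {(i, j). \<beta>' j < \<beta>' i \<and> \<beta> i = \<beta> j}"
  define A' where "A' = {(i, j). i < j \<and> \<beta>' j < \<beta>' i \<and> \<beta> i = \<beta> j}"
  have less: "\<beta>' j < \<beta>' i" if "\<beta> j < \<beta> i" for i j using mono[of i j] that by (meson not_less)
  have same: "\<beta> i = \<beta> j" if "\<beta>' j < \<beta>' i" "\<not> \<beta> j < \<beta> i" for i j using mono[of j i] that by simp
  have "drops \<beta>' = drops \<beta> \<union> A" "drops \<beta> \<inter> A = {}"
    using less same by (auto simp: drops_def A_def)
  then have D: "card (drops \<beta>') = card (drops \<beta>) + card A"
    by (simp add: card_Un_disjoint)
  have "inversions \<beta>' = inversions \<beta> \<union> A'" "inversions \<beta> \<inter> A' = {}"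
    using less same by (auto simp: inversions_def A'_def)
  then have I: "card (inversions \<beta>') = card (inversions \<beta>) + card A'"
    by (simp add: card_Un_disjoint)
  have "A' \<subseteq> A" by (auto simp: A_def A'_def)
  then have "card A' = card A \<longleftrightarrow> A' = A" by (metis card_subset_eq finite)
  also have "\<dots> \<longleftrightarrow> (\<forall>i j. \<beta>' j < \<beta>' i \<longrightarrow> \<beta> i = \<beta> j \<longrightarrow> i < j)" by (auto simp: A_def A'_def)
  finally show ?thesis using D I eq by auto
qed

text \<open>
  The definition compares neighbouring blocks only. For nonempty sorted blocks the comparison propagates to any two blocks
  of the list.
\<close>

lemma strictly_decreasing_blocks_iff:
  assumes ne: "\<And>B. B \<in> set G \<Longrightarrow> B \<noteq> []" and srt: "\<And>B. B \<in> set G \<Longrightarrow> sorted B"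
  shows "strictly_decreasing_blocks G \<longleftrightarrow>
    (\<forall>a b x y. a < b \<longrightarrow> b < length G \<longrightarrow> x \<in> set (G ! b) \<longrightarrow> y \<in> set (G ! a) \<longrightarrow> x < y)"
proof
  assume dec: "strictly_decreasing_blocks G"
  have hd_le: "hd (G ! a) \<le> x" and le_last: "x \<le> last (G ! a)" if a: "a < length G" and x: "x \<in> set (G ! a)" for a x
  proof -
    have "G ! a \<in> set G" using a by simp
    then have s: "sorted (G ! a)" "G ! a \<noteq> []" using ne srt by blast+
    obtain i where i: "i < length (G ! a)" "G ! a ! i = x" using x unfolding in_set_conv_nth by blast
    show "hd (G ! a) \<le> x" using sorted_nth_mono[OF s(1), of 0 i] i s(2) by (simp add: hd_conv_nth)
    show "x \<le> last (G ! a)"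
      using sorted_nth_mono[OF s(1), of i "length (G ! a) - 1"] i s(2) by (simp add: last_conv_nth)
  qed
  have gap: "last (G ! b) < hd (G ! a)" if "a < b" "b < length G" for a b
    using that
  proof (induction b rule: less_induct)
    case (less b)
    obtain c where c: "b = Suc c" using less.prems(1) by (cases b) auto
    have step: "last (G ! b) < hd (G ! c)"
      using dec less.prems(2) unfolding c strictly_decreasing_blocks_def by blast
    show ?case
    proof (cases "a = c")
      case True
      then show ?thesis using step by simp
    next
      case False
      have "G ! c \<noteq> []" using ne[of "G ! c"] less.prems(2) c by simp
      then have "hd (G ! c) \<le> last (G ! c)"
        using less.prems(2) c by (intro le_last) simp_all
      moreover have "last (G ! c) < hd (G ! a)" using less.IH[of c] less.prems c False by simp
      ultimately show ?thesis using step by order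
    qed
  qed
  show "\<forall>a b x y. a < b \<longrightarrow> b < length G \<longrightarrow> x \<in> set (G ! b) \<longrightarrow> y \<in> set (G ! a) \<longrightarrow> x < y"
  proof (intro allI impI)
    fix a b x y assume ab: "a < b" "b < length G" and x: "x \<in> set (G ! b)" and y: "y \<in> set (G ! a)"
    have "x \<le> last (G ! b)" using ab x by (intro le_last)
    moreover have "hd (G ! a) \<le> y" using ab y by (intro hd_le) simp_all
    ultimately show "x < y" using gap[OF ab] by order
  qed
next
  assume all: "\<forall>a b x y. a < b \<longrightarrow> b < length G \<longrightarrow> x \<in> set (G ! b) \<longrightarrow> y \<in> set (G ! a) \<longrightarrow> x < y"
  show "strictly_decreasing_blocks G"
    unfolding strictly_decreasing_blocks_def
  proof (intro allI impI)
    fix i assume i: "Suc i < length G"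
    then have "G ! i \<noteq> []" "G ! Suc i \<noteq> []" using ne by simp_all
    then have "last (G ! Suc i) \<in> set (G ! Suc i)" "hd (G ! i) \<in> set (G ! i)" by simp_all
    then show "last (G ! Suc i) < hd (G ! i)" using all i lessI by blast
  qed
qed

text \<open>
  Values with equal merged label lie in blocks of the same group. A group consisting of a single block
  has no such pair in different blocks and imposes no condition.
\<close>

lemma all_groups_decreasing_iff:
  fixes Bs :: "('n::{finite,linorder}) list list"
  assumes t: "sum_list t = length Bs"
    and dis: "distinct (concat Bs)" and all: "set (concat Bs) = UNIV"
    and dis': "distinct (concat (merge_groups t Bs))" and all': "set (concat (merge_groups t Bs)) = UNIV"
    and ne: "\<And>B. B \<in> set Bs \<Longrightarrow> B \<noteq> []" and srt: "\<And>B. B \<in> set Bs \<Longrightarrow> sorted B"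
  shows "(\<forall>j<length t. t ! j > 1 \<longrightarrow> strictly_decreasing_blocks (block_group t Bs j)) \<longleftrightarrow>
    (\<forall>x y. block_label Bs y < block_label Bs x \<longrightarrow>
       block_label (merge_groups t Bs) x = block_label (merge_groups t Bs) y \<longrightarrow> x < y)"
proof -
  let ?\<beta> = "block_label Bs" and ?\<gamma> = "block_label (merge_groups t Bs)"
  have sub: "B \<in> set Bs" if "B \<in> set (block_group t Bs j)" for B j
    using that by (auto simp: block_group_def dest: in_set_takeD in_set_dropD)
  have dec: "strictly_decreasing_blocks (block_group t Bs j) \<longleftrightarrow>
    (\<forall>a b x y. a < b \<longrightarrow> b < length (block_group t Bs j) \<longrightarrow> x \<in> set (block_group t Bs j ! b) \<longrightarrow>
       y \<in> set (block_group t Bs j ! a) \<longrightarrow> x < y)" for j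
    using ne srt sub by (intro strictly_decreasing_blocks_iff) blast+
  have mem: "x \<in> set (Bs ! ?\<beta> x)" for x using block_label_eq_iff[OF dis all] by blast
  show ?thesis
  proof (intro iffI allI impI)
    fix x y
    assume D: "\<forall>j<length t. t ! j > 1 \<longrightarrow> strictly_decreasing_blocks (block_group t Bs j)"
      and lt: "?\<beta> y < ?\<beta> x" and eq: "?\<gamma> x = ?\<gamma> y"
    define j where "j = ?\<gamma> y"
    have y: "j < length t" "partial_sum t j \<le> ?\<beta> y"
      using block_label_merge_groups[OF assms(1-5), of y j] by (simp_all add: j_def)
    have x: "?\<beta> x < partial_sum t (Suc j)"
      using block_label_merge_groups[OF assms(1-5), of x j] eq by (simp add: j_def)
    define a b where "a = ?\<beta> y - partial_sum t j" and "b = ?\<beta> x - partial_sum t j"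
    have ab: "a < b" "b < t ! j" using lt y(2) x partial_sum_Suc[OF y(1)] by (auto simp: a_def b_def)
    have "block_group t Bs j ! a = Bs ! ?\<beta> y" "block_group t Bs j ! b = Bs ! ?\<beta> x"
      using nth_block_group(1)[OF t y(1), of a] nth_block_group(1)[OF t y(1), of b] ab y(2) lt
      by (simp_all add: a_def b_def)
    moreover have "strictly_decreasing_blocks (block_group t Bs j)" using D y(1) ab by simp
    ultimately show "x < y"
      using mem[of x] mem[of y] ab length_block_group[OF t y(1)] unfolding dec by metis
  next
    fix j
    assume P: "\<forall>x y. ?\<beta> y < ?\<beta> x \<longrightarrow> ?\<gamma> x = ?\<gamma> y \<longrightarrow> x < y" and j: "j < length t"
    show "strictly_decreasing_blocks (block_group t Bs j)"
      unfolding dec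
    proof (intro allI impI)
      fix a b x y
      assume ab: "a < b" "b < length (block_group t Bs j)"
        and x: "x \<in> set (block_group t Bs j ! b)" and y: "y \<in> set (block_group t Bs j ! a)"
      have b: "b < t ! j" using ab length_block_group[OF t j] by simp
      then have a: "a < t ! j" using ab by simp
      have "?\<beta> x = partial_sum t j + b"
        using x nth_block_group[OF t j b] block_label_eq_iff[OF dis all] by simp
      moreover have "?\<beta> y = partial_sum t j + a"
        using y nth_block_group[OF t j a] block_label_eq_iff[OF dis all] by simp
      moreover have "?\<gamma> x = j" "?\<gamma> y = j"
        unfolding block_label_merge_groups[OF assms(1-5)]
        using calculation a b j partial_sum_Suc[OF j] by simp_all
      ultimately show "x < y" using P ab(1) by simp
    qed
  qed
qed

section \<open>Projecting Schubert varieties from the measurable model\<close>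

theorem proposition18:
  fixes f d t :: "nat list"
    and D Dhat :: "('n::{finite,linorder}) flag set"
    and Bs :: "'n list list"
  assumes "dimension_sequence CARD('n) f"
    and "\<not> symmetric_sequence f"
    and "open_orbit f D"
    and "symmetric_refinement CARD('n) f d"
    and "open_orbit d Dhat"
    and "forget f ` Dhat = D"
    and "length t = length f"
    and "\<forall>x\<in>set t. 0 < x"
    and "sum_list t = length d"
    and "\<forall>j<length f. f ! j = sum_list (block_group t d j)"
    and "block_form d Bs"
    and "schubert_variety d (concat Bs) \<in> complementary_schubert d (base_cycle Dhat)"
  shows "(forget f ` schubert_variety d (concat Bs) =
            schubert_variety f (concat (merge_groups t Bs)) \<and>
          schubert_variety f (concat (merge_groups t Bs)) \<in>
            complementary_schubert f (base_cycle D))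
      \<longleftrightarrow> (\<forall>j<length t. t ! j > 1 \<longrightarrow> strictly_decreasing_blocks (block_group t Bs j))"
proof -
  let ?n = "CARD('n)" and ?X = "flag_topology d :: 'n flag topology" and ?Y = "flag_topology f :: 'n flag topology"
  let ?Ms = "merge_groups t Bs" and ?\<beta> = "block_label Bs" and ?\<gamma> = "block_label (merge_groups t Bs)"
  have f: "\<forall>x\<in>set f. 0 < x" "sum_list f = ?n"
    using assms(1) by (simp_all add: dimension_sequence_def)
  have d: "\<forall>x\<in>set d. 0 < x" "sum_list d = ?n"
    and ps: "partial_sums d = (partial_sums f \<union> (\<lambda>r. ?n - r) ` partial_sums f) - {0}"
    using assms(4) by (simp_all add: symmetric_refinement_def dimension_sequence_def)
  have "0 \<notin> partial_sums f"
    using partial_sum_strict_mono[OF f(1), of 0] by (auto simp: partial_sums_iff partial_sum_def[of f 0] Suc_le_eq)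
  then have sub: "partial_sums f \<subseteq> partial_sums d" unfolding ps by blast
  have Bs: "map length Bs = d" "\<And>B. B \<in> set Bs \<Longrightarrow> sorted B" "distinct (concat Bs)" "set (concat Bs) = UNIV"
    using assms(11) by (simp_all add: block_form_def)
  have ne: "B \<noteq> []" if "B \<in> set Bs" for B using that d(1) unfolding Bs(1)[symmetric] by auto
  have t: "sum_list t = length Bs" using assms(9) Bs(1) by auto
  have Ms: "map length ?Ms = f"
    using assms(7,10) Bs(1) by (intro map_length_merge_groups) simp_all
  have Ms': "set (concat ?Ms) = UNIV" "distinct (concat ?Ms)"
    by (rule merge_groups_permutation[OF t Ms f(2) Bs(4)])+
  have lab: "labelling d ?\<beta>" "labelling f ?\<gamma>"
    using labelling_block_label[OF Bs(1,3,4)] labelling_block_label[OF Ms Ms'(2,1)] .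
  have mono: "?\<gamma> i \<le> ?\<gamma> j" if "?\<beta> i \<le> ?\<beta> j" for i j
    by (rule block_label_merge_groups_mono[OF t Bs(3,4) Ms'(2,1) that])
  have S: "schubert_variety d (concat Bs) = ?X closure_of cell (length d) ?\<beta>"
    by (rule schubert_variety_concat[OF Bs(1,3,4)])
  have S': "schubert_variety f (concat ?Ms) = ?Y closure_of cell (length f) ?\<gamma>"
    by (rule schubert_variety_concat[OF Ms Ms'(2,1)])
  have im: "forget f ` schubert_variety d (concat Bs) = schubert_variety f (concat ?Ms)"
    unfolding S S' by (rule forget_image_closure_cell[OF d f sub lab mono])
  have hyp: "schubert_variety d (concat Bs) \<inter> base_cycle Dhat \<noteq> {}"
    "complex_dim ?X (schubert_variety d (concat Bs)) + complex_dim ?X (base_cycle Dhat) = complex_dim ?X (flags d :: 'n flag set)"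
    using assms(12) by (simp_all add: complementary_schubert_def)
  obtain V where V: "V \<in> schubert_variety d (concat Bs)" "V \<in> Dhat" "isotropic V"
    using hyp(1) by (auto simp: base_cycle_def)
  have "forget f V \<in> schubert_variety f (concat ?Ms)" unfolding im[symmetric] using V(1) by (rule imageI)
  moreover have C: "forget f V \<in> base_cycle D"
    unfolding base_cycle_def assms(6)[symmetric] using V(2) forget_isotropic[OF V(3)] by blast
  ultimately have meet: "schubert_variety f (concat ?Ms) \<inter> base_cycle D \<noteq> {}" by blast
  have dimC: "complex_dim ?X (base_cycle Dhat) = complex_dim ?Y (base_cycle D)"
  proof -
    have "complex_dim ?X (base_cycle Dhat) = complex_dim ?X (isotropic_flags d :: 'n flag set)"
      using hyp(1) by (intro complex_dim_base_cycle[OF d(2) assms(5)]) blast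
    also have "\<dots> = complex_dim ?Y (isotropic_flags f :: 'n flag set)"
      by (rule complex_dim_isotropic_flags[OF d f ps sub])
    also have "\<dots> = complex_dim ?Y (base_cycle D)"
      using C by (intro complex_dim_base_cycle[OF f(2) assms(3), symmetric]) blast
    finally show ?thesis .
  qed
  let ?c = "complex_dim ?Y (base_cycle D)"
  have "card (inversions ?\<beta>) + ?c = card (drops ?\<beta>)"
    using hyp(2) unfolding S dimC
    by (simp add: complex_dim_schubert_variety[OF d(2) lab(1)] complex_dim_flags[OF d(2) lab(1)])
  then have count: "card (inversions ?\<gamma>) + ?c = card (drops ?\<gamma>) \<longleftrightarrow>
      (\<forall>i j. ?\<beta> j < ?\<beta> i \<longrightarrow> ?\<gamma> i = ?\<gamma> j \<longrightarrow> i < j)"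
    using mono by (intro card_inversions_drops_refine)
  have "schubert_variety f (concat ?Ms) \<in> schubert_varieties f"
    unfolding schubert_varieties_def schubert_variety_def coordinate_flag_concat[OF Ms Ms'(2,1)]
    using coord_flag_in_flags[OF lab(2)] by blast
  then have "schubert_variety f (concat ?Ms) \<in> complementary_schubert f (base_cycle D) \<longleftrightarrow>
      card (inversions ?\<gamma>) + ?c = card (drops ?\<gamma>)"
    using meet unfolding complementary_schubert_def S'
    by (simp add: complex_dim_schubert_variety[OF f(2) lab(2)] complex_dim_flags[OF f(2) lab(2)])
  also have "\<dots> \<longleftrightarrow> (\<forall>j<length t. t ! j > 1 \<longrightarrow> strictly_decreasing_blocks (block_group t Bs j))"
    unfolding count by (rule all_groups_decreasing_iff[OF t Bs(3,4) Ms'(2,1) ne Bs(2), symmetric])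
  finally show ?thesis using im by simp
qed

end
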